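(* Consider the $3\times3$, rank-two family of problems $\dot A=F_{j,\eta}(t,A)$, $A_{j,\eta}(0)=Y^0_{j,\eta}=E_{11}+h_j^3E_{22}$, with $h_j=2^{-j^2}$, $j\ge 3$, $\eta\in\{+1,-1\}$, defined in the context, and the iterates $Y^n_{j,\eta}$ of the exact-subflow Strang projector-splitting integrator with stepsize $h_j$ and right-hand side $F_{j,\eta}$. (1) For every $j\ge3$ and $\eta\in\{+1,-1\}$, the equation $\dot A=F_{j,\eta}(t,A)$ is defined on $[0,1]$ and, for all $t\in[0,1]$ and $X,Z\in\mathbb R^{3\times3}$, $$\|F_{j,\eta}(t,X)\|_{\mathrm F}\le5,\qquad \|F_{j,\eta}(t,X)-F_{j,\eta}(t,Z)\|_{\mathrm F}\le12\|X-Z\|_{\mathrm F}.$$ For every $Y\in\mathcal M_2$ (the $3\times 3$ matrices of rank two) and $t\in[0,1]$, $$F_{j,\eta}(t,Y)=M_\eta(Y)+R_j(t),\quad M_\eta(Y)\in T_Y\mathcal M_2,\quad \|M_\eta(Y)\|_{\mathrm F}\le4,\quad \|R_j(t)\|_{\mathrm F}\le\varepsilon_j,$$ where $\varepsilon_j:=\beta\sqrt2\,\frac\pi4h_j^2$, and $\|Y^0_{j,\eta}-A_{j,\eta}(0)\|_{\mathrm F}=0$. The two retained singular values of $Y^0_{j,\eta}$ are $1$ and $h_j^3$. Moreover, on $[0,1]\times\mathbb R^{3\times 3}$, $$\max\{\|D_X^2F_{j,\eta}\|_{(\mathrm F,\mathrm F)\to\mathrm F},\ \|\partial_tF_{j,\eta}\|_{\mathrm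 F},\ \|\partial_t^2F_{j,\eta}\|_{\mathrm F},\ \|D_X\partial_tF_{j,\eta}\|_{\mathrm F\to\mathrm F}\}\le123.$$ (2) For all sufficiently large $j$ and both $\eta=+1,-1$, every factor substep in every complete grid step whose endpoint does not exceed $1$ is well defined (the steps are rank-admissible), and $$\max_{\eta\in\{+1,-1\}}\|Y_{j,\eta}^{4j}-A_{j,\eta}(4jh_j)\|_{\mathrm F}\ge\frac{\sqrt2}{64}\,j\,h_j^2.$$ (3) Consequently, robust second-order convergence fails: with $m=n=3$, $r=2$, $B_F=5$, $L_F=12$, $T=1$, $\kappa=123$, there do not exist constants $C>0$ and $h_0>0$ (depending only on these fixed problem-class constants and not on retained singular values) such that for every problem $(F,A^0,Y^0,\delta,\varepsilon)$ in the problem class described in the context and every stepsize $0<h\le h_0$ for which the exact-subflow Strang run is rank-admissible, one has $$\max_{t_n=nh\le T}\|Y^n-A(t_n)\|_{\mathrm F}\le C(\delta+\varepsilon+h^2).$$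
   Context: Notation. $\|\cdot\|_{\mathrm F}$ is the Frobenius norm; $\|\cdot\|_{\mathrm F\to\mathrm F}$ is the induced operator norm of linear maps on matrices, and for a bilinear map $\mathcal T$, $\|\mathcal T\|_{(\mathrm F,\mathrm F)\to\mathrm F}=\sup_{\|X\|_{\mathrm F}=\|Z\|_{\mathrm F}=1}\|\mathcal T[X,Z]\|_{\mathrm F}$. $E_{ab}$ are the $3\times3$ matrix units. $\mathcal M_r=\{Y\in\mathbb R^{m\times n}:\operatorname{rank}Y=r\}$; for $Y=USV^\top\in\mathcal M_r$ ($U,V$ with $r$ orthonormal columns, $S$ nonsingular), $T_Y\mathcal M_r=\{Z:(I-UU^\top)Z(I-VV^\top)=0\}$. Family. For $j\ge3$, $\eta\in\{+1,-1\}$: $h_j:=2^{-j^2}$, $A_{j,\eta}(0):=Y^0_{j,\eta}:=E_{11}+h_j^3E_{22}$. For $X=(x_{ab})\in\mathbb R^{3\times3}$ put $\Omega:=E_{31}-E_{13}$, $$q_\eta(X):=\frac{1+\eta\tanh(x_{31})}{\sqrt{1+\|X\|_{\mathrm F}^2}},\qquad M_\eta(X):=q_\eta(X)(\Omega X-X\Omega).$$ Let $\boldsymbol\nu(\theta):=(0,\cos(\pi\theta/4),\sin(\pi\theta/4))^\top$, $W(\theta):=\boldsymbol\nu(\theta)\boldsymbol\nu(\theta)^\top$, $\psi(x):=x+15x^4-39x^5+34x^6-10x^7$, $\beta:=\max_{0\le x\le1}|\psi'(x)|=27904/16807$, and $$\vartheta_j(t):=\begin{cases}t/h_j,&0\le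 t\le4jh_j,\\4j+4\psi\bigl((t-4jh_j)/(4h_j)\bigr),&4jh_j\le t\le4(j+1)h_j,\\4(j+1),&t\ge4(j+1)h_j.\end{cases}$$ On $[0,1]$ set $R_j(t):=h_j^3\vartheta_j'(t)W'(\vartheta_j(t))$, and $F_{j,\eta}(t,X):=M_\eta(X)+R_j(t)$. $A_{j,\eta}$ is the solution of $\dot A=F_{j,\eta}(t,A)$ with initial value $A_{j,\eta}(0)=E_{11}+h_j^3E_{22}$. Exact-subflow Strang projector-splitting step (rank $r$, right-hand side $F$). Given a time $t$, stepsize $h>0$ and $Y=U_0S_0V_0^\top\in\mathcal M_r$ ($U_0,V_0$ with orthonormal columns, $S_0\in\mathbb R^{r\times r}$ nonsingular), solve exactly, in this order ($t'$ is the running time): ($K_1$) $\dot K=F(t',KV_0^\top)V_0$ on $[t,t+h/2]$, $K(t)=U_0S_0$; QR-factorize $K(t+h/2)=U_1\widehat S_1$ with $U_1^\top U_1=I$. ($S_1$) $\dot S=-U_1^\top F(t',U_1SV_0^\top)V_0$ on $[t,t+h/2]$, $S(t)=\widehat S_1$; set $\widetilde S_1:=S(t+h/2)$. ($L$) $\dot L=F(t',U_1L^\top)^\top U_1$ on $[t,t+h]$, $L(t)=V_0\widetilde S_1^\top$; QR-factorize $L(t+h)=V_1\widehat S_2^\top$ with $V_1^\top V_1=I$. ($S_2$) $\dot S=-U_1^\top F(t',U_1SV_1^\top)V_1$ on $[t+h/2,t+h]$, $S(t+h/2)=\widehat S_2$; set $\widetilde S_2:=S(t+h)$. ($K_2$)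 $\dot K=F(t',KV_1^\top)V_1$ on $[t+h/2,t+h]$, $K(t+h/2)=U_1\widetilde S_2$; QR-factorize $K(t+h)=U_2S^+$ with $U_2^\top U_2=I$. The result is $\Psi_{t,h}(Y):=U_2S^+V_1^\top$, which does not depend on the choice of factorizations. The step is rank-admissible if every K or L factor that must be QR-factorized has rank $r$ and every transferred core ($\widehat S_1,\widetilde S_1,\widehat S_2,\widetilde S_2,S^+$) is nonsingular. The method is $Y^{n+1}:=\Psi_{t_n,h}(Y^n)$, $t_n:=nh$; a run is rank-admissible if all of its steps are. $Y^n_{j,\eta}$ denotes the iterates with $F=F_{j,\eta}$, $h=h_j$, $r=2$, starting from $Y^0_{j,\eta}$. Problem class for given $m,n,r,B_F,L_F,T,\kappa$: a problem $(F,A^0,Y^0,\delta,\varepsilon)$ consists of $F:[0,T]\times\mathbb R^{m\times n}\to\mathbb R^{m\times n}$ (with the derivatives below existing), $A^0\in\mathbb R^{m\times n}$, $Y^0\in\mathcal M_r$, $\delta,\varepsilon\ge0$, such that for all $t\in[0,T]$ and $X,Z\in\mathbb R^{m\times n}$: $\|F(t,X)\|_{\mathrm F}\le B_F$; $\|F(t,X)-F(t,Z)\|_{\mathrm F}\le L_F\|X-Z\|_{\mathrm F}$; for all $Y\in\mathcal M_r$, $F(t,Y)=M(t,Y)+R(t,Y)$ with $M(t,Y)\in T_Y\mathcal M_r$, $\|M(t,Y)\|_{\mathrm F}\le B_F$, $\|R(t,Y)\|_{\mathrm F}\le\varepsilon$; $\|Y^0-A^0\|_{\mathrm F}\le\delta$;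 and $\|D_X^2F\|_{(\mathrm F,\mathrm F)\to\mathrm F}$, $\|\partial_tF\|_{\mathrm F}$, $\|\partial_t^2F\|_{\mathrm F}$, $\|D_X\partial_tF\|_{\mathrm F\to\mathrm F}\le\kappa$. Here $A$ solves $\dot A=F(t,A)$, $A(0)=A^0$, and $Y^n$ are the Strang iterates started at $Y^0$. *)

theory Defs
  imports "HOL-Analysis.Analysis"
begin

text \<open>
  An \<open>m \<times> n\<close> matrix is an element of \<^typ>\<open>real^'n^'m\<close>; the library norm on this type is the
  Frobenius norm.  The rank \<open>r\<close> is \<open>CARD('r)\<close> for an index type \<open>'r\<close>, which is passed as
  \<open>TYPE('r)\<close> where it does not occur in the types of the other arguments.
\<close>

section \<open>Fixed-rank matrices\<close>

definition fixed_rank :: "'r::finite itself \<Rightarrow> (real^'n^'m) set" where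
  "fixed_rank _ = {Y. rank Y = CARD('r)}"

definition orthonormal_cols :: "real^'r^'m \<Rightarrow> bool" where
  "orthonormal_cols U \<longleftrightarrow> transpose U ** U = mat 1"

definition low_rank_factors ::
  "real^'n^'m \<Rightarrow> real^'r^'m \<Rightarrow> real^'r^'r \<Rightarrow> real^'r^'n \<Rightarrow> bool" where
  "low_rank_factors Y U S V \<longleftrightarrow>
     orthonormal_cols U \<and> orthonormal_cols V \<and> invertible S \<and> Y = U ** S ** transpose V"

text \<open>
  The tangent space does not depend on the factorization \<open>Y = U S V\<^sup>T\<close>, which exists exactly for
  \<open>Y\<close> of rank \<open>r\<close>; for any other \<open>Y\<close> the set below is empty.
\<close>

definition tangent_space :: "'r::finite itself \<Rightarrow> real^'n^'m \<Rightarrow> (real^'n^'m) set" where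
  "tangent_space _ Y = {Z. \<exists>(U::real^'r^'m) S V. low_rank_factors Y U S V \<and>
     (mat 1 - U ** transpose U) ** Z ** (mat 1 - V ** transpose V) = 0}"

text \<open>
  The entries of \<open>\<sigma>\<close>, in some order, are the \<open>r\<close> nonzero singular values of a matrix of rank \<open>r\<close>
  (those retained in its compact singular value decomposition).
\<close>

definition retained_singular_values :: "real^'n^'m \<Rightarrow> real^'r \<Rightarrow> bool" where
  "retained_singular_values Y \<sigma> \<longleftrightarrow> (\<forall>i. \<sigma> $ i > 0) \<and>
     (\<exists>(U::real^'r^'m) V. orthonormal_cols U \<and> orthonormal_cols V \<and>
        Y = U ** (\<chi> i k. if i = k then \<sigma> $ i else 0) ** transpose V)"


section \<open>The Strang projector-splitting integrator with exact subflows\<close>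

definition ode_solution ::
  "(real \<Rightarrow> 'a::real_normed_vector \<Rightarrow> 'a) \<Rightarrow> real \<Rightarrow> real \<Rightarrow> 'a \<Rightarrow> (real \<Rightarrow> 'a) \<Rightarrow> bool" where
  "ode_solution f a b x0 x \<longleftrightarrow> x a = x0 \<and>
     (\<forall>s\<in>{a..b}. (x has_vector_derivative f s (x s)) (at s within {a..b}))"

text \<open>
  All that the integrator uses of a QR factorization is orthonormality of the first factor;
  triangularity of the second is not required, as the result of a step is independent of the
  choice of factorization.
\<close>

definition qr_factors :: "real^'r^'m \<Rightarrow> real^'r^'m \<Rightarrow> real^'r^'r \<Rightarrow> bool" where
  "qr_factors X Q R \<longleftrightarrow> orthonormal_cols Q \<and> X = Q ** R"

text \<open>
  The data computed in one step; \<open>tr_K1\<close>, \<open>tr_S1\<close>, \<open>tr_L\<close>, \<open>tr_S2\<close>, \<open>tr_K2\<close> are the trajectories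
  of the five subflows, and \<open>tr_Sh1\<close>, \<open>tr_Sh2\<close> are the cores denoted by \<open>S\<close> with a hat.
\<close>

record ('m::finite, 'n::finite, 'r::finite) strang_trace =
  tr_U0 :: "real^'r^'m"
  tr_S0 :: "real^'r^'r"
  tr_V0 :: "real^'r^'n"
  tr_K1 :: "real \<Rightarrow> real^'r^'m"
  tr_U1 :: "real^'r^'m"
  tr_Sh1 :: "real^'r^'r"
  tr_S1 :: "real \<Rightarrow> real^'r^'r"
  tr_L :: "real \<Rightarrow> real^'r^'n"
  tr_V1 :: "real^'r^'n"
  tr_Sh2 :: "real^'r^'r"
  tr_S2 :: "real \<Rightarrow> real^'r^'r"
  tr_K2 :: "real \<Rightarrow> real^'r^'m"
  tr_U2 :: "real^'r^'m"
  tr_Sp :: "real^'r^'r"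

definition K_field ::
  "(real \<Rightarrow> real^'n^'m \<Rightarrow> real^'n^'m) \<Rightarrow> real^'r^'n \<Rightarrow> real \<Rightarrow> real^'r^'m \<Rightarrow> real^'r^'m" where
  "K_field F V s K = F s (K ** transpose V) ** V"

definition S_field ::
  "(real \<Rightarrow> real^'n^'m \<Rightarrow> real^'n^'m) \<Rightarrow> real^'r^'m \<Rightarrow> real^'r^'n \<Rightarrow> real \<Rightarrow> real^'r^'r \<Rightarrow> real^'r^'r"
  where "S_field F U V s S = - (transpose U ** F s (U ** S ** transpose V) ** V)"

definition L_field ::
  "(real \<Rightarrow> real^'n^'m \<Rightarrow> real^'n^'m) \<Rightarrow> real^'r^'m \<Rightarrow> real \<Rightarrow> real^'r^'n \<Rightarrow> real^'r^'n" where
  "L_field F U s L = transpose (F s (U ** transpose L)) ** U"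

definition is_strang_trace ::
  "(real \<Rightarrow> real^'n^'m \<Rightarrow> real^'n^'m) \<Rightarrow> real \<Rightarrow> real \<Rightarrow> real^'n^'m \<Rightarrow>
     ('m::finite,'n::finite,'r::finite) strang_trace \<Rightarrow> bool"
  where
  "is_strang_trace F t h Y d \<longleftrightarrow>
     low_rank_factors Y (tr_U0 d) (tr_S0 d) (tr_V0 d) \<and>
     ode_solution (K_field F (tr_V0 d)) t (t + h/2) (tr_U0 d ** tr_S0 d) (tr_K1 d) \<and>
     qr_factors (tr_K1 d (t + h/2)) (tr_U1 d) (tr_Sh1 d) \<and>
     ode_solution (S_field F (tr_U1 d) (tr_V0 d)) t (t + h/2) (tr_Sh1 d) (tr_S1 d) \<and>
     ode_solution (L_field F (tr_U1 d)) t (t + h)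
       (tr_V0 d ** transpose (tr_S1 d (t + h/2))) (tr_L d) \<and>
     qr_factors (tr_L d (t + h)) (tr_V1 d) (transpose (tr_Sh2 d)) \<and>
     ode_solution (S_field F (tr_U1 d) (tr_V1 d)) (t + h/2) (t + h) (tr_Sh2 d) (tr_S2 d) \<and>
     ode_solution (K_field F (tr_V1 d)) (t + h/2) (t + h)
       (tr_U1 d ** tr_S2 d (t + h)) (tr_K2 d) \<and>
     qr_factors (tr_K2 d (t + h)) (tr_U2 d) (tr_Sp d)"

definition strang_result :: "('m::finite,'n::finite,'r::finite) strang_trace \<Rightarrow> real^'n^'m" where
  "strang_result d = tr_U2 d ** tr_Sp d ** transpose (tr_V1 d)"

definition rank_admissible_trace ::
  "real \<Rightarrow> real \<Rightarrow> ('m::finite,'n::finite,'r::finite) strang_trace \<Rightarrow> bool" where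
  "rank_admissible_trace t h d \<longleftrightarrow>
     rank (tr_K1 d (t + h/2)) = CARD('r) \<and>
     rank (tr_L d (t + h)) = CARD('r) \<and>
     rank (tr_K2 d (t + h)) = CARD('r) \<and>
     invertible (tr_Sh1 d) \<and> invertible (tr_S1 d (t + h/2)) \<and>
     invertible (tr_Sh2 d) \<and> invertible (tr_S2 d (t + h)) \<and>
     invertible (tr_Sp d)"

text \<open>
  \<open>strang_step TYPE('r) F t h Y Y'\<close> is the graph of the step map: \<open>Y'\<close> is obtained from \<open>Y\<close> with
  some admitted choice of factorizations.
\<close>

definition strang_step :: "'r::finite itself \<Rightarrow> (real \<Rightarrow> real^'n^'m \<Rightarrow> real^'n^'m) \<Rightarrow>
    real \<Rightarrow> real \<Rightarrow> real^'n^'m \<Rightarrow> real^'n^'m \<Rightarrow> bool" where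
  "strang_step _ F t h Y Y' \<longleftrightarrow>
     (\<exists>d::('m,'n,'r) strang_trace. is_strang_trace F t h Y d \<and> Y' = strang_result d)"

definition rank_admissible_step :: "'r::finite itself \<Rightarrow> (real \<Rightarrow> real^'n^'m \<Rightarrow> real^'n^'m) \<Rightarrow>
    real \<Rightarrow> real \<Rightarrow> real^'n^'m \<Rightarrow> bool" where
  "rank_admissible_step _ F t h Y \<longleftrightarrow>
     (\<exists>d::('m,'n,'r) strang_trace. is_strang_trace F t h Y d) \<and>
     (\<forall>d::('m,'n,'r) strang_trace. is_strang_trace F t h Y d \<longrightarrow> rank_admissible_trace t h d)"

text \<open>Only the complete grid steps inside \<open>[0,T]\<close> are constrained in the next two definitions.\<close>

definition strang_run :: "'r::finite itself \<Rightarrow> (real \<Rightarrow> real^'n^'m \<Rightarrow> real^'n^'m) \<Rightarrow>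
    real \<Rightarrow> real \<Rightarrow> real^'n^'m \<Rightarrow> (nat \<Rightarrow> real^'n^'m) \<Rightarrow> bool" where
  "strang_run r F T h Y0 Y \<longleftrightarrow> Y 0 = Y0 \<and>
     (\<forall>n. real (Suc n) * h \<le> T \<longrightarrow> strang_step r F (real n * h) h (Y n) (Y (Suc n)))"

definition rank_admissible_run :: "'r::finite itself \<Rightarrow> (real \<Rightarrow> real^'n^'m \<Rightarrow> real^'n^'m) \<Rightarrow>
    real \<Rightarrow> real \<Rightarrow> (nat \<Rightarrow> real^'n^'m) \<Rightarrow> bool" where
  "rank_admissible_run r F T h Y \<longleftrightarrow>
     (\<forall>n. real (Suc n) * h \<le> T \<longrightarrow> rank_admissible_step r F (real n * h) h (Y n))"

definition max_grid_error ::
  "real \<Rightarrow> real \<Rightarrow> (nat \<Rightarrow> real^'n^'m) \<Rightarrow> (real \<Rightarrow> real^'n^'m) \<Rightarrow> real" where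
  "max_grid_error T h Y A =
     Max ((\<lambda>n. norm (Y n - A (real n * h))) ` {n. real n * h \<le> T})"


section \<open>The problem class\<close>

definition bilinear_norm ::
  "('a::real_normed_vector \<Rightarrow> 'a \<Rightarrow> 'b::real_normed_vector) \<Rightarrow> real" where
  "bilinear_norm B = (SUP p\<in>{p. norm (fst p) = 1 \<and> norm (snd p) = 1}. norm (B (fst p) (snd p)))"

text \<open>
  Existence on \<open>[0,T]\<close>, and a common bound \<open>\<kappa>\<close>, of the derivatives \<open>D\<^sub>X\<^sup>2F\<close>, \<open>\<partial>\<^sub>tF\<close>, \<open>\<partial>\<^sub>t\<^sup>2F\<close>,
  \<open>D\<^sub>X\<partial>\<^sub>tF\<close>; time derivatives are one-sided at the endpoints.
\<close>

definition derivatives_bounded ::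
  "(real \<Rightarrow> 'a::euclidean_space \<Rightarrow> 'a) \<Rightarrow> real \<Rightarrow> real \<Rightarrow> bool" where
  "derivatives_bounded F T \<kappa> \<longleftrightarrow>
     (\<exists>(DF :: real \<Rightarrow> 'a \<Rightarrow> 'a \<Rightarrow>\<^sub>L 'a) (D2F :: real \<Rightarrow> 'a \<Rightarrow> 'a \<Rightarrow>\<^sub>L 'a \<Rightarrow>\<^sub>L 'a)
       (Ft :: real \<Rightarrow> 'a \<Rightarrow> 'a) (Ftt :: real \<Rightarrow> 'a \<Rightarrow> 'a) (DFt :: real \<Rightarrow> 'a \<Rightarrow> 'a \<Rightarrow> 'a).
       \<forall>t\<in>{0..T}. \<forall>X.
         (F t has_derivative blinfun_apply (DF t X)) (at X) \<and>
         (DF t has_derivative blinfun_apply (D2F t X)) (at X) \<and>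
         ((\<lambda>s. F s X) has_vector_derivative Ft t X) (at t within {0..T}) \<and>
         ((\<lambda>s. Ft s X) has_vector_derivative Ftt t X) (at t within {0..T}) \<and>
         (Ft t has_derivative DFt t X) (at X) \<and>
         bilinear_norm (\<lambda>V W. blinfun_apply (blinfun_apply (D2F t X) V) W) \<le> \<kappa> \<and>
         norm (Ft t X) \<le> \<kappa> \<and> norm (Ftt t X) \<le> \<kappa> \<and> onorm (DFt t X) \<le> \<kappa>)"

definition problem_class :: "'r::finite itself \<Rightarrow> real \<Rightarrow> real \<Rightarrow> real \<Rightarrow> real \<Rightarrow>
    (real \<Rightarrow> real^'n^'m \<Rightarrow> real^'n^'m) \<Rightarrow> real^'n^'m \<Rightarrow> real^'n^'m \<Rightarrow> real \<Rightarrow> real \<Rightarrow> bool" where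
  "problem_class r B\<^sub>F L\<^sub>F T \<kappa> F A0 Y0 \<delta> \<epsilon> \<longleftrightarrow>
     Y0 \<in> fixed_rank r \<and> \<delta> \<ge> 0 \<and> \<epsilon> \<ge> 0 \<and>
     (\<forall>t\<in>{0..T}. \<forall>X. norm (F t X) \<le> B\<^sub>F) \<and>
     (\<forall>t\<in>{0..T}. \<forall>X Z. norm (F t X - F t Z) \<le> L\<^sub>F * norm (X - Z)) \<and>
     (\<exists>M R. \<forall>t\<in>{0..T}. \<forall>Y\<in>fixed_rank r. F t Y = M t Y + R t Y \<and>
        M t Y \<in> tangent_space r Y \<and> norm (M t Y) \<le> B\<^sub>F \<and> norm (R t Y) \<le> \<epsilon>) \<and>
     norm (Y0 - A0) \<le> \<delta> \<and>
     derivatives_bounded F T \<kappa>"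


section \<open>The family\<close>

definition matrix_unit :: "3 \<Rightarrow> 3 \<Rightarrow> real^3^3" where
  "matrix_unit a b = (\<chi> i k. if i = a \<and> k = b then 1 else 0)"

definition hj :: "nat \<Rightarrow> real" where
  "hj j = 1 / 2 ^ (j^2)"

definition Y0_fam :: "nat \<Rightarrow> real^3^3" where
  "Y0_fam j = matrix_unit 1 1 + (hj j)^3 *\<^sub>R matrix_unit 2 2"

definition Omega :: "real^3^3" where
  "Omega = matrix_unit 3 1 - matrix_unit 1 3"

definition q_fam :: "real \<Rightarrow> real^3^3 \<Rightarrow> real" where
  "q_fam \<eta> X = (1 + \<eta> * tanh (X $ 3 $ 1)) / sqrt (1 + (norm X)^2)"

definition M_fam :: "real \<Rightarrow> real^3^3 \<Rightarrow> real^3^3" where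
  "M_fam \<eta> X = q_fam \<eta> X *\<^sub>R (Omega ** X - X ** Omega)"

definition nu :: "real \<Rightarrow> real^3" where
  "nu \<theta> = vector [0, cos (pi * \<theta> / 4), sin (pi * \<theta> / 4)]"

definition W :: "real \<Rightarrow> real^3^3" where
  "W \<theta> = (\<chi> i k. nu \<theta> $ i * nu \<theta> $ k)"

definition psi :: "real \<Rightarrow> real" where
  "psi x = x + 15 * x^4 - 39 * x^5 + 34 * x^6 - 10 * x^7"

text \<open>The supremum is attained at \<open>x = 3/7\<close>, with value \<open>27904/16807\<close>.\<close>

definition beta_psi :: real where
  "beta_psi = (SUP x\<in>{0..1}. \<bar>deriv psi x\<bar>)"

text \<open>
  The first branch is used for negative \<open>t\<close> as well, so that the two-sided derivative at
  \<open>t = 0\<close> is the one-sided one.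
\<close>

definition vartheta :: "nat \<Rightarrow> real \<Rightarrow> real" where
  "vartheta j t =
     (if t \<le> 4 * real j * hj j then t / hj j
      else if t \<le> 4 * (real j + 1) * hj j
        then 4 * real j + 4 * psi ((t - 4 * real j * hj j) / (4 * hj j))
      else 4 * (real j + 1))"

definition R_fam :: "nat \<Rightarrow> real \<Rightarrow> real^3^3" where
  "R_fam j t = ((hj j)^3 * deriv (vartheta j) t) *\<^sub>R vector_derivative W (at (vartheta j t))"

definition F_fam :: "nat \<Rightarrow> real \<Rightarrow> real \<Rightarrow> real^3^3 \<Rightarrow> real^3^3" where
  "F_fam j \<eta> t X = M_fam \<eta> X + R_fam j t"

definition eps_fam :: "nat \<Rightarrow> real" where
  "eps_fam j = beta_psi * sqrt 2 * (pi / 4) * (hj j)^2"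

end

theory Submission
  imports Defs
begin

text \<open>
  Up to \<open>O(h\<^sup>3)\<close> an iterate is a rank-one matrix \<open>u v\<^sup>T\<close> with unit vectors near the first axis, and
  each substep rotates \<open>u\<close> and \<open>v\<close> by projections of the generator \<open>\<Omega>\<close>, at the common speed \<open>q\<close>. The
  small singular value only decides which projections occur: the forcing drags the second singular
  direction along \<open>\<nu>(\<vartheta>(t))\<close>, turning it by a fixed angle per step however small \<open>h\<close> is.

  If \<open>q\<close> were constant, the K and S substeps next to each other would cancel on \<open>v\<close>, and a step would
  be exact. But \<open>q\<close> depends on the entry \<open>(3,1)\<close>, which moves at different rates in the two substeps, so
  a step leaves a kick \<open>\<eta> h\<^sup>2 g\<close> in the second component of \<open>v\<close>, where \<open>g\<close> depends on the angle of \<open>\<nu>\<close>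
  only. Four steps turn \<open>\<nu>\<close> by \<open>\<pi>\<close> and the kicks add up to \<open>\<eta> \<surd>2/32 h\<^sup>2\<close>, while the exact flow keeps
  this component zero. Hence \<open>\<eta> = 1\<close> alone already yields an error of order \<open>j h\<^sup>2\<close> after \<open>4j\<close> steps,
  whereas \<open>\<epsilon>\<close> is of order \<open>h\<^sup>2\<close>.
\<close>


section \<open>Linear growth estimates and the Picard-Lindelof theorem\<close>

text \<open>The small singular value h^3 ties two scales together. Turning its direction by a fixed
  angle per step takes a forcing of size h^2 only, the size of \<epsilon>, and the direct
  contribution of the forcing to a step is O(h^3), invisible at the order h^2 of the kicks. But the
  planes used by the substeps are determined by a component of size h^3, so all errors of an iterate
  have to be controlled relative to h^3. The normals come out right because this factor cancels when
  a null vector is tested against the small component. The two kicks of a step come from its two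
  junctions, K with S in the first half and S with K in the second. They have opposite signs and see
  the angles at the two ends of the step, so over a period they would telescope to zero. What
  survives is due to the weight cos^2 at the midpoint angle, contributed by the left plane, which
  favours the positive differences over the negative ones.\<close>

lemma deriv_le_imp_growth:
  fixes f :: "real \<Rightarrow> real"
  assumes "a \<le> b"
    and D: "\<And>s. s \<in> {a..b} \<Longrightarrow> (f has_vector_derivative f' s) (at s within {a..b})"
    and le: "\<And>s. s \<in> {a..b} \<Longrightarrow> f' s \<le> c"
  shows "f b \<le> f a + c * (b - a)"
proof -
  obtain x where x: "x \<in> {a..b}" "f b - f a = (b - a) *\<^sub>R f' x"
    using mvt_very_simple[of a b f "\<lambda>x h. h *\<^sub>R f' x"] assms(1) D
    unfolding has_vector_derivative_def by auto
  then have "f b - f a \<le> c * (b - a)"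
    using le[OF x(1)] assms(1) by (simp add: mult_right_mono mult.commute)
  then show ?thesis by simp
qed

text \<open>Only the inner product of \<open>x s\<close> with its derivative has to be bounded, so a
  skew-symmetric part of the derivative costs nothing. This is what lets a rotating error be bounded
  by its source terms alone.\<close>

lemma norm_growth_le:
  fixes x :: "real \<Rightarrow> 'a::real_inner"
  assumes "a \<le> b"
    and D: "\<And>s. s \<in> {a..b} \<Longrightarrow> (x has_vector_derivative d s) (at s within {a..b})"
    and le: "\<And>s. s \<in> {a..b} \<Longrightarrow> x s \<bullet> d s \<le> c * norm (x s)" and c: "c \<ge> 0"
  shows "norm (x b) \<le> norm (x a) + c * (b - a)"
proof (rule field_le_epsilon)
  fix e :: real assume e: "e > 0"
  \<comment> \<open>The norm is not differentiable at 0; \<open>g\<close> is a smooth majorant whose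
    derivative is still at most \<open>c\<close>, at the price of \<open>e\<close>.\<close>
  define g where "g = (\<lambda>s. sqrt (x s \<bullet> x s + e^2))"
  have pos: "x s \<bullet> x s + e^2 > 0" for s
    using e by (simp add: add_nonneg_pos)
  have gd: "(g has_vector_derivative (x s \<bullet> d s) / g s) (at s within {a..b})" if "s \<in> {a..b}" for s
  proof -
    have "((\<lambda>s. x s \<bullet> x s + e^2) has_vector_derivative 2 * (x s \<bullet> d s)) (at s within {a..b})"
      using D[OF that] unfolding has_vector_derivative_def
      by (auto intro!: derivative_eq_intros simp: inner_commute algebra_simps)
    then have r: "((\<lambda>s. x s \<bullet> x s + e^2) has_real_derivative 2 * (x s \<bullet> d s)) (at s within {a..b})"
      by (simp add: has_real_derivative_iff_has_vector_derivative)
    have "(g has_real_derivative inverse (g s) / 2 * (2 * (x s \<bullet> d s))) (at s within {a..b})"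
      unfolding g_def by (rule DERIV_chain2[OF DERIV_real_sqrt[OF pos] r])
    then show ?thesis
      by (simp add: has_real_derivative_iff_has_vector_derivative field_simps)
  qed
  have gn: "norm (x s) \<le> g s" for s
    unfolding g_def by (simp add: norm_eq_sqrt_inner)
  have gp: "g s > 0" for s unfolding g_def using pos[of s] by simp
  have "(x s \<bullet> d s) / g s \<le> c" if "s \<in> {a..b}" for s
  proof -
    have "x s \<bullet> d s \<le> c * g s" using le[OF that] gn[of s] c
      by (meson mult_left_mono order_trans)
    then show ?thesis using gp[of s] by (simp add: field_simps)
  qed
  from deriv_le_imp_growth[OF assms(1) gd this] have "g b \<le> g a + c * (b - a)" by simp
  moreover have "g a \<le> norm (x a) + e"
  proof -
    have "g a \<le> sqrt (x a \<bullet> x a) + sqrt (e^2)"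
      unfolding g_def by (rule sqrt_add_le_add_sqrt) auto
    then show ?thesis using e by (simp add: norm_eq_sqrt_inner)
  qed
  ultimately show "norm (x b) \<le> norm (x a) + c * (b - a) + e"
    using gn[of b] by linarith
qed

lemma has_vector_derivative_subinterval:
  fixes x :: "real \<Rightarrow> 'a::real_normed_vector"
  assumes "\<And>s. s \<in> {a..b} \<Longrightarrow> (x has_vector_derivative d s) (at s within {a..b})" "a \<le> a'" "b' \<le> b"
    "s \<in> {a'..b'}"
  shows "(x has_vector_derivative d s) (at s within {a'..b'})"
  using assms by (intro has_vector_derivative_within_subset[OF assms(1)]) auto

lemma norm_eq_if_orthogonal_deriv:
  fixes x :: "real \<Rightarrow> 'a::real_inner"
  assumes "s \<in> {a..b}"
    and D: "\<And>s. s \<in> {a..b} \<Longrightarrow> (x has_vector_derivative d s) (at s within {a..b})"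
    and ort: "\<And>s. s \<in> {a..b} \<Longrightarrow> x s \<bullet> d s = 0"
  shows "norm (x s) = norm (x a)"
proof -
  have D2: "((\<lambda>s. x s \<bullet> x s) has_vector_derivative 2 * (x s \<bullet> d s)) (at s within {a..b})"
    if "s \<in> {a..b}" for s
    using D[OF that] unfolding has_vector_derivative_def
    by (auto intro!: derivative_eq_intros simp: inner_commute algebra_simps)
  then have D3: "((\<lambda>s. x s \<bullet> x s) has_vector_derivative 0) (at s within {a..b})" if "s \<in> {a..b}" for s
    using D2[OF that] ort[OF that] by simp
  have D4: "((\<lambda>s. x s \<bullet> x s) has_vector_derivative 0) (at r within {a..s})" if "r \<in> {a..s}" for r
    using has_vector_derivative_subinterval[OF D3, of a s r] that assms(1) by auto
  have D5: "((\<lambda>s. - (x s \<bullet> x s)) has_vector_derivative 0) (at r within {a..s})" if "r \<in> {a..s}" for r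
    using has_vector_derivative_minus[OF D4[OF that]] by simp
  have "x s \<bullet> x s \<le> x a \<bullet> x a + 0 * (s - a)"
    by (rule deriv_le_imp_growth[where f'="\<lambda>_. 0"]) (use assms(1) D4 in auto)
  moreover have "- (x s \<bullet> x s) \<le> - (x a \<bullet> x a) + 0 * (s - a)"
    by (rule deriv_le_imp_growth[where f'="\<lambda>_. 0"]) (use assms(1) D5 in auto)
  ultimately have "x s \<bullet> x s = x a \<bullet> x a" by simp
  then show ?thesis by (simp add: norm_eq_sqrt_inner)
qed

lemma norm_diff_le_deriv_bound:
  fixes x :: "real \<Rightarrow> 'a::real_inner"
  assumes "s \<in> {a..b}"
    and D: "\<And>s. s \<in> {a..b} \<Longrightarrow> (x has_vector_derivative d s) (at s within {a..b})"
    and le: "\<And>s. s \<in> {a..b} \<Longrightarrow> norm (d s) \<le> c"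
  shows "norm (x s - x a) \<le> c * (s - a)"
proof -
  have c: "c \<ge> 0" using le[OF assms(1)] norm_ge_zero order_trans by blast
  have "norm (x s - x a) \<le> norm (x a - x a) + c * (s - a)"
  proof (rule norm_growth_le[where x="\<lambda>r. x r - x a" and d=d])
    show "((\<lambda>r. x r - x a) has_vector_derivative d r) (at r within {a..s})" if "r \<in> {a..s}" for r
      using has_vector_derivative_subinterval[OF D, of a s r] that assms(1)
      by (auto intro: derivative_eq_intros)
    show "(x r - x a) \<bullet> d r \<le> c * norm (x r - x a)" if "r \<in> {a..s}" for r
    proof -
      have "(x r - x a) \<bullet> d r \<le> norm (x r - x a) * norm (d r)" by (rule norm_cauchy_schwarz)
      also have "\<dots> \<le> norm (x r - x a) * c"
        using that assms(1) by (intro mult_left_mono le) auto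
      finally show ?thesis by (simp add: mult.commute)
    qed
  qed (use assms(1) c in auto)
  then show ?thesis by simp
qed

lemma ode_solution_unique:
  fixes f :: "real \<Rightarrow> 'a::real_inner \<Rightarrow> 'a"
  assumes lip: "\<And>s x y. s \<in> {a..b} \<Longrightarrow> norm (f s x - f s y) \<le> L * norm (x - y)"
    and X: "ode_solution f a b x0 x" and Y: "ode_solution f a b x0 y" and t: "t \<in> {a..b}"
  shows "x t = y t"
proof -
  \<comment> \<open>The factor \<open>exp (- L * (s - a))\<close> absorbs the Lipschitz growth:
    \<open>z s \<bullet> d s\<close> becomes nonpositive, so \<open>z\<close> cannot leave
    0.\<close>
  define z where "z = (\<lambda>s. exp (- L * (s - a)) *\<^sub>R (x s - y s))"
  define d where "d = (\<lambda>s. exp (- L * (s - a)) *\<^sub>R ((f s (x s) - f s (y s)) - L *\<^sub>R (x s - y s)))"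
  have zd: "(z has_vector_derivative d s) (at s within {a..b})" if "s \<in> {a..b}" for s
  proof -
    have 1: "((\<lambda>s. x s - y s) has_vector_derivative (f s (x s) - f s (y s))) (at s within {a..b})"
      using X Y that unfolding ode_solution_def by (intro has_vector_derivative_diff) auto
    have 2: "((\<lambda>s. exp (- L * (s - a))) has_real_derivative - L * exp (- L * (s - a))) (at s within {a..b})"
      by (auto intro!: derivative_eq_intros)
    show ?thesis unfolding z_def d_def
      using has_vector_derivative_scaleR[OF 2 1] by (simp add: algebra_simps)
  qed
  have "z s \<bullet> d s \<le> 0 * norm (z s)" if "s \<in> {a..b}" for s
  proof -
    have "(x s - y s) \<bullet> (f s (x s) - f s (y s)) \<le> norm (x s - y s) * (L * norm (x s - y s))"
      by (rule order_trans[OF norm_cauchy_schwarz mult_left_mono[OF lip[OF that]]]) simp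
    also have "\<dots> = L * ((x s - y s) \<bullet> (x s - y s))"
      by (simp add: dot_square_norm power2_eq_square)
    finally have "(x s - y s) \<bullet> ((f s (x s) - f s (y s)) - L *\<^sub>R (x s - y s)) \<le> 0"
      by (simp add: inner_diff_right)
    then show ?thesis unfolding z_def d_def
      by (simp add: mult_nonneg_nonpos)
  qed
  note le = this
  have "norm (z t) \<le> norm (z a) + 0 * (t - a)"
  proof (rule norm_growth_le[where d=d])
    show "(z has_vector_derivative d s) (at s within {a..t})" if "s \<in> {a..t}" for s
      using has_vector_derivative_subinterval[OF zd, of a t s] that t by auto
    show "z s \<bullet> d s \<le> 0 * norm (z s)" if "s \<in> {a..t}" for s
      using le[of s] that t by auto
  qed (use t in auto)
  then have "z t = 0" using X Y by (simp add: z_def[THEN fun_cong, of a] ode_solution_def)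
  then show ?thesis by (simp add: z_def)
qed

text \<open>Picard's map becomes a contraction for the norm weighted by \<open>exp (- \<lambda> (t - a))\<close>, so that a
  single fixed point covers the whole interval.\<close>

lemma ode_solution_exists:
  fixes f :: "real \<Rightarrow> 'a::banach \<Rightarrow> 'a"
  assumes ab: "a \<le> b" and cont: "continuous_on ({a..b} \<times> UNIV) (\<lambda>p. f (fst p) (snd p))"
    and lip: "\<And>s x y. s \<in> {a..b} \<Longrightarrow> norm (f s x - f s y) \<le> L * norm (x - y)" and L: "L \<ge> 0"
  shows "\<exists>x. ode_solution f a b x0 x"
proof -
  \<comment> \<open>This makes the contraction factor \<open>L / l\<close> at most 1/2 and keeps
    \<open>l\<close> positive even for \<open>L = 0\<close>.\<close>
  define l where "l = 2 * L + 1"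
  have l: "l > 0" "L / l \<le> 1/2" using L by (auto simp: l_def field_simps)
  \<comment> \<open>Clamping time to \<open>{a..b}\<close> extends functions on the interval to
    bounded continuous functions on the line, a complete space in which the fixed point theorem
    applies.\<close>
  define c where "c = (\<lambda>t. max a (min b t))"
  have c: "c t \<in> {a..b}" for t using ab by (auto simp: c_def)
  have c_id: "c t = t" if "t \<in> {a..b}" for t using that by (auto simp: c_def)
  have c_cont: "continuous_on UNIV c" unfolding c_def by (intro continuous_intros)
  \<comment> \<open>A point \<open>p\<close> of this space stands for the weighted candidate; the
    candidate solution itself is \<open>p\<close> multiplied by
    \<open>exp (l * (s - a))\<close>.\<close>
  define rhs where "rhs = (\<lambda>(p :: real \<Rightarrow>\<^sub>C 'a) s. f s (exp (l * (s - a)) *\<^sub>R apply_bcontfun p s))"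
  have rhs_cont: "continuous_on {a..b} (rhs p)" for p
  proof -
    have "continuous_on {a..b} (\<lambda>s. (s, exp (l * (s - a)) *\<^sub>R apply_bcontfun p s))"
      by (intro continuous_intros continuous_on_apply_bcontfun)
    then show ?thesis unfolding rhs_def
      using continuous_on_compose2[OF cont, of "{a..b}" "\<lambda>s. (s, exp (l * (s - a)) *\<^sub>R apply_bcontfun p s)"]
      by auto
  qed
  define I where "I = (\<lambda>p t. x0 + integral {a..t} (rhs p))"
  have I_deriv: "(I p has_vector_derivative rhs p t) (at t within {a..b})" if "t \<in> {a..b}" for p t
    unfolding I_def using integral_has_vector_derivative[OF rhs_cont that, of p]
    by (auto intro!: derivative_eq_intros)
  have I_cont: "continuous_on {a..b} (I p)" for p
    using I_deriv continuous_on_vector_derivative by blast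
  define G where "G = (\<lambda>p t. exp (- l * (c t - a)) *\<^sub>R I p (c t))"
  have G_b: "G p \<in> bcontfun" for p
  proof -
    have gc: "continuous_on {a..b} (\<lambda>t. exp (- l * (t - a)) *\<^sub>R I p t)"
      by (intro continuous_intros I_cont)
    have "bounded ((\<lambda>t. exp (- l * (t - a)) *\<^sub>R I p t) ` {a..b})"
      by (rule compact_imp_bounded[OF compact_continuous_image[OF gc compact_Icc]])
    then obtain B where B: "\<And>t. t \<in> {a..b} \<Longrightarrow> norm (exp (- l * (t - a)) *\<^sub>R I p t) \<le> B"
      unfolding bounded_iff by blast
    show ?thesis
    proof (rule bcontfun_normI)
      show "continuous_on UNIV (G p)" unfolding G_def
        by (rule continuous_on_compose2[OF gc c_cont]) (use c in auto)
      show "norm (G p t) \<le> B" for t unfolding G_def using B[OF c] by simp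
    qed
  qed
  define T where "T = (\<lambda>p. Bcontfun (G p))"
  have T: "apply_bcontfun (T p) t = G p t" for p t
    unfolding T_def using G_b by (simp add: Bcontfun_inverse)
  have contr: "dist (T p) (T r) \<le> 1/2 * dist p r" for p r
  proof (rule dist_bound)
    fix t
    define s where "s = c t"
    have s: "s \<in> {a..b}" using c by (simp add: s_def)
    have sub: "{a..s} \<subseteq> {a..b}" using s by auto
    have "norm (I p s - I r s) = norm (integral {a..s} (\<lambda>u. rhs p u - rhs r u))"
      unfolding I_def using sub
      by (subst integral_diff) (auto intro!: integrable_continuous_real continuous_on_subset[OF rhs_cont])
    also have "\<dots> \<le> integral {a..s} (\<lambda>u. L * dist p r * exp (l * (u - a)))"
    proof (rule integral_norm_bound_integral)
      show "(\<lambda>u. rhs p u - rhs r u) integrable_on {a..s}" using sub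
        by (intro integrable_diff integrable_continuous_real continuous_on_subset[OF rhs_cont])
      show "(\<lambda>u. L * dist p r * exp (l * (u - a))) integrable_on {a..s}"
        by (intro integrable_continuous_real continuous_intros)
      fix u assume u: "u \<in> {a..s}"
      have "norm (rhs p u - rhs r u) \<le> L * norm (exp (l * (u - a)) *\<^sub>R apply_bcontfun p u
          - exp (l * (u - a)) *\<^sub>R apply_bcontfun r u)"
        unfolding rhs_def using u sub by (intro lip) auto
      also have "\<dots> = L * (exp (l * (u - a)) * dist (apply_bcontfun p u) (apply_bcontfun r u))"
        by (simp add: dist_norm scaleR_diff_right[symmetric])
      also have "\<dots> \<le> L * (exp (l * (u - a)) * dist p r)"
        using L by (intro mult_left_mono dist_bounded) auto
      finally show "norm (rhs p u - rhs r u) \<le> L * dist p r * exp (l * (u - a))"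
        by (simp add: algebra_simps)
    qed
    also have "\<dots> = L * dist p r * ((exp (l * (s - a)) - 1) / l)"
    proof -
      have "((\<lambda>u. exp (l * (u - a))) has_integral
          exp (l * (s - a)) / l - exp (l * (a - a)) / l) {a..s}"
        by (rule fundamental_theorem_of_calculus)
          (use s l(1) in \<open>auto intro!: derivative_eq_intros
            simp: has_real_derivative_iff_has_vector_derivative[symmetric]\<close>)
      then have "integral {a..s} (\<lambda>u. exp (l * (u - a))) = (exp (l * (s - a)) - 1) / l"
        by (simp add: integral_unique diff_divide_distrib)
      then show ?thesis by simp
    qed
    finally have 1: "norm (I p s - I r s) \<le> L * dist p r * ((exp (l * (s - a)) - 1) / l)" .
    have "dist (T p t) (T r t) = exp (- l * (s - a)) * norm (I p s - I r s)"
      by (simp add: T G_def s_def dist_norm scaleR_diff_right[symmetric])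
    also have "\<dots> \<le> exp (- l * (s - a)) * (L * dist p r * ((exp (l * (s - a)) - 1) / l))"
      by (intro mult_left_mono 1) auto
    also have "\<dots> = (L / l) * dist p r * (1 - exp (- l * (s - a)))"
    proof -
      have "exp (- l * (s - a)) * exp (l * (s - a)) = 1" by (simp add: mult_exp_exp)
      then have "exp (- l * (s - a)) * (exp (l * (s - a)) - 1) = 1 - exp (- l * (s - a))"
        by (simp add: right_diff_distrib)
      then show ?thesis
        by (metis (no_types, opaque_lifting) mult.assoc mult.left_commute times_divide_eq_left times_divide_eq_right)
    qed
    also have "\<dots> \<le> (L / l) * dist p r * 1"
      using L l(1) by (intro mult_left_mono) auto
    also have "\<dots> \<le> 1/2 * dist p r"
      using mult_right_mono[OF l(2), of "dist p r"] by simp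
    finally show "dist (T p t) (T r t) \<le> 1/2 * dist p r" .
  qed
  have "\<exists>!p. T p = p"
    by (rule banach_fix_type[of "1/2"]) (use contr in auto)
  then obtain p where p: "T p = p" by auto
  have key: "exp (l * (t - a)) *\<^sub>R apply_bcontfun p t = I p t" if "t \<in> {a..b}" for t
  proof -
    have "apply_bcontfun p t = exp (- l * (t - a)) *\<^sub>R I p t"
      using T[of p t] p c_id[OF that] by (simp add: G_def)
    then show ?thesis by (simp add: exp_minus)
  qed
  have "ode_solution f a b x0 (I p)"
    unfolding ode_solution_def
  proof (intro conjI ballI)
    show "I p a = x0" by (simp add: I_def)
    show "(I p has_vector_derivative f s (I p s)) (at s within {a..b})" if "s \<in> {a..b}" for s
      using I_deriv[OF that, of p] unfolding rhs_def key[OF that] .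
  qed
  then show ?thesis by blast
qed


section \<open>Matrices and low-rank factorizations\<close>

definition outer :: "real^'m \<Rightarrow> real^'n \<Rightarrow> real^'n^'m" where
  "outer u v = (\<chi> i k. u $ i * v $ k)"

lemma outer_nth [simp]: "outer u v $ i $ k = u $ i * v $ k"
  by (simp add: outer_def)

lemma bounded_bilinear_matrix_mult:
  "bounded_bilinear ((**) :: real^'n^'m \<Rightarrow> real^'p^'n \<Rightarrow> real^'p^'m)"
  unfolding bilinear_conv_bounded_bilinear[symmetric] bilinear_def
  by (auto intro!: linearI simp: matrix_matrix_mult_def vec_eq_iff sum.distrib
      algebra_simps sum_distrib_left)

lemma bounded_bilinear_matrix_vector_mult:
  "bounded_bilinear ((*v) :: real^'n^'m \<Rightarrow> real^'n \<Rightarrow> real^'m)"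
  unfolding bilinear_conv_bounded_bilinear[symmetric] bilinear_def
  by (auto intro!: linearI simp: matrix_vector_mult_def vec_eq_iff sum.distrib
      algebra_simps sum_distrib_left)

lemma bounded_bilinear_vector_matrix_mult:
  "bounded_bilinear ((v*) :: real^'m \<Rightarrow> real^'n^'m \<Rightarrow> real^'n)"
  unfolding bilinear_conv_bounded_bilinear[symmetric] bilinear_def
  by (auto intro!: linearI simp: vector_matrix_mult_def vec_eq_iff sum.distrib
      algebra_simps sum_distrib_left)

lemma bounded_bilinear_outer:
  "bounded_bilinear (outer :: real^'m \<Rightarrow> real^'n \<Rightarrow> real^'n^'m)"
  unfolding bilinear_conv_bounded_bilinear[symmetric] bilinear_def
  by (auto intro!: linearI simp: outer_def vec_eq_iff algebra_simps)

lemma bounded_linear_transpose: "bounded_linear (transpose :: real^'n^'m \<Rightarrow> real^'m^'n)"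
  unfolding linear_conv_bounded_linear[symmetric]
  by (auto intro!: linearI simp: transpose_def vec_eq_iff)

lemmas mm_diff_left = bounded_bilinear.diff_left[OF bounded_bilinear_matrix_mult]
  and mm_diff_right = bounded_bilinear.diff_right[OF bounded_bilinear_matrix_mult]
  and mm_add_left = bounded_bilinear.add_left[OF bounded_bilinear_matrix_mult]
  and mm_add_right = bounded_bilinear.add_right[OF bounded_bilinear_matrix_mult]
  and mm_scaleR_left = bounded_bilinear.scaleR_left[OF bounded_bilinear_matrix_mult]
  and mm_scaleR_right = bounded_bilinear.scaleR_right[OF bounded_bilinear_matrix_mult]
  and mm_minus_left = bounded_bilinear.minus_left[OF bounded_bilinear_matrix_mult]
  and mm_minus_right = bounded_bilinear.minus_right[OF bounded_bilinear_matrix_mult]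

lemmas mm_simps = mm_diff_left mm_diff_right mm_add_left mm_add_right mm_scaleR_left
  mm_scaleR_right mm_minus_left mm_minus_right

lemmas vm_add_right = bounded_bilinear.add_right[OF bounded_bilinear_vector_matrix_mult]
  and vm_scaleR_right = bounded_bilinear.scaleR_right[OF bounded_bilinear_vector_matrix_mult]

lemmas outer_simps = bounded_bilinear.add_left[OF bounded_bilinear_outer]
  bounded_bilinear.add_right[OF bounded_bilinear_outer]
  bounded_bilinear.diff_left[OF bounded_bilinear_outer]
  bounded_bilinear.diff_right[OF bounded_bilinear_outer]
  bounded_bilinear.scaleR_left[OF bounded_bilinear_outer]
  bounded_bilinear.scaleR_right[OF bounded_bilinear_outer]
  bounded_bilinear.minus_left[OF bounded_bilinear_outer]
  bounded_bilinear.minus_right[OF bounded_bilinear_outer]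
  bounded_bilinear.zero_left[OF bounded_bilinear_outer]
  bounded_bilinear.zero_right[OF bounded_bilinear_outer]

lemma transpose_diff: "transpose (A - B) = transpose A - transpose (B :: real^'n^'m)"
  by (simp add: transpose_def vec_eq_iff)

lemma transpose_outer [simp]: "transpose (outer u v) = outer v u"
  by (simp add: transpose_def vec_eq_iff mult.commute)

lemma mm_outer: "A ** outer u v = outer (A *v u) v"
  by (simp add: vec_eq_iff matrix_matrix_mult_def matrix_vector_mult_def sum_distrib_right mult.assoc)

lemma outer_mm: "outer u v ** A = outer u (v v* A)"
  by (simp add: vec_eq_iff matrix_matrix_mult_def vector_matrix_mult_def sum_distrib_left mult_ac)

lemma outer_mult_vec: "outer u v *v x = (v \<bullet> x) *\<^sub>R u"
  by (simp add: vec_eq_iff matrix_vector_mult_def inner_vec_def sum_distrib_left mult_ac)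

lemma vec_mult_outer: "x v* outer u v = (x \<bullet> u) *\<^sub>R v"
  by (simp add: vec_eq_iff vector_matrix_mult_def inner_vec_def sum_distrib_left mult_ac)

lemma inner_matrix: "(A :: real^'n^'m) \<bullet> B = (\<Sum>i\<in>UNIV. \<Sum>k\<in>UNIV. A $ i $ k * B $ i $ k)"
  by (simp add: inner_vec_def)

lemma norm_sq_matrix: "(norm (A :: real^'n^'m))\<^sup>2 = (\<Sum>i\<in>UNIV. \<Sum>k\<in>UNIV. (A $ i $ k)\<^sup>2)"
  unfolding power2_norm_eq_inner inner_matrix by (simp add: power2_eq_square)

lemma norm_outer: "norm (outer u v) = norm u * norm v"
proof -
  have "outer u v \<bullet> outer u v = (\<Sum>i\<in>UNIV. \<Sum>k\<in>UNIV. (u $ i * u $ i) * (v $ k * v $ k))"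
    by (simp add: inner_matrix mult_ac)
  also have "\<dots> = (u \<bullet> u) * (v \<bullet> v)"
    by (simp add: inner_vec_def sum_product)
  finally show ?thesis by (simp add: norm_eq_sqrt_inner real_sqrt_mult)
qed

lemma norm_transpose: "norm (transpose A) = norm (A :: real^'n^'m)"
proof -
  have "(norm (transpose A))\<^sup>2 = (norm A)\<^sup>2"
    unfolding norm_sq_matrix by (subst sum.swap) (simp add: transpose_def)
  then show ?thesis by (simp add: power2_eq_iff_nonneg)
qed

lemma inner_transpose: "transpose A \<bullet> transpose B = A \<bullet> (B :: real^'n^'m)"
  unfolding inner_matrix by (subst sum.swap) (simp add: transpose_def)

lemma inner_mm_right: "A \<bullet> (B ** C) = (transpose B ** A) \<bullet> (C :: real^'n^'m)"
proof -
  have "A \<bullet> (B ** C) = (\<Sum>i\<in>UNIV. \<Sum>k\<in>UNIV. \<Sum>l\<in>UNIV. A $ i $ k * (B $ i $ l * C $ l $ k))"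
    by (simp add: inner_matrix matrix_matrix_mult_def sum_distrib_left)
  also have "\<dots> = (\<Sum>i\<in>UNIV. \<Sum>l\<in>UNIV. \<Sum>k\<in>UNIV. A $ i $ k * (B $ i $ l * C $ l $ k))"
    by (intro sum.cong refl sum.swap)
  also have "\<dots> = (\<Sum>l\<in>UNIV. \<Sum>i\<in>UNIV. \<Sum>k\<in>UNIV. A $ i $ k * (B $ i $ l * C $ l $ k))"
    by (rule sum.swap)
  also have "\<dots> = (\<Sum>l\<in>UNIV. \<Sum>k\<in>UNIV. \<Sum>i\<in>UNIV. A $ i $ k * (B $ i $ l * C $ l $ k))"
    by (intro sum.cong refl sum.swap)
  also have "\<dots> = (transpose B ** A) \<bullet> C"
    by (simp add: inner_matrix matrix_matrix_mult_def sum_distrib_left transpose_def mult_ac)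
  finally show ?thesis .
qed

lemma inner_mm_left: "A \<bullet> (C ** B) = (A ** transpose B) \<bullet> (C :: real^'n^'m)"
proof -
  have "A \<bullet> (C ** B) = transpose A \<bullet> (transpose B ** transpose C)"
    by (metis inner_transpose matrix_transpose_mul)
  also have "\<dots> = (B ** transpose A) \<bullet> transpose C"
    by (simp add: inner_mm_right)
  also have "\<dots> = (A ** transpose B) \<bullet> C"
    by (metis inner_transpose matrix_transpose_mul transpose_transpose)
  finally show ?thesis .
qed

lemma inner_mv_right: "x \<bullet> (A *v y) = (x v* A) \<bullet> (y :: real^'n)"
  by (simp add: dot_lmul_matrix)

lemma skew_inner_zero:
  fixes A :: "real^'n^'n"
  assumes "transpose A = - A"
  shows "x \<bullet> (A *v x) = 0"
proof -
  have "x v* A = transpose A *v x" by simp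
  also have "\<dots> = - (A *v x)"
    unfolding assms by (simp add: bounded_bilinear.minus_left[OF bounded_bilinear_matrix_vector_mult])
  finally have "x \<bullet> (A *v x) = - (A *v x) \<bullet> x" by (simp add: inner_mv_right)
  then show ?thesis by (simp add: inner_commute)
qed

lemma skew_inner_zero_left:
  fixes A :: "real^'m^'m" and E :: "real^'n^'m"
  assumes "transpose A = - A"
  shows "E \<bullet> (A ** E) = 0"
proof -
  have "E \<bullet> (A ** E) = - ((A ** E) \<bullet> E)"
    by (simp add: inner_mm_right assms mm_simps)
  then show ?thesis by (simp add: inner_commute)
qed

lemma skew_inner_zero_right:
  fixes A :: "real^'n^'n" and E :: "real^'n^'m"
  assumes "transpose A = - A"
  shows "E \<bullet> (E ** A) = 0"
proof -
  have "E \<bullet> (E ** A) = - ((E ** A) \<bullet> E)"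
    by (simp add: inner_mm_left assms mm_simps)
  then show ?thesis by (simp add: inner_commute)
qed

lemma norm_matrix_vector_le: "norm (A *v x) \<le> norm A * norm (x :: real^'n)"
  for A :: "real^'n^'m"
proof -
  have "(norm (A *v x))\<^sup>2 = (\<Sum>i\<in>UNIV. (A $ i \<bullet> x)\<^sup>2)"
    unfolding power2_norm_eq_inner inner_vec_def[of "A *v x"] matrix_vector_mul_component
    by (simp add: power2_eq_square)
  also have "\<dots> \<le> (\<Sum>i\<in>UNIV. (A $ i \<bullet> A $ i) * (x \<bullet> x))"
    by (intro sum_mono Cauchy_Schwarz_ineq)
  also have "\<dots> = (norm A * norm x)\<^sup>2"
    unfolding power_mult_distrib power2_norm_eq_inner inner_vec_def[of A A] sum_distrib_right ..
  finally show ?thesis by (rule power2_le_imp_le) simp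
qed

lemma norm_vector_matrix_le: "norm (x v* A) \<le> norm A * norm (x :: real^'m)"
  for A :: "real^'n^'m"
  using norm_matrix_vector_le[of "transpose A" x] by (simp add: norm_transpose)

lemma norm_sq_rows: "(norm (A :: real^'n^'m))\<^sup>2 = (\<Sum>i\<in>UNIV. (norm (A $ i))\<^sup>2)"
  by (simp add: power2_norm_eq_inner inner_vec_def[of A A])

text \<open>Frobenius submultiplicativity would cost a factor sqrt 2 for \<open>Omega\<close> and
  for each rank-two projection. Applying the operator bound row by row gives the constant 1
  instead.\<close>

lemma norm_mm_le_vec:
  fixes A :: "real^'n^'m" and B :: "real^'p^'n"
  assumes "\<And>x :: real^'n. norm (x v* B) \<le> c * norm x" and "c \<ge> 0"
  shows "norm (A ** B) \<le> c * norm A"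
proof -
  have row: "(A ** B) $ i = A $ i v* B" for i
    by (simp add: vec_eq_iff matrix_matrix_mult_def vector_matrix_mult_def mult.commute)
  have "(norm (A ** B))\<^sup>2 \<le> (\<Sum>i\<in>UNIV. (c * norm (A $ i))\<^sup>2)"
    unfolding norm_sq_rows row by (intro sum_mono power_mono assms) auto
  also have "\<dots> = (c * norm A)\<^sup>2"
    by (simp only: power_mult_distrib norm_sq_rows[of A] sum_distrib_left)
  finally have "norm (A ** B) \<le> c * norm A"
    by (rule power2_le_imp_le) (use assms(2) in simp)
  then show ?thesis .
qed

lemma norm_mm_le_vec':
  fixes A :: "real^'n^'m" and B :: "real^'p^'n"
  assumes "\<And>x :: real^'n. norm (A *v x) \<le> c * norm x" and "c \<ge> 0"
  shows "norm (A ** B) \<le> c * norm B"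
proof -
  have "norm (transpose B ** transpose A) \<le> c * norm (transpose B)"
  proof (rule norm_mm_le_vec)
    show "norm (x v* transpose A) \<le> c * norm x" for x
      unfolding vector_transpose_matrix by (rule assms)
  qed (rule assms)
  then show ?thesis unfolding matrix_transpose_mul[symmetric] norm_transpose .
qed

lemma has_vector_derivative_mm_left:
  "(X has_vector_derivative d) (at s within S) \<Longrightarrow>
   ((\<lambda>s. A ** X s) has_vector_derivative (A ** d)) (at s within S)"
  for A :: "real^'n^'m" and X :: "real \<Rightarrow> real^'p^'n"
  by (rule bounded_linear.has_vector_derivative
      [OF bounded_bilinear.bounded_linear_right[OF bounded_bilinear_matrix_mult]])

lemma has_vector_derivative_mm_right:
  "(X has_vector_derivative d) (at s within S) \<Longrightarrow>
   ((\<lambda>s. X s ** A) has_vector_derivative (d ** A)) (at s within S)"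
  for A :: "real^'p^'n" and X :: "real \<Rightarrow> real^'n^'m"
  by (rule bounded_linear.has_vector_derivative
      [OF bounded_bilinear.bounded_linear_left[OF bounded_bilinear_matrix_mult]])

lemma has_vector_derivative_transpose:
  "(X has_vector_derivative d) (at s within S) \<Longrightarrow>
   ((\<lambda>s. transpose (X s)) has_vector_derivative (transpose d)) (at s within S)"
  for X :: "real \<Rightarrow> real^'n^'m"
  by (rule bounded_linear.has_vector_derivative[OF bounded_linear_transpose])

section \<open>Low-rank factorizations and unit normals of planes\<close>

lemma low_rank_factors_rank:
  fixes Y :: "real^'n^'m" and U :: "real^'r^'m"
  assumes "low_rank_factors Y U S V"
  shows "rank Y = CARD('r)"
proof (rule antisym)
  have Y: "Y = U ** S ** transpose V" and U: "transpose U ** U = mat 1"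
    and V: "transpose V ** V = mat 1" and S: "invertible S"
    using assms by (auto simp: low_rank_factors_def orthonormal_cols_def)
  have "rank Y \<le> rank U"
    unfolding Y by (metis matrix_mul_assoc rank_mul_le_left)
  then show "rank Y \<le> CARD('r)" using rank_bound[of U] by simp
  have "S = (transpose U ** U) ** S ** (transpose V ** V)"
    by (simp add: U V)
  also have "\<dots> = transpose U ** Y ** V"
    by (simp add: Y matrix_mul_assoc)
  finally have "rank S \<le> rank Y"
    by (metis rank_mul_le_left rank_mul_le_right order_trans)
  moreover have "rank S = CARD('r)"
    using S by (simp add: full_rank_injective matrix_left_invertible_injective[symmetric]
        invertible_left_inverse)
  ultimately show "CARD('r) \<le> rank Y" by simp
qed

lemma qr_factors_rank:
  fixes X :: "real^'r^'m"
  assumes "qr_factors X Q R" "invertible R"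
  shows "rank X = CARD('r)"
proof -
  have "low_rank_factors X Q R (mat 1 :: real^'r^'r)"
    using assms by (simp add: low_rank_factors_def qr_factors_def orthonormal_cols_def)
  then show ?thesis by (rule low_rank_factors_rank)
qed

text \<open>Trades an orthonormal basis of a plane for its unit normal: the lifted flows see a
  factor only through \<open>U ** transpose U\<close>, so one vector carries all that matters of it.
  The normal completes the two columns to the orthogonal matrix \<open>G\<close>.\<close>

lemma orthonormal_cols_2_3_normal:
  fixes U :: "real^2^3"
  assumes "orthonormal_cols U"
  obtains m where "norm m = 1" "m v* U = 0" "U ** transpose U = mat 1 - outer m m"
proof -
  have "rank (transpose U) \<noteq> CARD(3)" using rank_bound[of "transpose U"] by auto
  then obtain x where x: "x \<noteq> 0" "x v* U = 0"
    using matrix_nonfull_linear_equations_eq[of "transpose U"] by auto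
  define m where "m = (1 / norm x) *\<^sub>R x"
  have m: "norm m = 1" using x(1) by (simp add: m_def)
  have mU: "m v* U = 0"
    unfolding m_def using x(2)
    by (simp add: bounded_bilinear.scaleR_left[OF bounded_bilinear_vector_matrix_mult])
  define G :: "real^3^3" where "G = (\<chi> i k. if k = 1 then U $ i $ 1 else if k = 2 then U $ i $ 2 else m $ i)"
  have U11: "(\<Sum>i\<in>UNIV. U $ i $ a * U $ i $ b) = (if a = b then 1 else 0)" for a b
    using assms unfolding orthonormal_cols_def
    by (simp add: vec_eq_iff matrix_matrix_mult_def transpose_def mat_def)
  have mU1: "(\<Sum>i\<in>UNIV. U $ i $ a * m $ i) = 0" for a
    using mU by (simp add: vec_eq_iff vector_matrix_mult_def mult.commute)
  have mm: "(\<Sum>i\<in>UNIV. m $ i * m $ i) = 1"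
    using m by (simp add: norm_eq_1 inner_vec_def)
  have "transpose G ** G = mat 1"
    using U11[of 1 1] U11[of 1 2] U11[of 2 1] U11[of 2 2] mU1[of 1] mU1[of 2] mm
    unfolding G_def by (simp add: vec_eq_iff matrix_matrix_mult_def transpose_def mat_def forall_3 sum_3 mult.commute)
  then have GG: "G ** transpose G = mat 1" by (simp add: matrix_left_right_inverse)
  have "G ** transpose G = U ** transpose U + outer m m"
    unfolding G_def by (simp add: vec_eq_iff matrix_matrix_mult_def transpose_def sum_3 sum_2)
  with GG have "U ** transpose U = mat 1 - outer m m" by (metis add_diff_cancel_right')
  with m mU that show ?thesis by blast
qed

lemma orthonormal_complement_factors:
  fixes X :: "real^'k^3"
  assumes "norm m = 1" "m v* X = 0"
  obtains U :: "real^2^3" where "orthonormal_cols U" "X = U ** (transpose U ** X)"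
proof -
  obtain G :: "real^3^3" where G: "orthogonal_matrix G" "G *v axis 3 1 = m"
    using orthogonal_matrix_exists_basis[OF assms(1)] by blast
  have Gm: "G $ i $ 3 = m $ i" for i
    using G(2) by (simp add: matrix_vector_mult_basis vec_eq_iff column_def)
  have G1: "transpose G ** G = mat 1" and G2: "G ** transpose G = mat 1"
    using G(1) by (auto simp: orthogonal_matrix_def)
  define U :: "real^2^3" where "U = (\<chi> i k. if k = 1 then G $ i $ 1 else G $ i $ 2)"
  have GG: "(\<Sum>i\<in>UNIV. G $ i $ a * G $ i $ b) = (if a = b then 1 else 0)" for a b
    using G1 by (simp add: vec_eq_iff matrix_matrix_mult_def transpose_def mat_def)
  have "orthonormal_cols U"
    unfolding orthonormal_cols_def U_def using GG[of 1 1] GG[of 1 2] GG[of 2 1] GG[of 2 2]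
    by (simp add: vec_eq_iff matrix_matrix_mult_def transpose_def mat_def forall_2)
  moreover have "U ** transpose U + outer m m = G ** transpose G"
    unfolding U_def by (simp add: vec_eq_iff matrix_matrix_mult_def transpose_def sum_3 sum_2 Gm)
  then have UU: "U ** transpose U = mat 1 - outer m m" unfolding G2 by (metis add_diff_cancel_right')
  have "U ** (transpose U ** X) = X"
    unfolding matrix_mul_assoc UU by (simp add: mm_simps outer_mm assms(2) outer_simps)
  ultimately show ?thesis using that by metis
qed

lemma left_null_unit_exists:
  fixes X :: "real^'k^3"
  assumes "rank X \<noteq> 3"
  obtains m where "norm m = 1" "m v* X = 0"
proof -
  have "rank (transpose X) \<noteq> CARD(3)" using assms by (simp add: rank_transpose)
  then obtain x where x: "x \<noteq> 0" "x v* X = 0"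
    using matrix_nonfull_linear_equations_eq[of "transpose X"] by auto
  define m where "m = (1 / norm x) *\<^sub>R x"
  have "norm m = 1" using x(1) by (simp add: m_def)
  moreover have "m v* X = 0"
    unfolding m_def using x(2)
    by (simp add: bounded_bilinear.scaleR_left[OF bounded_bilinear_vector_matrix_mult])
  ultimately show ?thesis using that by blast
qed

text \<open>A matrix with two columns always has a left null vector in dimension three, and any
  orthonormal basis of its complement can serve as \<open>Q\<close>. Rank-deficient matrices are
  included, so a trace exists before anything is known about admissibility.\<close>

lemma qr_factors_exist:
  fixes X :: "real^2^3"
  obtains Q R where "qr_factors X Q R"
proof -
  have "rank X \<noteq> 3" using rank_bound[of X] by auto
  then obtain m where "norm m = 1" "m v* X = 0" by (rule left_null_unit_exists)
  then obtain U :: "real^2^3" where "orthonormal_cols U" "X = U ** (transpose U ** X)"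
    by (rule orthonormal_complement_factors)
  then show ?thesis using that unfolding qr_factors_def by blast
qed

lemma low_rank_factors_exist:
  fixes Y :: "real^3^3"
  assumes "rank Y = 2"
  obtains U :: "real^2^3" and S V where "low_rank_factors Y U S V"
proof -
  have "rank Y \<noteq> 3" using assms by simp
  then obtain m where "norm m = 1" "m v* Y = 0" by (rule left_null_unit_exists)
  then obtain U :: "real^2^3" where U: "orthonormal_cols U" "Y = U ** (transpose U ** Y)"
    by (rule orthonormal_complement_factors)
  obtain V R where V: "qr_factors (transpose (transpose U ** Y)) V R"
    by (rule qr_factors_exist)
  have "transpose U ** Y = transpose R ** transpose V"
    using V unfolding qr_factors_def by (metis matrix_transpose_mul transpose_transpose)
  then have Y: "Y = U ** transpose R ** transpose V"
    using U(2) by (simp add: matrix_mul_assoc)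
  have "rank Y \<le> rank (transpose R)"
    unfolding Y by (metis rank_mul_le_left rank_mul_le_right order_trans)
  then have "rank (transpose R) = 2" using assms rank_bound[of "transpose R"] by simp
  then have "invertible (transpose R)"
    using full_rank_injective[of "transpose R"]
    by (simp add: invertible_left_inverse matrix_left_invertible_injective)
  then have "low_rank_factors Y U (transpose R) V"
    using U V Y by (simp add: low_rank_factors_def qr_factors_def)
  then show ?thesis by (rule that)
qed


section \<open>The generator and its compressions by orthogonal projections\<close>

lemma Omega_nth: "Omega $ i $ k = (if i = 3 \<and> k = 1 then 1 else if i = 1 \<and> k = 3 then -1 else 0)"
  by (simp add: Omega_def matrix_unit_def)

lemma Omega_mult_vec: "Omega *v x = vector [- (x $ 3), 0, x $ 1]"
  by (simp add: vec_eq_iff matrix_vector_mult_def Omega_nth forall_3 sum_3)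

lemma Omega_skew: "transpose Omega = - Omega"
  by (simp add: vec_eq_iff transpose_def Omega_nth forall_3)

lemma norm_sq_3: "(norm (x :: real^3))\<^sup>2 = (x $ 1)\<^sup>2 + (x $ 2)\<^sup>2 + (x $ 3)\<^sup>2"
  unfolding power2_norm_eq_inner by (simp add: inner_vec_def sum_3 power2_eq_square)

lemma norm_Omega_vec_le: "norm (Omega *v x) \<le> norm x"
  by (rule power2_le_imp_le) (simp_all add: norm_sq_3 Omega_mult_vec)

lemma norm_vec_Omega_le: "norm (x v* Omega) \<le> norm x"
proof -
  have "x v* Omega = transpose Omega *v x" by simp
  also have "\<dots> = - (Omega *v x)"
    unfolding Omega_skew by (simp add: bounded_bilinear.minus_left[OF bounded_bilinear_matrix_vector_mult])
  finally show ?thesis using norm_Omega_vec_le by simp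
qed

lemma norm_Omega_commutator_le: "norm (Omega ** X - X ** Omega) \<le> 2 * norm X"
proof -
  have "norm (Omega ** X) \<le> 1 * norm X"
    by (rule norm_mm_le_vec') (simp_all add: norm_Omega_vec_le)
  moreover have "norm (X ** Omega) \<le> 1 * norm X"
    by (rule norm_mm_le_vec) (simp_all add: norm_vec_Omega_le)
  ultimately show ?thesis using norm_triangle_ineq4[of "Omega ** X" "X ** Omega"] by linarith
qed

definition orth_proj :: "real^'n^'n \<Rightarrow> bool" where
  "orth_proj P \<longleftrightarrow> transpose P = P \<and> P ** P = P"

lemma orth_proj_mat_1 [simp]: "orth_proj (mat 1)"
  by (simp add: orth_proj_def)

lemma orth_proj_orthonormal_cols:
  assumes "orthonormal_cols U"
  shows "orth_proj (U ** transpose U)"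
proof -
  have "U ** transpose U ** (U ** transpose U) = U ** (transpose U ** U) ** transpose U"
    by (simp add: matrix_mul_assoc)
  then show ?thesis using assms
    by (simp add: orth_proj_def matrix_transpose_mul orthonormal_cols_def)
qed

lemma orth_proj_vec_mult: "orth_proj P \<Longrightarrow> x v* P = P *v x"
  unfolding orth_proj_def by (metis transpose_matrix_vector)

lemma norm_orth_proj_vec_le:
  assumes "orth_proj P"
  shows "norm (P *v x) \<le> norm x"
proof -
  have "P *v x = P *v (P *v x)"
    using assms by (simp add: orth_proj_def matrix_vector_mul_assoc)
  then have "(P *v x) \<bullet> (P *v x) = x \<bullet> (P *v x)"
    using assms by (metis inner_mv_right orth_proj_vec_mult inner_commute)
  then have "norm (P *v x) * norm (P *v x) \<le> norm x * norm (P *v x)"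
    using norm_cauchy_schwarz[of x "P *v x"] by (simp add: dot_square_norm power2_eq_square)
  then show ?thesis
    by (cases "P *v x = 0") simp_all
qed

lemma norm_orth_proj_left_le: "orth_proj P \<Longrightarrow> norm (P ** X) \<le> norm X"
  using norm_mm_le_vec'[of P 1 X] norm_orth_proj_vec_le[of P] by simp

lemma norm_orth_proj_right_le: "orth_proj P \<Longrightarrow> norm (X ** P) \<le> norm X"
  using norm_mm_le_vec[of P 1 X] norm_orth_proj_vec_le[of P] by (simp add: orth_proj_vec_mult)

text \<open>A lifted variable satisfies \<open>P ** X = X\<close> and \<open>X ** Q = X\<close>, so
  projecting the commutator from both sides leaves the compressed generators acting on
  \<open>X\<close>. They are again skew, hence still generate rotations.\<close>

definition compressed_Omega :: "real^3^3 \<Rightarrow> real^3^3" where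
  "compressed_Omega P = P ** Omega ** P"

lemma compressed_Omega_mat_1 [simp]: "compressed_Omega (mat 1) = Omega"
  by (simp add: compressed_Omega_def)

lemma compressed_Omega_skew: "orth_proj P \<Longrightarrow> transpose (compressed_Omega P) = - compressed_Omega P"
  unfolding compressed_Omega_def orth_proj_def
  by (simp add: matrix_transpose_mul Omega_skew mm_simps matrix_mul_assoc)

lemma compressed_Omega_vec: "compressed_Omega P *v x = P *v (Omega *v (P *v x))"
  by (simp add: compressed_Omega_def matrix_vector_mul_assoc matrix_mul_assoc)

lemma norm_compressed_Omega_vec_le: "orth_proj P \<Longrightarrow> norm (compressed_Omega P *v x) \<le> norm x"
  unfolding compressed_Omega_vec
  by (meson norm_orth_proj_vec_le norm_Omega_vec_le order_trans)

lemma vec_compressed_Omega: "orth_proj P \<Longrightarrow> x v* compressed_Omega P = - (compressed_Omega P *v x)"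
  using compressed_Omega_skew[of P]
  by (metis transpose_matrix_vector bounded_bilinear.minus_left[OF bounded_bilinear_matrix_vector_mult])

lemma norm_compressed_Omega_left_le: "orth_proj P \<Longrightarrow> norm (compressed_Omega P ** X) \<le> norm X"
  using norm_mm_le_vec'[of "compressed_Omega P" 1 X] norm_compressed_Omega_vec_le[of P] by simp

lemma norm_compressed_Omega_right_le: "orth_proj P \<Longrightarrow> norm (X ** compressed_Omega P) \<le> norm X"
  using norm_mm_le_vec[of "compressed_Omega P" 1 X] norm_compressed_Omega_vec_le[of P]
  by (simp add: vec_compressed_Omega)


section \<open>The substeps as rotating rank-one flows\<close>

text \<open>All substeps of the integrator have the form below, for the lifted variables \<open>K V\<^sup>T\<close>, \<open>U S V\<^sup>T\<close>
  and \<open>U L\<^sup>T\<close>; since the rotation part is norm preserving, the error of the ansatz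
  \<open>u v\<^sup>T + Z\<close> grows only through the action of the rotation on \<open>Z\<close>.\<close>

lemma rotating_rank_one_flow:
  fixes X :: "real \<Rightarrow> real^3^3"
  assumes ab: "a \<le> b" and P: "orth_proj P" and Q: "orth_proj Q" and \<sigma>: "\<bar>\<sigma>\<bar> = 1"
    and q: "continuous_on {a..b} q" "\<And>s. s \<in> {a..b} \<Longrightarrow> \<bar>q s\<bar> \<le> 2"
    and X: "\<And>s. s \<in> {a..b} \<Longrightarrow> (X has_vector_derivative
       \<sigma> *\<^sub>R (q s *\<^sub>R (compressed_Omega P ** X s - X s ** compressed_Omega Q) + P ** R s ** Q))
       (at s within {a..b})"
    and G: "\<And>s. s \<in> {a..b} \<Longrightarrow> (G has_vector_derivative R s) (at s within {a..b})"
    and B: "\<And>s. s \<in> {a..b} \<Longrightarrow> norm (Z0 + \<sigma> *\<^sub>R (P ** (G s - G a) ** Q)) \<le> B"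
  obtains u v where "u a = u0" "v a = v0"
    "\<And>s. s \<in> {a..b} \<Longrightarrow> (u has_vector_derivative (\<sigma> * q s) *\<^sub>R (compressed_Omega P *v u s)) (at s within {a..b})"
    "\<And>s. s \<in> {a..b} \<Longrightarrow> (v has_vector_derivative (\<sigma> * q s) *\<^sub>R (compressed_Omega Q *v v s)) (at s within {a..b})"
    "\<And>s. s \<in> {a..b} \<Longrightarrow> norm (X s - outer (u s) (v s) - (Z0 + \<sigma> *\<^sub>R (P ** (G s - G a) ** Q)))
       \<le> norm (X a - outer u0 v0 - Z0) + 4 * B * (s - a)"
proof -
  \<comment> \<open>The speed \<open>q\<close> is a given function of time, evaluated along
    \<open>X\<close>, so \<open>u\<close> and \<open>v\<close> solve linear equations with Lipschitz
    constant 2.\<close>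
  have lin: "\<exists>u. ode_solution (\<lambda>s x. (\<sigma> * q s) *\<^sub>R (compressed_Omega P *v x)) a b u0 u"
    if P: "orth_proj P" for P and u0 :: "real^3"
  proof (rule ode_solution_exists[where L=2])
    show "continuous_on ({a..b} \<times> UNIV) (\<lambda>p. (\<sigma> * q (fst p)) *\<^sub>R (compressed_Omega P *v snd p))"
    proof (intro continuous_on_scaleR continuous_on_mult continuous_on_const)
      show "continuous_on ({a..b} \<times> UNIV) (\<lambda>p. q (fst p))"
        by (rule continuous_on_compose2[OF q(1)]) (auto intro: continuous_intros)
      show "continuous_on ({a..b} \<times> UNIV) (\<lambda>p. compressed_Omega P *v snd p)"
        by (rule bounded_linear.continuous_on[OF bounded_bilinear.bounded_linear_right
              [OF bounded_bilinear_matrix_vector_mult]]) (intro continuous_intros)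
    qed
    fix s x y assume s: "s \<in> {a..b}"
    have "norm ((\<sigma> * q s) *\<^sub>R (compressed_Omega P *v x) - (\<sigma> * q s) *\<^sub>R (compressed_Omega P *v y))
      = \<bar>q s\<bar> * norm (compressed_Omega P *v (x - y))"
      using \<sigma> by (simp add: scaleR_diff_right[symmetric] abs_mult matrix_vector_mult_diff_distrib)
    also have "\<dots> \<le> 2 * norm (x - y)"
      by (intro mult_mono q s norm_compressed_Omega_vec_le P) auto
    finally show "norm ((\<sigma> * q s) *\<^sub>R (compressed_Omega P *v x) - (\<sigma> * q s) *\<^sub>R (compressed_Omega P *v y))
      \<le> 2 * norm (x - y)" .
  qed (use ab in auto)
  obtain u where u: "u a = u0"
    "\<And>s. s \<in> {a..b} \<Longrightarrow> (u has_vector_derivative (\<sigma> * q s) *\<^sub>R (compressed_Omega P *v u s)) (at s within {a..b})"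
    using lin[OF P, of u0] unfolding ode_solution_def by blast
  obtain v where v: "v a = v0"
    "\<And>s. s \<in> {a..b} \<Longrightarrow> (v has_vector_derivative (\<sigma> * q s) *\<^sub>R (compressed_Omega Q *v v s)) (at s within {a..b})"
    using lin[OF Q, of v0] unfolding ode_solution_def by blast
  \<comment> \<open>\<open>Z\<close> accumulates the forcing as if nothing rotated. The forcing then
    cancels in the derivative of \<open>E\<close>, which is left with the rotation of
    \<open>E + Z\<close>.\<close>
  define Z where "Z = (\<lambda>s. Z0 + \<sigma> *\<^sub>R (P ** (G s - G a) ** Q))"
  define E where "E = (\<lambda>s. X s - outer (u s) (v s) - Z s)"
  define A where "A = compressed_Omega P"
  define C where "C = compressed_Omega Q"
  have A: "transpose A = - A" and C: "transpose C = - C"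
    using compressed_Omega_skew P Q by (auto simp: A_def C_def)
  define d where "d = (\<lambda>s. (\<sigma> * q s) *\<^sub>R (A ** (E s + Z s) - (E s + Z s) ** C))"
  have E': "(E has_vector_derivative d s) (at s within {a..b})" if s: "s \<in> {a..b}" for s
  proof -
    have Zd: "(Z has_vector_derivative \<sigma> *\<^sub>R (P ** R s ** Q)) (at s within {a..b})"
    proof -
      have "((\<lambda>s. G s - G a) has_vector_derivative R s) (at s within {a..b})"
        using G[OF s] by (auto intro!: derivative_eq_intros)
      from has_vector_derivative_mm_right[OF has_vector_derivative_mm_left[OF this, of P], of Q]
      have "((\<lambda>s. \<sigma> *\<^sub>R (P ** (G s - G a) ** Q)) has_vector_derivative \<sigma> *\<^sub>R (P ** R s ** Q)) (at s within {a..b})"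
        by (rule bounded_linear.has_vector_derivative[OF bounded_linear_scaleR_right])
      from has_vector_derivative_add[OF has_vector_derivative_const this]
      show ?thesis unfolding Z_def by simp
    qed
    have od: "((\<lambda>s. outer (u s) (v s)) has_vector_derivative
        outer (u s) ((\<sigma> * q s) *\<^sub>R (C *v v s)) + outer ((\<sigma> * q s) *\<^sub>R (A *v u s)) (v s)) (at s within {a..b})"
      unfolding A_def C_def
      by (rule bounded_bilinear.has_vector_derivative[OF bounded_bilinear_outer u(2)[OF s] v(2)[OF s]])
    have Cv: "v s v* C = - (C *v v s)" using vec_compressed_Omega[OF Q] by (simp add: C_def)
    have "(E has_vector_derivative
       \<sigma> *\<^sub>R (q s *\<^sub>R (A ** X s - X s ** C) + P ** R s ** Q)
       - (outer (u s) ((\<sigma> * q s) *\<^sub>R (C *v v s)) + outer ((\<sigma> * q s) *\<^sub>R (A *v u s)) (v s))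
       - \<sigma> *\<^sub>R (P ** R s ** Q)) (at s within {a..b})"
      unfolding E_def A_def C_def
      by (intro has_vector_derivative_diff X[OF s] od[unfolded A_def C_def] Zd)
    moreover have "\<sigma> *\<^sub>R (q s *\<^sub>R (A ** X s - X s ** C) + P ** R s ** Q)
       - (outer (u s) ((\<sigma> * q s) *\<^sub>R (C *v v s)) + outer ((\<sigma> * q s) *\<^sub>R (A *v u s)) (v s))
       - \<sigma> *\<^sub>R (P ** R s ** Q) = d s"
    proof -
      have EZ: "E s + Z s = X s - outer (u s) (v s)" by (simp add: E_def)
      show ?thesis unfolding d_def EZ
        by (simp add: mm_simps mm_outer outer_mm Cv outer_simps algebra_simps)
    qed
    ultimately show ?thesis by simp
  qed
  have le: "E s \<bullet> d s \<le> (4 * B) * norm (E s)" if s: "s \<in> {a..b}" for s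
  proof -
    have Zs: "norm (Z s) \<le> B" using B[OF s] by (simp add: Z_def)
    \<comment> \<open>The rotation of \<open>E\<close> itself drops out by skewness. The two terms
      acting on \<open>Z\<close> contribute \<open>B\<close> each, and the speed is at most 2, which
      is the origin of \<open>4 * B\<close>.\<close>
    have "E s \<bullet> d s = (\<sigma> * q s) * (E s \<bullet> (A ** Z s - Z s ** C))"
      unfolding d_def
      by (simp add: mm_simps inner_add_right inner_diff_right skew_inner_zero_left[OF A] skew_inner_zero_right[OF C])
    also have "\<dots> \<le> \<bar>(\<sigma> * q s) * (E s \<bullet> (A ** Z s - Z s ** C))\<bar>" by simp
    also have "\<dots> = \<bar>q s\<bar> * \<bar>E s \<bullet> (A ** Z s - Z s ** C)\<bar>"
      using \<sigma> by (simp add: abs_mult)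
    also have "\<dots> \<le> 2 * (norm (E s) * (B + B))"
    proof (intro mult_mono q s)
      have "norm (A ** Z s - Z s ** C) \<le> norm (A ** Z s) + norm (Z s ** C)" by (rule norm_triangle_ineq4)
      also have "\<dots> \<le> B + B" unfolding A_def C_def
        using norm_compressed_Omega_left_le[OF P, of "Z s"] norm_compressed_Omega_right_le[OF Q, of "Z s"] Zs
        by linarith
      finally show "\<bar>E s \<bullet> (A ** Z s - Z s ** C)\<bar> \<le> norm (E s) * (B + B)"
        using Cauchy_Schwarz_ineq2[of "E s" "A ** Z s - Z s ** C"]
        by (meson mult_left_mono norm_ge_zero order_trans)
    qed auto
    finally show ?thesis by (simp add: algebra_simps)
  qed
  have "a \<in> {a..b}" using ab by simp
  then have B0: "B \<ge> 0" by (rule order_trans[OF norm_ge_zero B])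
  have "norm (E s) \<le> norm (E a) + (4 * B) * (s - a)" if s: "s \<in> {a..b}" for s
  proof (rule norm_growth_le[where d=d])
    show "(E has_vector_derivative d r) (at r within {a..s})" if "r \<in> {a..s}" for r
      using has_vector_derivative_subinterval[OF E', of a s r] that s by auto
    show "E r \<bullet> d r \<le> 4 * B * norm (E r)" if "r \<in> {a..s}" for r
      using le[of r] that s by auto
  qed (use s B0 in auto)
  note Ele = this
  have Ea: "E a = X a - outer u0 v0 - Z0"
    by (simp add: E_def Z_def u v bounded_bilinear.zero_right[OF bounded_bilinear_matrix_mult]
        bounded_bilinear.zero_left[OF bounded_bilinear_matrix_mult])
  show ?thesis
  proof (rule that[of u v])
    show "norm (X s - outer (u s) (v s) - (Z0 + \<sigma> *\<^sub>R (P ** (G s - G a) ** Q)))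
       \<le> norm (X a - outer u0 v0 - Z0) + 4 * B * (s - a)" if "s \<in> {a..b}" for s
      using Ele[OF that] unfolding Ea unfolding E_def Z_def .
    show "u a = u0" by (rule u(1))
    show "v a = v0" by (rule v(1))
    show "(u has_vector_derivative (\<sigma> * q s) *\<^sub>R (compressed_Omega P *v u s)) (at s within {a..b})"
      if "s \<in> {a..b}" for s by (rule u(2)[OF that])
    show "(v has_vector_derivative (\<sigma> * q s) *\<^sub>R (compressed_Omega Q *v v s)) (at s within {a..b})"
      if "s \<in> {a..b}" for s by (rule v(2)[OF that])
  qed
qed

lemma compressed_Omega_norm_preserved:
  assumes P: "orth_proj P" and s: "s \<in> {a..b}"
    and u: "\<And>s. s \<in> {a..b} \<Longrightarrow> (u has_vector_derivative c s *\<^sub>R (compressed_Omega P *v u s)) (at s within {a..b})"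
  shows "norm (u s) = norm (u a)"
  by (rule norm_eq_if_orthogonal_deriv[OF s u])
    (simp_all add: skew_inner_zero[OF compressed_Omega_skew[OF P]])

lemma q_fam_bounds:
  assumes "\<bar>\<eta>\<bar> = 1"
  shows "0 \<le> q_fam \<eta> X" "q_fam \<eta> X \<le> 2"
proof -
  have "\<bar>\<eta> * tanh (X $ 3 $ 1)\<bar> \<le> 1"
    using tanh_real_bounds[of "X $ 3 $ 1"] assms by (auto simp: abs_mult)
  then have 1: "0 \<le> 1 + \<eta> * tanh (X $ 3 $ 1)" "1 + \<eta> * tanh (X $ 3 $ 1) \<le> 2" by linarith+
  have s: "sqrt (1 + (norm X)\<^sup>2) \<ge> 1" by simp
  show "0 \<le> q_fam \<eta> X" unfolding q_fam_def using 1 s by simp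
  have "1 + \<eta> * tanh (X $ 3 $ 1) \<le> 2 * sqrt (1 + (norm X)\<^sup>2)" using 1 s by linarith
  then show "q_fam \<eta> X \<le> 2" unfolding q_fam_def
    using s by (subst pos_divide_le_eq) linarith+
qed

lemma continuous_on_q_fam: "continuous_on S (q_fam \<eta>)"
  unfolding q_fam_def
  by (intro continuous_intros) (auto simp: add_nonneg_eq_0_iff intro!: add_pos_nonneg simp: add_pos_nonneg[THEN less_imp_neq, symmetric])

section \<open>Lifted subflows and existence of a step\<close>

lemma ode_solution_deriv:
  "ode_solution f a b x0 x \<Longrightarrow> s \<in> {a..b} \<Longrightarrow> (x has_vector_derivative f s (x s)) (at s within {a..b})"
  by (simp add: ode_solution_def)

text \<open>The scalar 1 and the factors \<open>mat 1\<close> are kept so that the K, S and L flows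
  all match the shape assumed in \<open>rotating_rank_one_flow\<close>, with
  \<open>\<sigma> = -1\<close> for S.\<close>

lemma K_flow_lifted:
  fixes K :: "real \<Rightarrow> real^2^3"
  assumes "ode_solution (K_field (F_fam j \<eta>) V) a b K0 K" "orthonormal_cols V" "s \<in> {a..b}"
  shows "((\<lambda>s. K s ** transpose V) has_vector_derivative
     1 *\<^sub>R (q_fam \<eta> (K s ** transpose V) *\<^sub>R (compressed_Omega (mat 1) ** (K s ** transpose V)
       - (K s ** transpose V) ** compressed_Omega (V ** transpose V)) + mat 1 ** R_fam j s ** (V ** transpose V)))
     (at s within {a..b})"
proof -
  have VV: "transpose V ** V = mat 1" using assms(2) by (simp add: orthonormal_cols_def)
  have V1: "A ** transpose V ** V ** transpose V = A ** transpose V" for A :: "real^2^3"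
    by (metis VV matrix_mul_assoc matrix_mul_rid)
  have V2: "A ** transpose V ** V = A" for A :: "real^2^3"
    by (metis VV matrix_mul_assoc matrix_mul_rid)
  show ?thesis
    using has_vector_derivative_mm_right[OF ode_solution_deriv[OF assms(1,3)], of "transpose V"]
    by (simp add: K_field_def F_fam_def M_fam_def compressed_Omega_def mm_simps matrix_mul_assoc V1 V2)
qed

lemma S_flow_lifted:
  fixes S :: "real \<Rightarrow> real^2^2" and U :: "real^2^3"
  assumes "ode_solution (S_field (F_fam j \<eta>) U V) a b S0 S" "orthonormal_cols U" "orthonormal_cols V" "s \<in> {a..b}"
  shows "((\<lambda>s. U ** S s ** transpose V) has_vector_derivative
     (-1) *\<^sub>R (q_fam \<eta> (U ** S s ** transpose V) *\<^sub>R (compressed_Omega (U ** transpose U) ** (U ** S s ** transpose V)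
       - (U ** S s ** transpose V) ** compressed_Omega (V ** transpose V))
       + U ** transpose U ** R_fam j s ** (V ** transpose V)))
     (at s within {a..b})"
proof -
  have VV: "transpose V ** V = mat 1" and UU: "transpose U ** U = mat 1"
    using assms by (auto simp: orthonormal_cols_def)
  have V1: "A ** transpose V ** V = A" for A :: "real^2^3"
    by (metis VV matrix_mul_assoc matrix_mul_rid)
  have U1: "A ** transpose U ** U = A" for A :: "real^2^3"
    by (metis UU matrix_mul_assoc matrix_mul_rid)
  show ?thesis
    using has_vector_derivative_mm_right[OF has_vector_derivative_mm_left[OF ode_solution_deriv[OF assms(1,4)], of U], of "transpose V"]
    by (simp add: S_field_def F_fam_def M_fam_def compressed_Omega_def mm_simps matrix_mul_assoc U1 V1)
qed

lemma L_flow_lifted: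
  fixes L :: "real \<Rightarrow> real^2^3" and U :: "real^2^3"
  assumes "ode_solution (L_field (F_fam j \<eta>) U) a b L0 L" "orthonormal_cols U" "s \<in> {a..b}"
  shows "((\<lambda>s. U ** transpose (L s)) has_vector_derivative
     1 *\<^sub>R (q_fam \<eta> (U ** transpose (L s)) *\<^sub>R (compressed_Omega (U ** transpose U) ** (U ** transpose (L s))
       - (U ** transpose (L s)) ** compressed_Omega (mat 1)) + U ** transpose U ** R_fam j s ** mat 1))
     (at s within {a..b})"
proof -
  have UU: "transpose U ** U = mat 1"
    using assms by (auto simp: orthonormal_cols_def)
  have U1: "A ** transpose U ** U = A" for A :: "real^2^3"
    by (metis UU matrix_mul_assoc matrix_mul_rid)
  show ?thesis
    using has_vector_derivative_mm_left[OF has_vector_derivative_transpose[OF ode_solution_deriv[OF assms(1,3)]], of U]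
    by (simp add: L_field_def F_fam_def M_fam_def compressed_Omega_def mm_simps matrix_mul_assoc U1
        matrix_transpose_mul)
qed

text \<open>The fields of all three kinds of substep are \<open>F\<close> preceded and followed by
  linear maps, so a single existence proof covers them.\<close>

lemma projected_ode_exists:
  fixes F :: "real \<Rightarrow> real^3^3 \<Rightarrow> real^3^3" and f :: "'a::euclidean_space \<Rightarrow> real^3^3"
  assumes cont: "continuous_on ({t..t'} \<times> UNIV) (\<lambda>p. F (fst p) (snd p))"
    and lip: "\<forall>s\<in>{t..t'}. \<forall>X Z. norm (F s X - F s Z) \<le> L * norm (X - Z)" and L: "L \<ge> 0"
    and ab: "t \<le> a" "a \<le> b" "b \<le> t'" and f: "bounded_linear f" and g: "bounded_linear g"
  shows "\<exists>x. ode_solution (\<lambda>s x. g (F s (f x))) a b x0 x"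
proof -
    obtain Kf where Kf: "\<And>x. norm (f x) \<le> norm x * Kf" "Kf \<ge> 0"
      using bounded_linear.nonneg_bounded[OF f] by blast
    obtain Kg where Kg: "\<And>x. norm (g x) \<le> norm x * Kg" "Kg \<ge> 0"
      using bounded_linear.nonneg_bounded[OF g] by blast
    show ?thesis
    proof (rule ode_solution_exists[where L="L * Kf * Kg"])
    show "a \<le> b" by (rule ab)
    have sub: "{a..b} \<subseteq> {t..t'}" using ab by auto
    show "continuous_on ({a..b} \<times> UNIV) (\<lambda>p. g (F (fst p) (f (snd p))))"
    proof (rule bounded_linear.continuous_on[OF g])
      have "continuous_on ({a..b} \<times> UNIV) (\<lambda>p. (fst p, f (snd p)))"
        by (intro continuous_intros bounded_linear.continuous_on[OF f])
      moreover have "(\<lambda>p. (fst p, f (snd p))) ` ({a..b} \<times> UNIV) \<subseteq> {t..t'} \<times> UNIV"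
        using sub by auto
      ultimately show "continuous_on ({a..b} \<times> UNIV) (\<lambda>p. F (fst p) (f (snd p)))"
        using continuous_on_compose2[OF cont] by fastforce
    qed
    show "norm (g (F s (f x)) - g (F s (f y))) \<le> L * Kf * Kg * norm (x - y)" if s: "s \<in> {a..b}" for s x y
    proof -
      have "norm (g (F s (f x)) - g (F s (f y))) \<le> norm (F s (f x) - F s (f y)) * Kg"
        using Kg(1) by (simp add: linear_diff[OF bounded_linear.linear[OF g], symmetric])
      also have "\<dots> \<le> (L * norm (f x - f y)) * Kg"
        using s sub by (intro mult_right_mono lip[rule_format] Kg) auto
      also have "\<dots> \<le> (L * (norm (x - y) * Kf)) * Kg"
        using Kf(1) L Kg(2) by (intro mult_right_mono mult_left_mono) (auto simp: linear_diff[OF bounded_linear.linear[OF f], symmetric])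
      finally show ?thesis by (simp add: mult_ac)
    qed
    show "L * Kf * Kg \<ge> 0" using L Kf Kg by simp
    qed
qed

lemma strang_trace_exists:
  fixes F :: "real \<Rightarrow> real^3^3 \<Rightarrow> real^3^3"
  assumes h: "h \<ge> 0" and cont: "continuous_on ({t..t+h} \<times> UNIV) (\<lambda>p. F (fst p) (snd p))"
    and lip: "\<And>s X Z. s \<in> {t..t+h} \<Longrightarrow> norm (F s X - F s Z) \<le> L * norm (X - Z)" and L: "L \<ge> 0"
    and Y: "rank Y = 2"
  shows "\<exists>d :: (3, 3, 2) strang_trace. is_strang_trace F t h Y d"
proof -
  have "\<forall>s\<in>{t..t+h}. \<forall>X Z. norm (F s X - F s Z) \<le> L * norm (X - Z)" using lip by blast
  note solve = projected_ode_exists[OF cont this L]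
  obtain U0 :: "real^2^3" and S0 V0 where Y0: "low_rank_factors Y U0 S0 V0"
    using low_rank_factors_exist[OF Y] by blast
  have Kex: "\<exists>K. ode_solution (K_field F V) a b (K0 :: real^2^3) K" if "t \<le> a" "a \<le> b" "b \<le> t + h" for V :: "real^2^3" and a b K0
    unfolding K_field_def by (rule solve[OF that]) 
      (auto intro: bounded_bilinear.bounded_linear_left[OF bounded_bilinear_matrix_mult])
  have Sex: "\<exists>S. ode_solution (S_field F U V) a b S0 S" if "t \<le> a" "a \<le> b" "b \<le> t + h" for U V :: "real^2^3" and a b S0
    unfolding S_field_def
    by (rule solve[where f="\<lambda>S. U ** S ** transpose V" and g="\<lambda>X. - (transpose U ** X ** V)", OF that])
      (intro bounded_linear_minus bounded_linear_compose[OF bounded_bilinear.bounded_linear_left[OF bounded_bilinear_matrix_mult]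
        bounded_bilinear.bounded_linear_right[OF bounded_bilinear_matrix_mult]])+
  have Lex: "\<exists>K. ode_solution (L_field F U) a b (K0 :: real^2^3) K" if "t \<le> a" "a \<le> b" "b \<le> t + h" for U :: "real^2^3" and a b K0
    unfolding L_field_def
    by (rule solve[where f="\<lambda>K. U ** transpose K" and g="\<lambda>X. transpose X ** U", OF that])
      (intro bounded_linear_compose[OF bounded_bilinear.bounded_linear_left[OF bounded_bilinear_matrix_mult] bounded_linear_transpose]
       bounded_linear_compose[OF bounded_bilinear.bounded_linear_right[OF bounded_bilinear_matrix_mult] bounded_linear_transpose])+
  obtain K1 where K1: "ode_solution (K_field F V0) t (t + h/2) (U0 ** S0) K1"
    using Kex[of t "t + h/2" V0 "U0 ** S0"] h by auto
  obtain U1 Sh1 where U1: "qr_factors (K1 (t + h/2)) U1 Sh1" by (rule qr_factors_exist)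
  obtain S1 where S1: "ode_solution (S_field F U1 V0) t (t + h/2) Sh1 S1"
    using Sex[of t "t + h/2" U1 V0 Sh1] h by auto
  obtain K where L: "ode_solution (L_field F U1) t (t + h) (V0 ** transpose (S1 (t + h/2))) K"
    using Lex[of t "t + h" U1] h by auto
  obtain V1 R where V1: "qr_factors (K (t + h)) V1 R" by (rule qr_factors_exist)
  obtain S2 where S2: "ode_solution (S_field F U1 V1) (t + h/2) (t + h) (transpose R) S2"
    using Sex[of "t + h/2" "t + h" U1 V1 "transpose R"] h by auto
  obtain K2 where K2: "ode_solution (K_field F V1) (t + h/2) (t + h) (U1 ** S2 (t + h)) K2"
    using Kex[of "t + h/2" "t + h" V1 "U1 ** S2 (t + h)"] h by auto
  obtain U2 Sp where U2: "qr_factors (K2 (t + h)) U2 Sp" by (rule qr_factors_exist)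
  define d :: "(3, 3, 2) strang_trace" where "d = \<lparr>tr_U0 = U0, tr_S0 = S0, tr_V0 = V0, tr_K1 = K1, tr_U1 = U1,
     tr_Sh1 = Sh1, tr_S1 = S1, tr_L = K, tr_V1 = V1, tr_Sh2 = transpose R, tr_S2 = S2, tr_K2 = K2,
     tr_U2 = U2, tr_Sp = Sp\<rparr>"
  have "is_strang_trace F t h Y d"
    unfolding is_strang_trace_def d_def using Y0 K1 U1 S1 L V1 S2 K2 U2 by simp
  then show ?thesis by blast
qed


section \<open>The forcing term\<close>

definition psi1 :: "real \<Rightarrow> real" where
  "psi1 x = 1 + 60 * x^3 - 195 * x^4 + 204 * x^5 - 70 * x^6"

text \<open>The second derivative of \<open>psi\<close> in factored form. The double zeros at 0 and
  1 make the pieces of \<open>vartheta\<close> fit together up to the third derivative; the sign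
  change at 3/7 locates the maximum of \<open>psi1\<close>.\<close>

definition psi2 :: "real \<Rightarrow> real" where
  "psi2 x = 60 * x^2 * (1 - x)^2 * (3 - 7 * x)"

definition psi3 :: "real \<Rightarrow> real" where
  "psi3 x = 60 * x * (1 - x) * (6 - 33 * x + 35 * x^2)"

lemma psi_deriv: "(psi has_real_derivative psi1 x) (at x)"
  unfolding psi_def[abs_def] psi1_def by (auto intro!: derivative_eq_intros)

lemma psi1_deriv: "(psi1 has_real_derivative psi2 x) (at x)"
  unfolding psi1_def[abs_def] psi2_def
  by (auto intro!: derivative_eq_intros simp: algebra_simps power2_eq_square power3_eq_cube eval_nat_numeral)

lemma psi2_deriv: "(psi2 has_real_derivative psi3 x) (at x)"
  unfolding psi2_def[abs_def] psi3_def
  by (auto intro!: derivative_eq_intros simp: algebra_simps power2_eq_square power3_eq_cube eval_nat_numeral)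

lemma psi1_nonneg:
  assumes "x \<in> {0..1}"
  shows "0 \<le> psi1 x"
proof -
  \<comment> \<open>Since \<open>psi2\<close> has a double zero at 1 and \<open>psi1\<close>
    vanishes there, 1 is a triple zero of \<open>psi1\<close>; the cofactor has positive
    coefficients.\<close>
  have "psi1 x = (1 - x)^3 * (1 + 3 * x + 6 * x^2 + 70 * x^3)"
    by (simp add: psi1_def algebra_simps power2_eq_square power3_eq_cube eval_nat_numeral)
  then show ?thesis using assms by simp
qed

lemma psi1_le_2:
  assumes "x \<in> {0..1}"
  shows "psi1 x \<le> 2"
proof -
  have max: "psi1 (3/7) \<le> 2" by (simp add: psi1_def eval_nat_numeral)
  show ?thesis
  proof (cases "x \<le> 3/7")
    case True
    have "psi1 x \<le> psi1 (3/7)"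
    proof (rule DERIV_nonneg_imp_nondecreasing[OF True])
      fix y :: real assume "x \<le> y" "y \<le> 3/7"
      then have "psi2 y \<ge> 0" unfolding psi2_def by simp
      then show "\<exists>d. (psi1 has_real_derivative d) (at y) \<and> 0 \<le> d" using psi1_deriv by blast
    qed
    with max show ?thesis by simp
  next
    case False
    have "psi1 (3/7) \<ge> psi1 x"
    proof (rule DERIV_nonpos_imp_nonincreasing[of "3/7" x])
      show "3/7 \<le> x" using False by simp
      fix y :: real assume "3/7 \<le> y" "y \<le> x"
      then have "psi2 y \<le> 0" unfolding psi2_def by (intro mult_nonneg_nonpos) auto
      then show "\<exists>d. (psi1 has_real_derivative d) (at y) \<and> d \<le> 0" using psi1_deriv by blast
    qed
    with max show ?thesis by simp
  qed
qed

lemma unit_interval_parabola: "x * (1 - x) \<le> 1/4" "x \<in> {0..1} \<Longrightarrow> 0 \<le> x * (1 - x)" for x :: real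
  using zero_le_power2[of "x - 1/2"] by (simp add: algebra_simps power2_eq_square, simp)

lemma psi2_bound:
  assumes "x \<in> {0..1}"
  shows "\<bar>psi2 x\<bar> \<le> 15"
proof -
  have "psi2 x = 60 * (x * (1 - x))^2 * (3 - 7 * x)"
    by (simp add: psi2_def power_mult_distrib)
  then have "\<bar>psi2 x\<bar> = 60 * (x * (1 - x))^2 * \<bar>3 - 7 * x\<bar>"
    by (simp add: abs_mult)
  also have "\<dots> \<le> 60 * (1/4)^2 * 4"
    using assms unit_interval_parabola(1)[of x] unit_interval_parabola(2)[OF assms]
    by (intro mult_mono power_mono) auto
  finally show ?thesis by (simp add: power2_eq_square)
qed

lemma psi3_bound:
  assumes "x \<in> {0..1}"
  shows "\<bar>psi3 x\<bar> \<le> 120"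
proof -
  have x2: "0 \<le> x^2" "x^2 \<le> x"
    using assms by (auto simp: power2_eq_square mult_left_le)
  \<comment> \<open>Completing the square gives the minimum -249/140, which is above -2. The upper
    bound 8 comes from \<open>x^2 \<le> x\<close>.\<close>
  have "6 - 33 * x + 35 * x^2 = 35 * (x - 33/70)^2 - 249/140"
    by (simp add: algebra_simps power2_eq_square)
  then have l: "6 - 33 * x + 35 * x^2 \<ge> - 2"
    using zero_le_power2[of "x - 33/70"] by linarith
  have "\<bar>psi3 x\<bar> = 60 * (x * (1 - x)) * \<bar>6 - 33 * x + 35 * x^2\<bar>"
    unfolding psi3_def using assms by (simp add: abs_mult)
  also have "\<dots> \<le> 60 * (1/4) * 8"
  proof (rule mult_mono)
    show "60 * (x * (1 - x)) \<le> 60 * (1/4)" using unit_interval_parabola(1)[of x] by linarith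
    show "\<bar>6 - 33 * x + 35 * x^2\<bar> \<le> 8" using assms l x2 by auto
  qed auto
  finally show ?thesis by simp
qed

section \<open>The angle function and its derivatives\<close>

lemma hj_pos [simp]: "0 < hj j" by (simp add: hj_def)
lemma hj_nonneg [simp]: "0 \<le> hj j" by (simp add: hj_def)
lemma hj_nonzero [simp]: "hj j \<noteq> 0" using hj_pos[of j] by linarith

definition glue :: "real \<Rightarrow> (real \<Rightarrow> real) \<Rightarrow> (real \<Rightarrow> real) \<Rightarrow> real \<Rightarrow> real" where
  "glue c f g = (\<lambda>t. if t \<le> c then f t else g t)"

lemma glue_deriv:
  assumes f: "\<And>x. (f has_real_derivative f' x) (at x)"
    and g: "\<And>x. (g has_real_derivative g' x) (at x)"
    and "f c = g c" "f' c = g' c"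
  shows "(glue c f g has_real_derivative glue c f' g' x) (at x)"
proof -
  have cl: "closure {..c} \<inter> closure {c<..} = {c}" by auto
  have "((\<lambda>x. if x \<in> {..c} then f x else g x) has_vector_derivative
    (if x \<in> {..c} then f' x else g' x)) (at x within UNIV)"
    by (rule has_vector_derivative_If_within_closures[of x "{..c}" "{c<..}"])
      (use assms cl in \<open>auto simp: has_real_derivative_iff_has_vector_derivative[symmetric]
        intro: has_field_derivative_at_within\<close>)
  then show ?thesis unfolding glue_def
    by (simp add: has_real_derivative_iff_has_vector_derivative)
qed

definition ramp :: "nat \<Rightarrow> real \<Rightarrow> real" where
  "ramp j t = (t - 4 * real j * hj j) / (4 * hj j)"

text \<open>The derivative of order \<open>k\<close> of \<open>vartheta j\<close>, for
  \<open>k\<close> up to 3. On the transition interval each differentiation yields a factor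
  \<open>1 / (4 * hj j)\<close>; the first one is partly cancelled by the 4 in front of
  \<open>psi\<close>.\<close>

definition vartheta_d :: "nat \<Rightarrow> nat \<Rightarrow> real \<Rightarrow> real" where
  "vartheta_d k j = (if k = 0 then vartheta j
     else if k = 1 then glue (4 * real j * hj j) (\<lambda>_. 1 / hj j)
       (glue (4 * (real j + 1) * hj j) (\<lambda>t. psi1 (ramp j t) / hj j) (\<lambda>_. 0))
     else if k = 2 then glue (4 * real j * hj j) (\<lambda>_. 0)
       (glue (4 * (real j + 1) * hj j) (\<lambda>t. psi2 (ramp j t) / (4 * (hj j)^2)) (\<lambda>_. 0))
     else glue (4 * real j * hj j) (\<lambda>_. 0)
       (glue (4 * (real j + 1) * hj j) (\<lambda>t. psi3 (ramp j t) / (16 * (hj j)^3)) (\<lambda>_. 0)))"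

lemma ramp_deriv: "(ramp j has_real_derivative 1 / (4 * hj j)) (at t)"
  unfolding ramp_def[abs_def] by (auto intro!: derivative_eq_intros)

lemma ramp_ends [simp]: "ramp j (4 * real j * hj j) = 0" "ramp j (4 * (real j + 1) * hj j) = 1"
  "ramp j ((4 * real j + 4) * hj j) = 1"
  by (simp_all add: ramp_def field_simps)

lemma psi_ends [simp]: "psi 0 = 0" "psi 1 = 1" "psi1 0 = 1" "psi1 1 = 0" "psi2 0 = 0" "psi2 1 = 0"
  "psi3 0 = 0" "psi3 1 = 0"
  by (simp_all add: psi_def psi1_def psi2_def psi3_def)

lemma knots_le: "4 * real j * hj j \<le> 4 * (real j + 1) * hj j"
  by (intro mult_right_mono) auto

lemma vartheta_glue: "vartheta j = glue (4 * real j * hj j) (\<lambda>t. t / hj j)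
    (glue (4 * (real j + 1) * hj j) (\<lambda>t. 4 * real j + 4 * psi (ramp j t)) (\<lambda>_. 4 * (real j + 1)))"
  by (rule ext) (simp add: vartheta_def glue_def ramp_def)

lemma vartheta_deriv: "(vartheta j has_real_derivative vartheta_d 1 j t) (at t)"
proof -
  have 1: "((\<lambda>t. 4 * real j + 4 * psi (ramp j t)) has_real_derivative psi1 (ramp j t) / hj j) (at t)" for t
    using DERIV_chain2[OF psi_deriv ramp_deriv, of j t]
    by (auto intro!: derivative_eq_intros)
  have 2: "((\<lambda>t. t / hj j) has_real_derivative 1 / hj j) (at t)" for t
    by (auto intro!: derivative_eq_intros)
  show ?thesis unfolding vartheta_glue vartheta_d_def
    by (simp, intro glue_deriv 1 2) (use knots_le[of j] in \<open>auto simp: glue_def\<close>)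
qed

lemma vartheta_d_deriv:
  assumes "k = 1 \<or> k = 2"
  shows "(vartheta_d k j has_real_derivative vartheta_d (Suc k) j t) (at t)"
proof -
  have 1: "((\<lambda>t. psi1 (ramp j t) / hj j) has_real_derivative psi2 (ramp j t) / (4 * (hj j)^2)) (at t)" for t
    using DERIV_cdivide[OF DERIV_chain2[OF psi1_deriv ramp_deriv, of j t], of "hj j"]
    by (simp add: power2_eq_square mult_ac)
  have 2: "((\<lambda>t. psi2 (ramp j t) / (4 * (hj j)^2)) has_real_derivative psi3 (ramp j t) / (16 * (hj j)^3)) (at t)" for t
    using DERIV_cdivide[OF DERIV_chain2[OF psi2_deriv ramp_deriv, of j t], of "4 * (hj j)^2"]
    by (simp add: power2_eq_square power3_eq_cube mult_ac)
  have 3: "((\<lambda>_. c) has_real_derivative 0) (at t)" for t c :: real by simp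
  show ?thesis using assms
  proof
    assume "k = 1"
    then show ?thesis unfolding vartheta_d_def
      by (simp, intro glue_deriv 1 3) (use knots_le[of j] in \<open>auto simp: glue_def\<close>)
  next
    assume "k = 2"
    then show ?thesis unfolding vartheta_d_def
      by (simp, intro glue_deriv 2 3) (use knots_le[of j] in \<open>auto simp: glue_def\<close>)
  qed
qed

lemma ramp_in: "\<not> t \<le> 4 * real j * hj j \<Longrightarrow> t \<le> 4 * (real j + 1) * hj j \<Longrightarrow> ramp j t \<in> {0..1}"
  by (auto simp: ramp_def field_simps)

text \<open>The two outer pieces take the values that the transition formulas have at 0 and at 1, so
  whatever is proved on the unit interval holds at all times.\<close>

lemma vartheta_d_cases:
  assumes "\<And>x. x \<in> {0..1} \<Longrightarrow> P (psi1 x / hj j) (psi2 x / (4 * (hj j)^2)) (psi3 x / (16 * (hj j)^3))"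
  shows "P (vartheta_d 1 j t) (vartheta_d 2 j t) (vartheta_d 3 j t)"
  unfolding vartheta_d_def glue_def
  using assms[of 0] assms[of 1] assms[OF ramp_in, of t] by auto

lemma vartheta_d1_le: "\<bar>vartheta_d 1 j t\<bar> \<le> 2 / hj j"
  by (rule vartheta_d_cases[where P="\<lambda>x _ _. \<bar>x\<bar> \<le> 2 / hj j"])
    (simp add: psi1_nonneg psi1_le_2 divide_right_mono abs_div_pos)

lemma vartheta_d2_le: "\<bar>vartheta_d 2 j t\<bar> \<le> 15 / (4 * (hj j)^2)"
  by (rule vartheta_d_cases[where P="\<lambda>_ x _. \<bar>x\<bar> \<le> 15 / (4 * (hj j)^2)"])
    (simp add: psi2_bound divide_right_mono)

lemma vartheta_d3_le: "\<bar>vartheta_d 3 j t\<bar> \<le> 120 / (16 * (hj j)^3)"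
proof (rule vartheta_d_cases[where P="\<lambda>_ _ x. \<bar>x\<bar> \<le> 120 / (16 * (hj j)^3)"])
  fix x :: real assume "x \<in> {0..1}"
  then have "\<bar>psi3 x\<bar> / (16 * (hj j)^3) \<le> 120 / (16 * (hj j)^3)"
    by (intro divide_right_mono psi3_bound) auto
  then show "\<bar>psi3 x / (16 * (hj j)^3)\<bar> \<le> 120 / (16 * (hj j)^3)" by (simp add: abs_divide)
qed

lemma deriv_psi: "deriv psi x = psi1 x"
  by (rule DERIV_imp_deriv[OF psi_deriv])

lemma psi1_le_beta: "x \<in> {0..1} \<Longrightarrow> \<bar>psi1 x\<bar> \<le> beta_psi"
  unfolding beta_psi_def deriv_psi
  by (rule cSUP_upper) (auto intro!: bdd_aboveI[where M=2] simp: psi1_nonneg psi1_le_2)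

lemma vartheta_d1_le_beta: "\<bar>vartheta_d 1 j t\<bar> \<le> beta_psi / hj j"
  by (rule vartheta_d_cases[where P="\<lambda>x _ _. \<bar>x\<bar> \<le> beta_psi / hj j"])
    (simp add: psi1_le_beta divide_right_mono)

text \<open>The double angle \<open>b = \<pi>\<theta>/2\<close> turns \<open>W\<close> into a constant plus half of a rotating traceless matrix.\<close>

definition H_rot :: "real \<Rightarrow> real^3^3" where
  "H_rot b = (\<chi> i k. if i = 2 \<and> k = 2 then cos b else if i = 3 \<and> k = 3 then - cos b
     else if i = 2 \<and> k = 3 \<or> i = 3 \<and> k = 2 then sin b else 0)"

definition K_rot :: "real \<Rightarrow> real^3^3" where
  "K_rot b = (\<chi> i k. if i = 2 \<and> k = 2 then - sin b else if i = 3 \<and> k = 3 then sin b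
     else if i = 2 \<and> k = 3 \<or> i = 3 \<and> k = 2 then cos b else 0)"

lemma norm_H_rot: "norm (H_rot b) = sqrt 2" and norm_K_rot: "norm (K_rot b) = sqrt 2"
proof -
  have "(norm (H_rot b))\<^sup>2 = 2 * ((sin b)\<^sup>2 + (cos b)\<^sup>2)"
    unfolding norm_sq_matrix by (simp add: H_rot_def sum_3)
  then show "norm (H_rot b) = sqrt 2" by (simp add: real_sqrt_unique)
  have "(norm (K_rot b))\<^sup>2 = 2 * ((sin b)\<^sup>2 + (cos b)\<^sup>2)"
    unfolding norm_sq_matrix by (simp add: K_rot_def sum_3)
  then show "norm (K_rot b) = sqrt 2" by (simp add: real_sqrt_unique)
qed

lemma rot_derivs:
  assumes "(f has_real_derivative f') (at x within S)"
  shows "((\<lambda>x. H_rot (f x)) has_vector_derivative f' *\<^sub>R K_rot (f x)) (at x within S)"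
    and "((\<lambda>x. K_rot (f x)) has_vector_derivative - f' *\<^sub>R H_rot (f x)) (at x within S)"
proof -
  define D1 where "D1 = matrix_unit 2 2 - matrix_unit 3 3"
  define D2 where "D2 = matrix_unit 2 3 + matrix_unit 3 2"
  have H: "H_rot = (\<lambda>b. cos b *\<^sub>R D1 + sin b *\<^sub>R D2)" and K: "K_rot = (\<lambda>b. - sin b *\<^sub>R D1 + cos b *\<^sub>R D2)"
    by (auto simp: fun_eq_iff vec_eq_iff forall_3 H_rot_def K_rot_def D1_def D2_def matrix_unit_def)
  have c: "((\<lambda>x. cos (f x)) has_real_derivative - sin (f x) * f') (at x within S)"
    and s: "((\<lambda>x. sin (f x)) has_real_derivative cos (f x) * f') (at x within S)"
    by (rule DERIV_chain2[OF DERIV_cos assms]) (rule DERIV_chain2[OF DERIV_sin assms])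
  show "((\<lambda>x. H_rot (f x)) has_vector_derivative f' *\<^sub>R K_rot (f x)) (at x within S)"
    unfolding H K
    using has_vector_derivative_add[OF has_vector_derivative_scaleR[OF c has_vector_derivative_const[of D1]]
      has_vector_derivative_scaleR[OF s has_vector_derivative_const[of D2]]]
    by (simp add: algebra_simps)
  show "((\<lambda>x. K_rot (f x)) has_vector_derivative - f' *\<^sub>R H_rot (f x)) (at x within S)"
    unfolding H K
    using has_vector_derivative_add[OF has_vector_derivative_scaleR[OF DERIV_minus[OF s] has_vector_derivative_const[of D1]]
      has_vector_derivative_scaleR[OF c has_vector_derivative_const[of D2]]]
    by (simp add: algebra_simps)
qed

lemma nu_nth [simp]: "nu \<theta> $ 1 = 0" "nu \<theta> $ 2 = cos (pi * \<theta> / 4)" "nu \<theta> $ 3 = sin (pi * \<theta> / 4)"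
  by (simp_all add: nu_def)

lemma W_eq_H_rot: "W \<theta> = (1/2) *\<^sub>R (matrix_unit 2 2 + matrix_unit 3 3) + (1/2) *\<^sub>R H_rot (pi * \<theta> / 2)"
proof -
  define a where "a = pi * \<theta> / 4"
  have b: "pi * \<theta> / 2 = 2 * a" by (simp add: a_def)
  have 1: "cos a * cos a = 1/2 + cos (2 * a) / 2" unfolding cos_double_cos by (simp add: power2_eq_square field_simps)
  have 2: "sin a * sin a = 1/2 - cos (2 * a) / 2" unfolding cos_double_sin by (simp add: power2_eq_square field_simps)
  have 3: "cos a * sin a = sin (2 * a) / 2" "sin a * cos a = sin (2 * a) / 2" unfolding sin_double by simp_all
  show ?thesis unfolding b
    by (simp add: vec_eq_iff forall_3 W_def H_rot_def matrix_unit_def a_def[symmetric] 1 2 3)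
qed

lemma W_comp_deriv:
  assumes "(f has_real_derivative f') (at x within S)"
  shows "((\<lambda>x. W (f x)) has_vector_derivative (f' * (pi / 4)) *\<^sub>R K_rot (pi * f x / 2)) (at x within S)"
proof -
  have "((\<lambda>x. pi * f x / 2) has_real_derivative (pi / 2) * f') (at x within S)"
    using DERIV_cmult[OF assms, of "pi / 2"] by simp
  from rot_derivs(1)[OF this]
  have "((\<lambda>x. (1/2) *\<^sub>R H_rot (pi * f x / 2)) has_vector_derivative
     (1/2) *\<^sub>R (((pi / 2) * f') *\<^sub>R K_rot (pi * f x / 2))) (at x within S)"
    by (rule bounded_linear.has_vector_derivative[OF bounded_linear_scaleR_right])
  moreover have "(1/2) *\<^sub>R (((pi / 2) * f') *\<^sub>R K_rot (pi * f x / 2)) = (f' * (pi / 4)) *\<^sub>R K_rot (pi * f x / 2)"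
    by simp
  ultimately have "((\<lambda>x. (1/2) *\<^sub>R H_rot (pi * f x / 2)) has_vector_derivative
     (f' * (pi / 4)) *\<^sub>R K_rot (pi * f x / 2)) (at x within S)" by (simp add: mult.commute)
  from has_vector_derivative_add[OF has_vector_derivative_const this]
  show ?thesis unfolding W_eq_H_rot by (simp only: add_0_left)
qed

lemma R_fam_eq: "R_fam j t = ((hj j)^3 * vartheta_d 1 j t * (pi / 4)) *\<^sub>R K_rot (pi * vartheta j t / 2)"
proof -
  have "vector_derivative W (at \<theta>) = (pi / 4) *\<^sub>R K_rot (pi * \<theta> / 2)" for \<theta>
    using W_comp_deriv[OF DERIV_ident, of \<theta> UNIV] by (simp add: vector_derivative_at)
  then show ?thesis
    unfolding R_fam_def DERIV_imp_deriv[OF vartheta_deriv] by simp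
qed

text \<open>The forcing is an exact derivative, so its integral over a substep is a difference of
  two values of \<open>W\<close>, whatever the angular speed in between.\<close>

lemma W_vartheta_deriv:
  "((\<lambda>t. (hj j)^3 *\<^sub>R W (vartheta j t)) has_vector_derivative R_fam j t) (at t within S)"
  using bounded_linear.has_vector_derivative[OF bounded_linear_scaleR_right
      W_comp_deriv[OF has_field_derivative_at_within[OF vartheta_deriv]], of "(hj j)^3"]
  unfolding R_fam_eq by (simp add: mult_ac)

definition Rt_fam :: "nat \<Rightarrow> real \<Rightarrow> real^3^3" where
  "Rt_fam j t = ((hj j)^3 * (pi / 4)) *\<^sub>R (vartheta_d 2 j t *\<^sub>R K_rot (pi * vartheta j t / 2)
     - ((vartheta_d 1 j t)^2 * (pi / 2)) *\<^sub>R H_rot (pi * vartheta j t / 2))"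

definition Rtt_fam :: "nat \<Rightarrow> real \<Rightarrow> real^3^3" where
  "Rtt_fam j t = ((hj j)^3 * (pi / 4)) *\<^sub>R
     ((vartheta_d 3 j t - (vartheta_d 1 j t)^3 * (pi / 2)^2) *\<^sub>R K_rot (pi * vartheta j t / 2)
     - (3 * vartheta_d 1 j t * vartheta_d 2 j t * (pi / 2)) *\<^sub>R H_rot (pi * vartheta j t / 2))"

lemma angle_deriv: "((\<lambda>t. pi * vartheta j t / 2) has_real_derivative vartheta_d 1 j t * (pi / 2)) (at t within S)"
  using DERIV_cmult[OF has_field_derivative_at_within[OF vartheta_deriv], of "pi / 2"] by (simp add: mult_ac)

lemma R_fam_deriv: "(R_fam j has_vector_derivative Rt_fam j t) (at t within S)"
proof -
  have d1: "(vartheta_d 1 j has_real_derivative vartheta_d 2 j t) (at t within S)"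
    using vartheta_d_deriv[of 1 j t] by (simp add: numeral_2_eq_2 has_field_derivative_at_within)
  have "((\<lambda>t. ((hj j)^3 * (pi / 4)) *\<^sub>R (vartheta_d 1 j t *\<^sub>R K_rot (pi * vartheta j t / 2)))
    has_vector_derivative Rt_fam j t) (at t within S)"
    unfolding Rt_fam_def
    by (rule bounded_linear.has_vector_derivative[OF bounded_linear_scaleR_right])
      (use has_vector_derivative_scaleR[OF d1 rot_derivs(2)[OF angle_deriv]]
        in \<open>simp add: algebra_simps power2_eq_square\<close>)
  then show ?thesis unfolding R_fam_eq[abs_def] by (simp add: mult_ac)
qed

lemma Rt_fam_deriv: "(Rt_fam j has_vector_derivative Rtt_fam j t) (at t within S)"
proof -
  have d1: "(vartheta_d 1 j has_real_derivative vartheta_d 2 j t) (at t within S)"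
    using vartheta_d_deriv[of 1 j t] by (simp add: numeral_2_eq_2 has_field_derivative_at_within)
  have d2: "(vartheta_d 2 j has_real_derivative vartheta_d 3 j t) (at t within S)"
    using vartheta_d_deriv[of 2 j t] by (simp add: numeral_3_eq_3 has_field_derivative_at_within)
  have d11: "((\<lambda>t. (vartheta_d 1 j t)^2 * (pi / 2)) has_real_derivative
      2 * vartheta_d 1 j t * vartheta_d 2 j t * (pi / 2)) (at t within S)"
    using d1 by (auto intro!: derivative_eq_intros)
  have "(Rt_fam j has_vector_derivative ((hj j)^3 * (pi / 4)) *\<^sub>R
      (vartheta_d 2 j t *\<^sub>R (- (vartheta_d 1 j t * (pi / 2)) *\<^sub>R H_rot (pi * vartheta j t / 2))
        + vartheta_d 3 j t *\<^sub>R K_rot (pi * vartheta j t / 2)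
       - (((vartheta_d 1 j t)^2 * (pi / 2)) *\<^sub>R ((vartheta_d 1 j t * (pi / 2)) *\<^sub>R K_rot (pi * vartheta j t / 2))
        + (2 * vartheta_d 1 j t * vartheta_d 2 j t * (pi / 2)) *\<^sub>R H_rot (pi * vartheta j t / 2)))) (at t within S)"
    (is "(_ has_vector_derivative ?D) _")
    unfolding Rt_fam_def[abs_def]
    by (rule bounded_linear.has_vector_derivative[OF bounded_linear_scaleR_right]
        has_vector_derivative_diff has_vector_derivative_scaleR d2 d11 rot_derivs angle_deriv)+
  moreover have "?D = Rtt_fam j t"
    unfolding Rtt_fam_def
    by (simp add: vec_eq_iff algebra_simps power2_eq_square power3_eq_cube)
  ultimately show ?thesis by simp
qed

lemma sqrt_2_le: "sqrt 2 \<le> 1.42"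
  by (rule real_le_lsqrt) (auto simp: power2_eq_square)

lemma norm_R_fam_le_eps: "norm (R_fam j t) \<le> eps_fam j"
proof -
  have "norm (R_fam j t) = (hj j)^3 * \<bar>vartheta_d 1 j t\<bar> * (pi / 4) * sqrt 2"
    unfolding R_fam_eq by (simp add: norm_K_rot abs_mult)
  also have "\<dots> \<le> (hj j)^3 * (beta_psi / hj j) * (pi / 4) * sqrt 2"
    by (intro mult_right_mono mult_left_mono vartheta_d1_le_beta) auto
  also have "\<dots> = eps_fam j"
    by (simp add: eps_fam_def power3_eq_cube power2_eq_square)
  finally show ?thesis .
qed

lemma norm_R_fam_le: "norm (R_fam j t) \<le> 4 * (hj j)^2"
proof -
  have "norm (R_fam j t) = (hj j)^3 * \<bar>vartheta_d 1 j t\<bar> * ((pi / 4) * sqrt 2)"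
    unfolding R_fam_eq by (simp add: norm_K_rot abs_mult)
  also have "\<dots> \<le> (hj j)^3 * (2 / hj j) * (1 * 2)"
    using pi_less_4 sqrt_2_le
    by (intro mult_mono vartheta_d1_le) auto
  also have "\<dots> = 4 * (hj j)^2"
    by (simp add: power3_eq_cube power2_eq_square)
  finally show ?thesis .
qed

lemma hj_le: "j \<ge> 3 \<Longrightarrow> hj j \<le> 1/512"
proof -
  assume "j \<ge> 3"
  then have "3^2 \<le> j^2" by (intro power_mono) auto
  then have "(2::real)^9 \<le> 2^(j^2)" by (intro power_increasing) auto
  then show ?thesis unfolding hj_def by (simp add: field_simps)
qed

lemma norm_Rt_fam_le:
  assumes "hj j \<le> 1"
  shows "norm (Rt_fam j t) \<le> 123"
proof -
  let ?h = "hj j" let ?K = "K_rot (pi * vartheta j t / 2)" let ?H = "H_rot (pi * vartheta j t / 2)"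
  have sq: "(vartheta_d 1 j t)^2 \<le> (2 / ?h)^2"
    using power_mono[OF vartheta_d1_le[of j t], of 2] by simp
  have "norm (vartheta_d 2 j t *\<^sub>R ?K - ((vartheta_d 1 j t)^2 * (pi / 2)) *\<^sub>R ?H)
    \<le> norm (vartheta_d 2 j t *\<^sub>R ?K) + norm (((vartheta_d 1 j t)^2 * (pi / 2)) *\<^sub>R ?H)"
    by (rule norm_triangle_ineq4)
  also have "\<dots> = (\<bar>vartheta_d 2 j t\<bar> + (vartheta_d 1 j t)^2 * (pi / 2)) * sqrt 2"
    unfolding norm_scaleR norm_H_rot norm_K_rot by (simp add: abs_mult algebra_simps)
  also have "\<dots> \<le> (15 / (4 * ?h^2) + (2 / ?h)^2 * 2) * 1.42"
    using pi_less_4 by (intro mult_mono add_mono vartheta_d2_le sq sqrt_2_le) (auto intro!: add_nonneg_nonneg)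
  also have "\<dots> = 11.75 * 1.42 / ?h^2" by (simp add: power_divide field_simps)
  finally have "norm (Rt_fam j t) \<le> (?h^3 * 1) * (11.75 * 1.42 / ?h^2)"
    unfolding Rt_fam_def norm_scaleR using pi_less_4 by (intro mult_mono) (auto simp: abs_mult)
  also have "\<dots> = ?h * (11.75 * 1.42)" by (simp add: power3_eq_cube power2_eq_square)
  also have "\<dots> \<le> 1 * (11.75 * 1.42)" using assms by (intro mult_right_mono) auto
  finally show ?thesis by simp
qed

lemma norm_Rtt_fam_le: "norm (Rtt_fam j t) \<le> 123"
proof -
  let ?h = "hj j" let ?K = "K_rot (pi * vartheta j t / 2)" let ?H = "H_rot (pi * vartheta j t / 2)"
  let ?a = "vartheta_d 1 j t" let ?b = "vartheta_d 2 j t" let ?c = "vartheta_d 3 j t"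
  have "norm ((?c - ?a^3 * (pi / 2)^2) *\<^sub>R ?K - (3 * ?a * ?b * (pi / 2)) *\<^sub>R ?H)
    \<le> norm ((?c - ?a^3 * (pi / 2)^2) *\<^sub>R ?K) + norm ((3 * ?a * ?b * (pi / 2)) *\<^sub>R ?H)"
    by (rule norm_triangle_ineq4)
  also have "\<dots> = (\<bar>?c - ?a^3 * (pi / 2)^2\<bar> + 3 * \<bar>?a\<bar> * \<bar>?b\<bar> * (pi / 2)) * sqrt 2"
    unfolding norm_scaleR norm_H_rot norm_K_rot by (simp add: abs_mult algebra_simps)
  also have "\<dots> \<le> ((\<bar>?c\<bar> + \<bar>?a\<bar>^3 * (pi / 2)^2) + 3 * \<bar>?a\<bar> * \<bar>?b\<bar> * (pi / 2)) * sqrt 2"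
    using abs_triangle_ineq4[of ?c "?a^3 * (pi / 2)^2"]
    by (intro mult_right_mono add_right_mono) (auto simp: abs_mult power_abs)
  also have "\<dots> \<le> ((120 / (16 * ?h^3) + (2 / ?h)^3 * 2^2) + 3 * (2 / ?h) * (15 / (4 * ?h^2)) * 2) * 1.42"
    using pi_less_4 
    by (intro mult_mono add_mono power_mono vartheta_d2_le vartheta_d3_le vartheta_d1_le sqrt_2_le)
      (auto intro!: add_nonneg_nonneg mult_nonneg_nonneg)
  \<comment> \<open>Here 84.5 = 7.5 + 32 + 45, using \<open>pi / 2 \<le> 2\<close>. The resulting
    84.5 * 1.42 = 119.99 is the largest of the derivative bounds and the one that comes close to
    123.\<close>
  also have "\<dots> = 84.5 * 1.42 / ?h^3" by (simp add: power_divide field_simps power2_eq_square power3_eq_cube)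
  finally have "norm (Rtt_fam j t) \<le> (?h^3 * 1) * (84.5 * 1.42 / ?h^3)"
    unfolding Rtt_fam_def norm_scaleR using pi_less_4 by (intro mult_mono) (auto simp: abs_mult)
  also have "\<dots> = 84.5 * 1.42" by simp
  finally show ?thesis by simp
qed


section \<open>Null vectors and invertible cores\<close>

lemma W_outer: "W \<theta> = outer (nu \<theta>) (nu \<theta>)"
  by (simp add: W_def vec_eq_iff)

lemma norm_nu [simp]: "norm (nu \<theta>) = 1"
proof -
  have "(norm (nu \<theta>))\<^sup>2 = 1"
    unfolding norm_sq_3 nu_nth using sin_cos_squared_add[of "pi * \<theta> / 4"] by simp
  then show ?thesis by (simp add: power2_eq_1_iff norm_ge_zero)
      (smt (verit) norm_ge_zero)
qed

lemma norm_W [simp]: "norm (W \<theta>) = 1"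
  by (simp add: W_outer norm_outer)

abbreviation "e1 \<equiv> axis 1 1 :: real^3"

lemma e1_inner [simp]: "e1 \<bullet> x = x $ 1" "x \<bullet> e1 = x $ 1"
  by (simp_all add: inner_axis inner_axis')

text \<open>Multiplying the decomposition of \<open>X\<close> by \<open>m\<close> gives a vanishing
  combination of \<open>v\<close>, \<open>\<kappa>\<close> and a small remainder. As
  \<open>v\<close> and \<open>\<kappa>\<close> are nearly orthogonal, testing with \<open>v\<close>
  shows that \<open>m \<bullet> u\<close> is of order \<open>\<delta> * k\<close>; testing with
  \<open>\<kappa>\<close> then bounds \<open>k * (m \<bullet> \<mu>)\<close> by the same order, and
  \<open>k\<close> cancels. Thus a tiny second component still fixes the normal up to
  \<open>\<delta>\<close>.\<close>

lemma left_null_estimate: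
  fixes u v \<mu> \<kappa> m :: "real^3"
  assumes X: "norm (X - outer u v - k *\<^sub>R outer \<mu> \<kappa>) \<le> \<delta> * k" and k: "k > 0"
    and m: "norm m = 1" "m v* X = 0" and v: "norm v = 1" and vk: "\<bar>v \<bullet> \<kappa>\<bar> \<le> \<delta>"
    and \<kappa>: "1/4 \<le> \<kappa> \<bullet> \<kappa>" "norm \<kappa> \<le> 1" and \<mu>: "norm \<mu> \<le> 1" and \<delta>: "0 \<le> \<delta>" "\<delta> \<le> 1/2"
  shows "\<bar>m \<bullet> u\<bar> \<le> 2 * \<delta> * k" "\<bar>m \<bullet> \<mu>\<bar> \<le> 8 * \<delta>"
proof -
  define E where "E = X - outer u v - k *\<^sub>R outer \<mu> \<kappa>"
  define w where "w = m v* E"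
  have "X = outer u v + k *\<^sub>R outer \<mu> \<kappa> + E" by (simp add: E_def)
  then have "(m \<bullet> u) *\<^sub>R v + (k * (m \<bullet> \<mu>)) *\<^sub>R \<kappa> + w = 0"
    using m(2) by (simp add: vm_add_right vm_scaleR_right vec_mult_outer w_def)
  then have eq: "((m \<bullet> u) *\<^sub>R v + (k * (m \<bullet> \<mu>)) *\<^sub>R \<kappa> + w) \<bullet> x = 0" for x by simp
  have nw: "norm w \<le> \<delta> * k"
    using norm_vector_matrix_le[of m E] X m(1) by (simp add: w_def E_def)
  have mm: "\<bar>m \<bullet> \<mu>\<bar> \<le> 1"
    using Cauchy_Schwarz_ineq2[of m \<mu>] m(1) \<mu> by simp
  have vv: "v \<bullet> v = 1" using v by (simp add: norm_eq_1)
  have "m \<bullet> u = - (k * (m \<bullet> \<mu>) * (v \<bullet> \<kappa>)) - w \<bullet> v"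
    using eq[of v] by (simp add: inner_add_left vv inner_commute[of \<kappa> v])
  then have "\<bar>m \<bullet> u\<bar> \<le> \<bar>k * (m \<bullet> \<mu>) * (v \<bullet> \<kappa>)\<bar> + \<bar>w \<bullet> v\<bar>" by linarith
  also have "\<dots> \<le> k * 1 * \<delta> + \<delta> * k"
  proof (rule add_mono)
    show "\<bar>k * (m \<bullet> \<mu>) * (v \<bullet> \<kappa>)\<bar> \<le> k * 1 * \<delta>"
      unfolding abs_mult using k by (intro mult_mono mm vk) auto
    show "\<bar>w \<bullet> v\<bar> \<le> \<delta> * k"
      using Cauchy_Schwarz_ineq2[of w v] v nw by simp
  qed
  finally show mu: "\<bar>m \<bullet> u\<bar> \<le> 2 * \<delta> * k" by simp
  have "k * (m \<bullet> \<mu>) * (\<kappa> \<bullet> \<kappa>) = - ((m \<bullet> u) * (v \<bullet> \<kappa>)) - w \<bullet> \<kappa>"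
    using eq[of \<kappa>] by (simp add: inner_add_left)
  then have "\<bar>k * (m \<bullet> \<mu>) * (\<kappa> \<bullet> \<kappa>)\<bar> \<le> \<bar>(m \<bullet> u) * (v \<bullet> \<kappa>)\<bar> + \<bar>w \<bullet> \<kappa>\<bar>" by linarith
  also have "\<dots> \<le> 2 * \<delta> * k * (1/2) + \<delta> * k"
  proof (rule add_mono)
    show "\<bar>(m \<bullet> u) * (v \<bullet> \<kappa>)\<bar> \<le> 2 * \<delta> * k * (1/2)"
      unfolding abs_mult using mu vk \<delta> k by (intro mult_mono) auto
    have "norm w * norm \<kappa> \<le> (\<delta> * k) * 1" using nw \<kappa>(2) \<delta> k by (intro mult_mono) auto
    then show "\<bar>w \<bullet> \<kappa>\<bar> \<le> \<delta> * k" using Cauchy_Schwarz_ineq2[of w \<kappa>] by simp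
  qed
  finally have "k * (\<bar>m \<bullet> \<mu>\<bar> * (\<kappa> \<bullet> \<kappa>)) \<le> k * (2 * \<delta>)"
    using k by (simp add: abs_mult mult_ac)
  then have "\<bar>m \<bullet> \<mu>\<bar> * (\<kappa> \<bullet> \<kappa>) \<le> 2 * \<delta>" using k by simp
  moreover have "\<bar>m \<bullet> \<mu>\<bar> * (1/4) \<le> \<bar>m \<bullet> \<mu>\<bar> * (\<kappa> \<bullet> \<kappa>)" by (intro mult_left_mono \<kappa>) auto
  ultimately show "\<bar>m \<bullet> \<mu>\<bar> \<le> 8 * \<delta>" by linarith
qed

lemma right_null_estimate:
  fixes u v \<mu> \<kappa> n :: "real^3"
  assumes X: "norm (X - outer u v - k *\<^sub>R outer \<mu> \<kappa>) \<le> \<delta> * k" and k: "k > 0"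
    and n: "norm n = 1" "X *v n = 0" and u: "norm u = 1" and uk: "\<bar>u \<bullet> \<mu>\<bar> \<le> \<delta>"
    and \<mu>: "1/4 \<le> \<mu> \<bullet> \<mu>" "norm \<mu> \<le> 1" and \<kappa>: "norm \<kappa> \<le> 1" and \<delta>: "0 \<le> \<delta>" "\<delta> \<le> 1/2"
  shows "\<bar>n \<bullet> v\<bar> \<le> 2 * \<delta> * k" "\<bar>n \<bullet> \<kappa>\<bar> \<le> 8 * \<delta>"
proof -
  have "transpose X - outer v u - k *\<^sub>R outer \<kappa> \<mu> = transpose (X - outer u v - k *\<^sub>R outer \<mu> \<kappa>)"
    by (simp add: transpose_diff transpose_scalar)
  then have T: "norm (transpose X - outer v u - k *\<^sub>R outer \<kappa> \<mu>) \<le> \<delta> * k"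
    using X by (simp add: norm_transpose)
  have "n v* transpose X = 0" using n(2) by simp
  from left_null_estimate[OF T k n(1) this u uk \<mu> \<kappa> \<delta>]
  show "\<bar>n \<bullet> v\<bar> \<le> 2 * \<delta> * k" "\<bar>n \<bullet> \<kappa>\<bar> \<le> 8 * \<delta>" .
qed

text \<open>A singular core would leave the columns of \<open>U\<close> room for a second left null vector; two
  orthonormal left null vectors are both nearly orthogonal to \<open>u\<close> and \<open>\<mu>\<close>, which span a plane.\<close>

lemma core_invertible:
  fixes u v \<mu> \<kappa> :: "real^3" and U V :: "real^2^3"
  assumes X: "norm (U ** S ** transpose V - outer u v - k *\<^sub>R outer \<mu> \<kappa>) \<le> \<delta> * k" and k: "0 < k" "k \<le> 1"
    and U: "orthonormal_cols U" and u: "norm u = 1" and v: "norm v = 1"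
    and vk: "\<bar>v \<bullet> \<kappa>\<bar> \<le> \<delta>" and um: "\<bar>u \<bullet> \<mu>\<bar> \<le> \<delta>"
    and \<kappa>: "1/4 \<le> \<kappa> \<bullet> \<kappa>" "norm \<kappa> \<le> 1" and \<mu>: "1/4 \<le> \<mu> \<bullet> \<mu>" "norm \<mu> \<le> 1"
    and \<delta>: "0 \<le> \<delta>" "\<delta> \<le> 1/1000"
  shows "invertible S"
proof (rule ccontr)
  assume "\<not> invertible S"
  then have "\<not> invertible (transpose S)" using transpose_invertible[of "transpose S"] by auto
  then obtain w where w: "w \<noteq> 0" "w v* S = 0"
    using matrix_left_invertible_ker[of "transpose S"] by (auto simp: invertible_left_inverse)
  define w' where "w' = (1 / norm w) *\<^sub>R w"
  have w': "norm w' = 1" "w' v* S = 0"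
    using w by (auto simp: w'_def bounded_bilinear.scaleR_left[OF bounded_bilinear_vector_matrix_mult])
  define m' where "m' = U *v w'"
  have UU: "transpose U ** U = mat 1" using U by (simp add: orthonormal_cols_def)
  have Um': "m' v* U = w'"
  proof -
    have "m' v* U = transpose U *v (U *v w')" by (simp add: m'_def)
    then show ?thesis unfolding matrix_vector_mul_assoc UU by simp
  qed
  obtain m where m: "norm m = 1" "m v* U = 0" "U ** transpose U = mat 1 - outer m m"
    using orthonormal_cols_2_3_normal[OF U] by blast
  have m'n: "norm m' = 1"
  proof -
    have "m' \<bullet> m' = (m' v* U) \<bullet> w'" unfolding m'_def by (simp add: inner_mv_right)
    then show ?thesis using w'(1) by (simp add: Um' norm_eq_1)
  qed
  have mm': "m \<bullet> m' = 0" unfolding m'_def by (simp add: inner_mv_right m)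
  have n1: "m v* (U ** S ** transpose V) = 0"
    by (simp add: vector_matrix_mul_assoc[symmetric] m)
  have n2: "m' v* (U ** S ** transpose V) = 0"
    by (simp add: vector_matrix_mul_assoc[symmetric] Um' w')
  have \<delta>2: "\<delta> \<le> 1/2" using \<delta> by simp
  note b1 = left_null_estimate[OF X k(1) m(1) n1 v vk \<kappa> \<mu>(2) \<delta>(1) \<delta>2]
  note b2 = left_null_estimate[OF X k(1) m'n n2 v vk \<kappa> \<mu>(2) \<delta>(1) \<delta>2]
  have dk: "2 * \<delta> * k \<le> 2 * \<delta>" using \<delta> k mult_left_le[of k "2 * \<delta>"] by simp
  \<comment> \<open>Taking the two null vectors as columns supplies, through
    \<open>orthonormal_cols_2_3_normal\<close>, the third vector \<open>n\<close> of an orthonormal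
    basis.\<close>
  define U' :: "real^2^3" where "U' = (\<chi> i k. if k = 1 then m $ i else m' $ i)"
  have "(\<Sum>i\<in>UNIV. m $ i * m $ i) = 1" "(\<Sum>i\<in>UNIV. m' $ i * m' $ i) = 1" "(\<Sum>i\<in>UNIV. m $ i * m' $ i) = 0"
    using m(1) m'n mm' by (simp_all add: norm_eq_1 inner_vec_def)
  then have "orthonormal_cols U'"
    unfolding orthonormal_cols_def U'_def
    by (simp add: vec_eq_iff matrix_matrix_mult_def transpose_def mat_def forall_2 mult.commute)
  then obtain n where n: "U' ** transpose U' = mat 1 - outer n n"
    using orthonormal_cols_2_3_normal by blast
  have UU': "U' ** transpose U' = outer m m + outer m' m'"
    unfolding U'_def by (simp add: vec_eq_iff matrix_matrix_mult_def transpose_def sum_2)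
  have "outer m m + outer m' m' + outer n n = mat 1"
    using n unfolding UU' by (simp add: algebra_simps)
  then have "(outer m m + outer m' m' + outer n n) *v x = x" for x by simp
  then have ex: "(m \<bullet> x) *\<^sub>R m + (m' \<bullet> x) *\<^sub>R m' + (n \<bullet> x) *\<^sub>R n = x" for x
    by (simp add: matrix_vector_mult_add_rdistrib outer_mult_vec)
  have par: "x \<bullet> y = (m \<bullet> x) * (m \<bullet> y) + (m' \<bullet> x) * (m' \<bullet> y) + (n \<bullet> x) * (n \<bullet> y)" for x y
    using arg_cong[OF ex[of x], of "\<lambda>z. z \<bullet> y"] by (simp add: inner_add_left)
  have sq: "a * a \<le> c * c" if "\<bar>a\<bar> \<le> c" for a c :: real
    using mult_mono[OF that that] that by simp
  have small: "\<bar>m \<bullet> u\<bar> \<le> 1/100" "\<bar>m' \<bullet> u\<bar> \<le> 1/100" "\<bar>m \<bullet> \<mu>\<bar> \<le> 1/100" "\<bar>m' \<bullet> \<mu>\<bar> \<le> 1/100"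
    using b1 b2 dk \<delta> by linarith+
  have "u \<bullet> u = 1" using u by (simp add: norm_eq_1)
  then have 1: "(n \<bullet> u) * (n \<bullet> u) \<ge> 1/2"
    using par[of u u] sq[OF small(1)] sq[OF small(2)] by simp
  have 2: "(n \<bullet> \<mu>) * (n \<bullet> \<mu>) \<ge> 1/8"
    using par[of \<mu> \<mu>] sq[OF small(3)] sq[OF small(4)] \<mu>(1) by simp
  \<comment> \<open>Both \<open>u\<close> and \<open>\<mu>\<close> point mainly along
    \<open>n\<close>, so their inner product cannot be small, against their near
    orthogonality.\<close>
  have "(1/2) * (1/8) \<le> ((n \<bullet> u) * (n \<bullet> u)) * ((n \<bullet> \<mu>) * (n \<bullet> \<mu>))"
    using 1 2 by (intro mult_mono) auto
  moreover have "\<bar>(n \<bullet> u) * (n \<bullet> \<mu>)\<bar> \<le> 1/10"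
  proof -
    have "\<bar>(m \<bullet> u) * (m \<bullet> \<mu>)\<bar> \<le> (1/100) * (1/100)"
      unfolding abs_mult by (rule mult_mono[OF small(1) small(3)]) simp_all
    moreover have "\<bar>(m' \<bullet> u) * (m' \<bullet> \<mu>)\<bar> \<le> (1/100) * (1/100)"
      unfolding abs_mult by (rule mult_mono[OF small(2) small(4)]) simp_all
    ultimately show ?thesis using par[of u \<mu>] um \<delta> by linarith
  qed
  from sq[OF this] have "((n \<bullet> u) * (n \<bullet> u)) * ((n \<bullet> \<mu>) * (n \<bullet> \<mu>)) \<le> (1/10) * (1/10)"
    by (simp add: mult_ac)
  ultimately show False by simp
qed

section \<open>Planes with nearly known normals, and the phases of a step\<close>

definition normal_proj :: "real^3 \<Rightarrow> real^3^3" where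
  "normal_proj m = mat 1 - outer m m"

lemma normal_proj_vec: "normal_proj m *v x = x - (m \<bullet> x) *\<^sub>R m"
  by (simp add: normal_proj_def algebra_simps outer_mult_vec)

text \<open>The plane orthogonal to \<open>n\<close> is nearly spanned by the first axis and
  \<open>nu \<theta>\<close>. This leaves the sign of \<open>n\<close> open, which is harmless
  because the projection and the entries needed later are even in \<open>n\<close>.\<close>

definition near_normal :: "real \<Rightarrow> real^3 \<Rightarrow> real \<Rightarrow> bool" where
  "near_normal \<epsilon> n \<theta> \<longleftrightarrow> norm n = 1 \<and> \<bar>n $ 1\<bar> \<le> \<epsilon> \<and> \<bar>n \<bullet> nu \<theta>\<bar> \<le> \<epsilon>"

lemma near_normal_mono: "near_normal \<epsilon> n \<theta> \<Longrightarrow> \<epsilon> \<le> \<epsilon>' \<Longrightarrow> near_normal \<epsilon>' n \<theta>"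
  unfolding near_normal_def by linarith

definition nup :: "real \<Rightarrow> real^3" where
  "nup \<theta> = vector [0, - sin (pi * \<theta> / 4), cos (pi * \<theta> / 4)]"

lemma nup_nth [simp]: "nup \<theta> $ 1 = 0" "nup \<theta> $ 2 = - sin (pi * \<theta> / 4)" "nup \<theta> $ 3 = cos (pi * \<theta> / 4)"
  by (simp_all add: nup_def)

lemma norm_nup [simp]: "norm (nup \<theta>) = 1"
proof -
  have "(norm (nup \<theta>))\<^sup>2 = 1"
    unfolding norm_sq_3 nup_nth using sin_cos_squared_add[of "pi * \<theta> / 4"] by simp
  then show ?thesis by (simp add: power2_eq_1_iff norm_ge_zero)
      (smt (verit) norm_ge_zero)
qed

lemma abs_sin_le_near_quarter:
  assumes "\<bar>x\<bar> \<le> pi / 4"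
  shows "\<bar>sin x\<bar> \<le> 0.71"
proof -
  have "cos (2 * x) \<ge> 0" using assms by (intro cos_ge_zero) auto
  then have "2 * (sin x)\<^sup>2 \<le> 1" unfolding cos_double_sin by simp
  then have "(sin x)\<^sup>2 \<le> (0.71)\<^sup>2" by (simp add: power2_eq_square)
  then show ?thesis by (simp add: abs_le_square_iff[symmetric])
qed

text \<open>During half a step \<theta> changes by at most 1, so \<open>nu\<close> turns by at most
  pi/4. Its component along the normal therefore stays below 0.72, and the projection keeps a
  squared length of at least 1/4.\<close>

lemma projected_nu_bounds:
  assumes n: "near_normal \<epsilon> m \<theta>" and \<theta>: "\<bar>\<theta>' - \<theta>\<bar> \<le> 1" and \<epsilon>: "\<epsilon> \<le> 1/100"
  shows "1/4 \<le> (normal_proj m *v nu \<theta>') \<bullet> (normal_proj m *v nu \<theta>')" "norm (normal_proj m *v nu \<theta>') \<le> 1"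
proof -
  define D where "D = pi * \<theta>' / 4 - pi * \<theta> / 4"
  have m: "norm m = 1" "\<bar>m \<bullet> nu \<theta>\<bar> \<le> \<epsilon>" using n by (auto simp: near_normal_def)
  have D: "\<bar>D\<bar> \<le> pi / 4"
  proof -
    have "\<bar>D\<bar> = (pi / 4) * \<bar>\<theta>' - \<theta>\<bar>" by (simp add: D_def abs_if field_simps)
    also have "\<dots> \<le> (pi / 4) * 1" by (intro mult_left_mono \<theta>) auto
    finally show ?thesis by simp
  qed
  have D': "pi * \<theta>' / 4 = pi * \<theta> / 4 + D" by (simp add: D_def)
  have "cos (pi * \<theta>' / 4) = cos (pi * \<theta> / 4) * cos D - sin (pi * \<theta> / 4) * sin D"
    "sin (pi * \<theta>' / 4) = sin (pi * \<theta> / 4) * cos D + cos (pi * \<theta> / 4) * sin D"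
    unfolding D' by (rule cos_add, rule sin_add)
  then have "nu \<theta>' = cos D *\<^sub>R nu \<theta> + sin D *\<^sub>R nup \<theta>"
    by (simp add: vec_eq_iff forall_3 mult.commute)
  then have "m \<bullet> nu \<theta>' = cos D * (m \<bullet> nu \<theta>) + sin D * (m \<bullet> nup \<theta>)"
    by (simp add: inner_add_right)
  then have "\<bar>m \<bullet> nu \<theta>'\<bar> \<le> \<bar>cos D\<bar> * \<bar>m \<bullet> nu \<theta>\<bar> + \<bar>sin D\<bar> * \<bar>m \<bullet> nup \<theta>\<bar>"
    by (metis abs_mult abs_triangle_ineq)
  also have "\<dots> \<le> 1 * \<epsilon> + 0.71 * 1"
    using m Cauchy_Schwarz_ineq2[of m "nup \<theta>"]
    by (intro add_mono mult_mono abs_sin_le_near_quarter D) auto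
  finally have b: "\<bar>m \<bullet> nu \<theta>'\<bar> \<le> 0.72" using \<epsilon> by simp
  then have "\<bar>m \<bullet> nu \<theta>'\<bar> * \<bar>m \<bullet> nu \<theta>'\<bar> \<le> 0.72 * 0.72" by (intro mult_mono) auto
  then have sq: "(m \<bullet> nu \<theta>') * (m \<bullet> nu \<theta>') \<le> 3/4" by simp
  have nn: "nu \<theta>' \<bullet> nu \<theta>' = 1" and mm: "m \<bullet> m = 1" using m by (simp_all add: norm_eq_1[symmetric])
  have e: "(normal_proj m *v nu \<theta>') \<bullet> (normal_proj m *v nu \<theta>') = 1 - (m \<bullet> nu \<theta>') * (m \<bullet> nu \<theta>')"
    unfolding normal_proj_vec
    by (simp add: inner_diff_left inner_diff_right nn mm inner_commute)
  show "1/4 \<le> (normal_proj m *v nu \<theta>') \<bullet> (normal_proj m *v nu \<theta>')" unfolding e using sq by simp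
  have "(normal_proj m *v nu \<theta>') \<bullet> (normal_proj m *v nu \<theta>') \<le> 1" unfolding e by simp
  then show "norm (normal_proj m *v nu \<theta>') \<le> 1"
    unfolding norm_eq_sqrt_inner by (simp add: real_sqrt_le_1_iff)
qed

text \<open>Records of a substep what the second-order analysis uses: the rank-one factors rotate at
  the speed of the actual solution \<open>X\<close>, while the remainder, which carries the small
  singular value and the forcing, enters only through its norm.\<close>

definition phase :: "real \<Rightarrow> real \<Rightarrow> real \<Rightarrow> real \<Rightarrow> real \<Rightarrow> real^3^3 \<Rightarrow> real^3^3 \<Rightarrow>
    (real \<Rightarrow> real^3^3) \<Rightarrow> (real \<Rightarrow> real^3) \<Rightarrow> (real \<Rightarrow> real^3) \<Rightarrow> bool" where
  "phase \<eta> e a b \<sigma> P Q X u v \<longleftrightarrow> orth_proj P \<and> orth_proj Q \<and> continuous_on {a..b} X \<and>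
     (\<forall>s\<in>{a..b}.
        (u has_vector_derivative (\<sigma> * q_fam \<eta> (X s)) *\<^sub>R (compressed_Omega P *v u s)) (at s within {a..b}) \<and>
        (v has_vector_derivative (\<sigma> * q_fam \<eta> (X s)) *\<^sub>R (compressed_Omega Q *v v s)) (at s within {a..b}) \<and>
        norm (u s) = 1 \<and> norm (v s) = 1 \<and> norm (X s - outer (u s) (v s)) \<le> e)"

lemma rotation_speed:
  assumes "\<bar>\<sigma>\<bar> = 1" "\<bar>\<eta>\<bar> = 1" "orth_proj P" "norm x = 1"
  shows "norm ((\<sigma> * q_fam \<eta> X) *\<^sub>R (compressed_Omega P *v x)) \<le> 2"
proof -
  have "\<bar>q_fam \<eta> X\<bar> * norm (compressed_Omega P *v x) \<le> 2 * 1"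
    using norm_compressed_Omega_vec_le[OF assms(3), of x] assms(4) q_fam_bounds[OF assms(2), of X]
    by (intro mult_mono) auto
  then show ?thesis using assms(1) by (simp add: abs_mult)
qed

text \<open>Specializes \<open>rotating_rank_one_flow\<close> to the forcing of the family. The
  distance \<open>e'\<close> from rank one is controlled throughout the substep; the final estimate,
  which also resolves the component of size h^3, is recorded at the end time.\<close>

lemma flow_phase:
  fixes X :: "real \<Rightarrow> real^3^3"
  assumes ab: "a \<le> b" and P: "orth_proj P" and Q: "orth_proj Q" and \<sigma>: "\<bar>\<sigma>\<bar> = 1" and \<eta>: "\<bar>\<eta>\<bar> = 1"
    and X: "\<And>s. s \<in> {a..b} \<Longrightarrow> (X has_vector_derivative
       \<sigma> *\<^sub>R (q_fam \<eta> (X s) *\<^sub>R (compressed_Omega P ** X s - X s ** compressed_Omega Q) + P ** R_fam j s ** Q))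
       (at s within {a..b})"
    and u0: "norm u0 = 1" and v0: "norm v0 = 1" and Z0: "norm Z0 \<le> (hj j)^3"
    and e: "norm (X a - outer u0 v0 - Z0) \<le> e" and e': "e + (hj j)^3 * (12 * (b - a)) + 3 * (hj j)^3 \<le> e'"
  obtains u v where "phase \<eta> e' a b \<sigma> P Q X u v" "u a = u0" "v a = v0"
    "norm (u b - u0) \<le> 2 * (b - a)" "norm (v b - v0) \<le> 2 * (b - a)"
    "norm (X b - outer (u b) (v b) - (Z0 + \<sigma> *\<^sub>R (P ** ((hj j)^3 *\<^sub>R (W (vartheta j b) - W (vartheta j a))) ** Q)))
       \<le> e + (hj j)^3 * (12 * (b - a))"
proof -
  define k where "k = (hj j)^3"
  have k: "k > 0" by (simp add: k_def)
  define G where "G = (\<lambda>s. k *\<^sub>R W (vartheta j s))"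
  have Xc: "continuous_on {a..b} X" by (rule continuous_on_vector_derivative[OF X])
  have q: "continuous_on {a..b} (\<lambda>s. q_fam \<eta> (X s))"
    by (rule continuous_on_compose2[OF continuous_on_q_fam Xc subset_UNIV])
  have ql: "\<bar>q_fam \<eta> (X s)\<bar> \<le> 2" for s using q_fam_bounds[OF \<eta>, of "X s"] by simp
  have G: "(G has_vector_derivative R_fam j s) (at s within {a..b})" for s
    unfolding G_def k_def by (rule W_vartheta_deriv)
  have GW: "P ** (G s - G a) ** Q = P ** (k *\<^sub>R (W (vartheta j s) - W (vartheta j a))) ** Q" for s
    by (simp add: G_def scaleR_diff_right)
  \<comment> \<open>The initial part contributes \<open>k\<close>, the difference of two matrices of
    norm \<open>k\<close> another \<open>2 * k\<close>. With \<open>B = 3 * k\<close> the growth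
    rate \<open>4 * B\<close> becomes the \<open>12 * k\<close> of the estimates.\<close>
  have B: "norm (Z0 + \<sigma> *\<^sub>R (P ** (G s - G a) ** Q)) \<le> 3 * k" for s
  proof -
    have "norm (P ** (G s - G a) ** Q) \<le> norm (G s - G a)"
      using norm_orth_proj_right_le[OF Q] norm_orth_proj_left_le[OF P] order_trans by blast
    also have "\<dots> \<le> norm (G s) + norm (G a)" by (rule norm_triangle_ineq4)
    also have "\<dots> = 2 * k" using k by (simp add: G_def)
    finally have "norm (\<sigma> *\<^sub>R (P ** (G s - G a) ** Q)) \<le> 2 * k" using \<sigma> by simp
    then show ?thesis using Z0 norm_triangle_ineq[of Z0 "\<sigma> *\<^sub>R (P ** (G s - G a) ** Q)"]
      unfolding k_def[symmetric] by linarith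
  qed
  obtain u v where uv: "u a = u0" "v a = v0"
    and ud: "\<And>s. s \<in> {a..b} \<Longrightarrow> (u has_vector_derivative (\<sigma> * q_fam \<eta> (X s)) *\<^sub>R (compressed_Omega P *v u s)) (at s within {a..b})"
    and vd: "\<And>s. s \<in> {a..b} \<Longrightarrow> (v has_vector_derivative (\<sigma> * q_fam \<eta> (X s)) *\<^sub>R (compressed_Omega Q *v v s)) (at s within {a..b})"
    and est: "\<And>s. s \<in> {a..b} \<Longrightarrow> norm (X s - outer (u s) (v s) - (Z0 + \<sigma> *\<^sub>R (P ** (G s - G a) ** Q)))
       \<le> norm (X a - outer u0 v0 - Z0) + 4 * (3 * k) * (s - a)"
    using rotating_rank_one_flow[OF ab P Q \<sigma> q ql X G B, where ?u0.0=u0 and ?v0.0=v0] by metis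
  have un: "norm (u s) = 1" if "s \<in> {a..b}" for s
    using compressed_Omega_norm_preserved[OF P that ud] u0 uv by simp
  have vn: "norm (v s) = 1" if "s \<in> {a..b}" for s
    using compressed_Omega_norm_preserved[OF Q that vd] v0 uv by simp
  have bb: "b \<in> {a..b}" using ab by simp
  show ?thesis
  proof (rule that[of u v])
    show "u a = u0" "v a = v0" by (fact uv)+
    show "norm (u b - u0) \<le> 2 * (b - a)"
      using norm_diff_le_deriv_bound[OF bb ud rotation_speed[OF \<sigma> \<eta> P un]] uv by simp
    show "norm (v b - v0) \<le> 2 * (b - a)"
      using norm_diff_le_deriv_bound[OF bb vd rotation_speed[OF \<sigma> \<eta> Q vn]] uv by simp
    show "norm (X b - outer (u b) (v b) - (Z0 + \<sigma> *\<^sub>R (P ** ((hj j)^3 *\<^sub>R (W (vartheta j b) - W (vartheta j a))) ** Q)))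
       \<le> e + (hj j)^3 * (12 * (b - a))"
      using est[OF bb] e unfolding GW k_def[symmetric] by (simp add: algebra_simps)
    have close: "norm (X s - outer (u s) (v s)) \<le> e'" if s: "s \<in> {a..b}" for s
    proof -
      have "norm (X s - outer (u s) (v s)) \<le> (norm (X a - outer u0 v0 - Z0) + 4 * (3 * k) * (s - a)) + 3 * k"
        using est[OF s] B[of s] norm_triangle_sub[of "X s - outer (u s) (v s)" "Z0 + \<sigma> *\<^sub>R (P ** (G s - G a) ** Q)"]
        by linarith
      also have "\<dots> \<le> e + k * (12 * (b - a)) + 3 * k"
      proof -
        have "12 * k * (s - a) \<le> 12 * k * (b - a)" using s k by (intro mult_left_mono) auto
        then show ?thesis using e by (simp add: algebra_simps)
      qed
      finally show ?thesis using e' unfolding k_def by simp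
    qed
    show "phase \<eta> e' a b \<sigma> P Q X u v"
      unfolding phase_def using P Q Xc ud vd un vn close by blast
  qed
qed

lemma phase_drift:
  assumes ph: "phase \<eta> e0 a b \<sigma> P Q X u v" and s: "a \<le> s" "s \<le> s'" "s' \<le> b"
    and \<sigma>: "\<bar>\<sigma>\<bar> = 1" and \<eta>: "\<bar>\<eta>\<bar> = 1"
  shows "norm (u s' - u s) \<le> 2 * (s' - s)" "norm (v s' - v s) \<le> 2 * (s' - s)"
proof -
  have P: "orth_proj P" "orth_proj Q" using ph by (auto simp: phase_def)
  have n: "norm (u r) = 1" "norm (v r) = 1" if "r \<in> {s..s'}" for r
    using ph that s by (auto simp: phase_def)
  have d: "(u has_vector_derivative (\<sigma> * q_fam \<eta> (X r)) *\<^sub>R (compressed_Omega P *v u r)) (at r within {s..s'})"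
    "(v has_vector_derivative (\<sigma> * q_fam \<eta> (X r)) *\<^sub>R (compressed_Omega Q *v v r)) (at r within {s..s'})"
    if "r \<in> {s..s'}" for r
    by (rule has_vector_derivative_subinterval[where a=a and b=b]; use ph that s in \<open>auto simp: phase_def\<close>)+
  have s': "s' \<in> {s..s'}" using s by simp
  show "norm (u s' - u s) \<le> 2 * (s' - s)"
    by (rule norm_diff_le_deriv_bound[OF s' d(1) rotation_speed[OF \<sigma> \<eta> P(1) n(1)]])
  show "norm (v s' - v s) \<le> 2 * (s' - s)"
    by (rule norm_diff_le_deriv_bound[OF s' d(2) rotation_speed[OF \<sigma> \<eta> P(2) n(2)]])
qed

lemma vartheta_lipschitz:
  assumes "s \<le> s'"
  shows "\<bar>vartheta j s' - vartheta j s\<bar> \<le> 2 / hj j * (s' - s)"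
proof -
  have "(vartheta j has_vector_derivative vartheta_d 1 j r) (at r within {s..s'})" for r
    using vartheta_deriv has_field_derivative_at_within has_real_derivative_iff_has_vector_derivative by blast
  then have "norm (vartheta j s' - vartheta j s) \<le> 2 / hj j * (s' - s)"
    by (intro norm_diff_le_deriv_bound[where b=s' and d="vartheta_d 1 j"]) (use vartheta_d1_le[of j] assms in auto)
  then show ?thesis by simp
qed


section \<open>Structure of one Strang step\<close>

text \<open>The substeps K1, S1, L, S2, K2 chained end to start; \<open>n0\<close>,
  \<open>m\<close>, \<open>n1\<close> are the normals of the planes spanned by \<open>V0\<close>,
  \<open>U1\<close>, \<open>V1\<close>. The factors are continuous along the chain although the
  running time jumps back between substeps.\<close>

definition step_phases :: "real \<Rightarrow> nat \<Rightarrow> real \<Rightarrow> real \<Rightarrow> real^3 \<Rightarrow> real^3 \<Rightarrow> real^3 \<Rightarrow> real^3 \<Rightarrow> bool" where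
  "step_phases \<eta> j t \<epsilon> u0 v0 u' v' \<longleftrightarrow> (\<exists>n0 m n1 X1 X2 X3 X4 X5 u1 u2 u3 u4 u5 v1 v2 v3 v4 v5.
     near_normal \<epsilon> n0 (vartheta j t) \<and> near_normal \<epsilon> m (vartheta j (t + hj j / 2)) \<and>
     near_normal \<epsilon> n1 (vartheta j (t + hj j)) \<and>
     phase \<eta> (5 * (hj j)^3) t (t + hj j / 2) 1 (mat 1) (normal_proj n0) X1 u1 v1 \<and>
     phase \<eta> (5 * (hj j)^3) t (t + hj j / 2) (-1) (normal_proj m) (normal_proj n0) X2 u2 v2 \<and>
     phase \<eta> (5 * (hj j)^3) t (t + hj j) 1 (normal_proj m) (mat 1) X3 u3 v3 \<and>
     phase \<eta> (5 * (hj j)^3) (t + hj j / 2) (t + hj j) (-1) (normal_proj m) (normal_proj n1) X4 u4 v4 \<and>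
     phase \<eta> (5 * (hj j)^3) (t + hj j / 2) (t + hj j) 1 (mat 1) (normal_proj n1) X5 u5 v5 \<and>
     u1 t = u0 \<and> v1 t = v0 \<and> u2 t = u1 (t + hj j / 2) \<and> v2 t = v1 (t + hj j / 2) \<and>
     u3 t = u2 (t + hj j / 2) \<and> v3 t = v2 (t + hj j / 2) \<and>
     u4 (t + hj j / 2) = u3 (t + hj j) \<and> v4 (t + hj j / 2) = v3 (t + hj j) \<and>
     u5 (t + hj j / 2) = u4 (t + hj j) \<and> v5 (t + hj j / 2) = v4 (t + hj j) \<and>
     u' = u5 (t + hj j) \<and> v' = v5 (t + hj j))"

lemma abs_nth_le_near_e1:
  fixes u x :: "real^3"
  assumes "norm (u - e1) \<le> d" "norm x \<le> 1"
  shows "\<bar>u \<bullet> x\<bar> \<le> d + \<bar>x $ 1\<bar>" "\<bar>x $ 1\<bar> \<le> d + \<bar>u \<bullet> x\<bar>"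
proof -
  have "u \<bullet> x = (u - e1) \<bullet> x + x $ 1" by (simp add: inner_diff_left)
  moreover have "\<bar>(u - e1) \<bullet> x\<bar> \<le> d * 1"
  proof (rule order_trans[OF Cauchy_Schwarz_ineq2 mult_mono])
    show "0 \<le> d" by (rule order_trans[OF norm_ge_zero assms(1)])
  qed (use assms in auto)
  ultimately show "\<bar>u \<bullet> x\<bar> \<le> d + \<bar>x $ 1\<bar>" "\<bar>x $ 1\<bar> \<le> d + \<bar>u \<bullet> x\<bar>" by linarith+
qed

text \<open>One link in the chain of a step. The small component is expected to pass from
  \<open>outer \<mu> \<kappa>\<close> to \<open>outer \<mu>' \<kappa>'\<close>, and \<open>f\<close>
  measures by how much the projected forcing misses this target. The 5 in the phase is 2, from the
  relative error, plus 3, from the forcing.\<close>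

lemma flow_stage:
  fixes X :: "real \<Rightarrow> real^3^3"
  assumes ab: "a \<le> b" and PQ: "orth_proj P" "orth_proj Q" and \<sigma>: "\<bar>\<sigma>\<bar> = 1" and \<eta>: "\<bar>\<eta>\<bar> = 1"
    and X: "\<And>s. s \<in> {a..b} \<Longrightarrow> (X has_vector_derivative
       \<sigma> *\<^sub>R (q_fam \<eta> (X s) *\<^sub>R (compressed_Omega P ** X s - X s ** compressed_Omega Q) + P ** R_fam j s ** Q))
       (at s within {a..b})"
    and u0: "norm u0 = 1" "norm (u0 - e1) \<le> c" and v0: "norm v0 = 1" "norm (v0 - e1) \<le> c"
    and f0: "norm (X a - outer u0 v0 - (hj j)^3 *\<^sub>R outer \<mu> \<kappa>) \<le> d * (hj j)^3"
    and \<mu>\<kappa>: "norm \<mu> \<le> 1" "norm \<kappa> \<le> 1"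
    and f: "norm (outer \<mu> \<kappa> + \<sigma> *\<^sub>R (P ** (W (vartheta j b) - W (vartheta j a)) ** Q) - outer \<mu>' \<kappa>') \<le> f"
    and d: "d + 12 * (b - a) \<le> 2" "d + 12 * (b - a) + f \<le> d'" and c: "c + 2 * (b - a) \<le> c'"
  obtains u v where "phase \<eta> (5 * (hj j)^3) a b \<sigma> P Q X u v" "u a = u0" "v a = v0"
    "norm (u b) = 1" "norm (v b) = 1" "norm (u b - e1) \<le> c'" "norm (v b - e1) \<le> c'"
    "norm (X b - outer (u b) (v b) - (hj j)^3 *\<^sub>R outer \<mu>' \<kappa>') \<le> d' * (hj j)^3"
proof -
  define k where "k = (hj j)^3"
  have k: "0 < k" by (simp add: k_def)
  have kle: "x * k \<le> y * k" if "x \<le> y" for x y using that k by simp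
  have Z0: "norm (k *\<^sub>R outer \<mu> \<kappa>) \<le> k"
    using mult_mono[OF \<mu>\<kappa>] k by (simp add: norm_outer mult_left_le)
  have e': "d * k + k * (12 * (b - a)) + 3 * k \<le> 5 * k"
    using kle[OF d(1)] by (simp add: algebra_simps)
  show ?thesis
  proof (rule flow_phase[OF ab PQ \<sigma> \<eta> X u0(1) v0(1) Z0[unfolded k_def] f0 e'[unfolded k_def]])
    fix u v
    assume ph: "phase \<eta> (5 * (hj j)^3) a b \<sigma> P Q X u v" and st: "u a = u0" "v a = v0"
      and dr: "norm (u b - u0) \<le> 2 * (b - a)" "norm (v b - v0) \<le> 2 * (b - a)"
      and fin: "norm (X b - outer (u b) (v b) - ((hj j)^3 *\<^sub>R outer \<mu> \<kappa>
          + \<sigma> *\<^sub>R (P ** ((hj j)^3 *\<^sub>R (W (vartheta j b) - W (vartheta j a))) ** Q)))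
        \<le> d * (hj j)^3 + (hj j)^3 * (12 * (b - a))"
    have n: "norm (u b) = 1" "norm (v b) = 1" using ph ab by (auto simp: phase_def)
    have e: "norm (u b - e1) \<le> c'" "norm (v b - e1) \<le> c'"
      using norm_triangle_ineq[of "u b - u0" "u0 - e1"] norm_triangle_ineq[of "v b - v0" "v0 - e1"] dr u0(2) v0(2) c
      by simp_all
    define D where "D = outer \<mu> \<kappa> + \<sigma> *\<^sub>R (P ** (W (vartheta j b) - W (vartheta j a)) ** Q) - outer \<mu>' \<kappa>'"
    have "norm (X b - outer (u b) (v b) - k *\<^sub>R outer \<mu>' \<kappa>')
      = norm ((X b - outer (u b) (v b) - (k *\<^sub>R outer \<mu> \<kappa>
          + \<sigma> *\<^sub>R (P ** (k *\<^sub>R (W (vartheta j b) - W (vartheta j a))) ** Q))) + k *\<^sub>R D)"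
      by (simp add: D_def mm_simps algebra_simps)
    also have "\<dots> \<le> (d * k + k * (12 * (b - a))) + k * f"
      using fin f k unfolding k_def[symmetric] D_def[symmetric]
      by (intro norm_triangle_le add_mono) (auto simp: mult_left_mono)
    also have "\<dots> \<le> d' * k" using kle[OF d(2)] by (simp add: algebra_simps)
    finally show thesis using that ph st n e unfolding k_def by blast
  qed
qed

text \<open>If the normals were exact, the small component divided by h^3 would pass through
  \<open>outer \<nu>0 \<nu>0\<close>, \<open>outer \<nu>h \<kappa>1\<close>,
  \<open>outer \<mu>0 \<nu>0\<close>, \<open>outer \<mu>1 \<nu>1\<close>,
  \<open>outer \<nu>h \<kappa>h\<close>, \<open>outer \<nu>1 \<nu>1\<close>, as in the exactness
  property of projector splitting. The deviations contain the inner products of the normals with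
  \<open>\<nu>0\<close>, \<open>\<nu>h\<close>, \<open>\<nu>1\<close>, and each normal is estimated
  from the matrix that defined its plane. Every such estimate multiplies the relative error by 8:
  hence 8, 128 = 8 * 16 and 1376 = 8 * 172. The factor 10000 covers all of them.\<close>

lemma strang_step_structure:
  fixes d :: "(3, 3, 2) strang_trace"
  assumes tr: "is_strang_trace (F_fam j \<eta>) t (hj j) Y d" and \<eta>: "\<bar>\<eta>\<bar> = 1"
    and u0: "norm u0 = 1" "norm (u0 - e1) \<le> \<delta>" and v0: "norm v0 = 1" "norm (v0 - e1) \<le> \<delta>"
    and Y: "norm (Y - outer u0 v0 - (hj j)^3 *\<^sub>R W (vartheta j t)) \<le> \<delta> * (hj j)^3"
    and h: "hj j \<le> \<delta>" and \<delta>: "\<delta> \<le> 1 / 10^8"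
  shows "rank_admissible_trace t (hj j) d \<and>
    (\<exists>u' v'. step_phases \<eta> j t (10000 * \<delta>) u0 v0 u' v' \<and> norm u' = 1 \<and> norm v' = 1 \<and>
       norm (u' - e1) \<le> 10000 * \<delta> \<and> norm (v' - e1) \<le> 10000 * \<delta> \<and>
       norm (strang_result d - outer u' v' - (hj j)^3 *\<^sub>R W (vartheta j (t + hj j))) \<le> 10000 * \<delta> * (hj j)^3)"
proof -
  define H where "H = hj j"
  define k where "k = H^3"
  define hh where "hh = H / 2"
  define U0 where "U0 = tr_U0 d"
  define S0 where "S0 = tr_S0 d"
  define V0 where "V0 = tr_V0 d"
  define U1 where "U1 = tr_U1 d"
  define V1 where "V1 = tr_V1 d"
  define K1 where "K1 = tr_K1 d"
  define Sh1 where "Sh1 = tr_Sh1 d"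
  define S1 where "S1 = tr_S1 d"
  define L where "L = tr_L d"
  define Sh2 where "Sh2 = tr_Sh2 d"
  define S2 where "S2 = tr_S2 d"
  define K2 where "K2 = tr_K2 d"
  define U2 where "U2 = tr_U2 d"
  define Sp where "Sp = tr_Sp d"
  note defs = U0_def S0_def V0_def U1_def V1_def K1_def Sh1_def S1_def L_def Sh2_def S2_def K2_def U2_def Sp_def
  have H: "0 < H" "H \<le> \<delta>" "H \<le> 1" using h \<delta> by (auto simp: H_def)
  have k: "0 < k" "k \<le> 1" using H by (auto simp: k_def power_le_one)
  have hh: "0 < hh" "hh + hh = H" "t + H / 2 = t + hh" using H by (auto simp: hh_def)
  have \<delta>0: "0 \<le> \<delta>" using H by linarith
  have Y0: "low_rank_factors Y U0 S0 V0"
    and K1: "ode_solution (K_field (F_fam j \<eta>) V0) t (t + hh) (U0 ** S0) K1"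
    and Q1: "qr_factors (K1 (t + hh)) U1 Sh1"
    and S1: "ode_solution (S_field (F_fam j \<eta>) U1 V0) t (t + hh) Sh1 S1"
    and L: "ode_solution (L_field (F_fam j \<eta>) U1) t (t + H) (V0 ** transpose (S1 (t + hh))) L"
    and QL: "qr_factors (L (t + H)) V1 (transpose Sh2)"
    and S2: "ode_solution (S_field (F_fam j \<eta>) U1 V1) (t + hh) (t + H) Sh2 S2"
    and K2: "ode_solution (K_field (F_fam j \<eta>) V1) (t + hh) (t + H) (U1 ** S2 (t + H)) K2"
    and Q2: "qr_factors (K2 (t + H)) U2 Sp"
    using tr unfolding is_strang_trace_def defs H_def hh_def by auto
  have oV0: "orthonormal_cols V0" and Yeq: "Y = U0 ** S0 ** transpose V0"
    using Y0 by (auto simp: low_rank_factors_def)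
  have oU1: "orthonormal_cols U1" and K1e: "K1 (t + hh) = U1 ** Sh1" using Q1 by (auto simp: qr_factors_def)
  have oV1: "orthonormal_cols V1" and Le: "L (t + H) = V1 ** transpose Sh2" using QL by (auto simp: qr_factors_def)
  have oU2: "orthonormal_cols U2" and K2e: "K2 (t + H) = U2 ** Sp" using Q2 by (auto simp: qr_factors_def)
  obtain n0 where n0: "norm n0 = 1" "n0 v* V0 = 0" "V0 ** transpose V0 = normal_proj n0"
    using orthonormal_cols_2_3_normal[OF oV0] unfolding normal_proj_def by blast
  obtain m where m: "norm m = 1" "m v* U1 = 0" "U1 ** transpose U1 = normal_proj m"
    using orthonormal_cols_2_3_normal[OF oU1] unfolding normal_proj_def by blast
  obtain n1 where n1: "norm n1 = 1" "n1 v* V1 = 0" "V1 ** transpose V1 = normal_proj n1"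
    using orthonormal_cols_2_3_normal[OF oV1] unfolding normal_proj_def by blast
  have pn0: "orth_proj (normal_proj n0)" using orth_proj_orthonormal_cols[OF oV0] n0 by simp
  have pm: "orth_proj (normal_proj m)" using orth_proj_orthonormal_cols[OF oU1] m by simp
  have pn1: "orth_proj (normal_proj n1)" using orth_proj_orthonormal_cols[OF oV1] n1 by simp
  define \<nu>0 where "\<nu>0 = nu (vartheta j t)"
  define \<nu>h where "\<nu>h = nu (vartheta j (t + hh))"
  define \<nu>1 where "\<nu>1 = nu (vartheta j (t + H))"
  have W: "W (vartheta j t) = outer \<nu>0 \<nu>0" "W (vartheta j (t + hh)) = outer \<nu>h \<nu>h" "W (vartheta j (t + H)) = outer \<nu>1 \<nu>1"
    by (simp_all add: W_outer \<nu>0_def \<nu>h_def \<nu>1_def)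
  have nn: "norm \<nu>0 = 1" "norm \<nu>h = 1" "norm \<nu>1 = 1" "\<nu>0 $ 1 = 0" "\<nu>h $ 1 = 0" "\<nu>1 $ 1 = 0"
    by (simp_all add: \<nu>0_def \<nu>h_def \<nu>1_def)
  have nl: "norm \<nu>0 \<le> 1" "norm \<nu>h \<le> 1" "norm \<nu>1 \<le> 1" using nn by simp_all
  have \<delta>s: "\<delta> \<le> 1/2" "0 \<le> 16 * \<delta>" "16 * \<delta> \<le> 1/2" "0 \<le> 172 * \<delta>" "172 * \<delta> \<le> 1/2"
    "16 * \<delta> \<le> 1/1000" "0 \<le> 160 * \<delta>" "160 * \<delta> \<le> 1/1000" "172 * \<delta> \<le> 1/1000"
    "0 \<le> 1700 * \<delta>" "1700 * \<delta> \<le> 1/1000" "0 \<le> 4000 * \<delta>" "4000 * \<delta> \<le> 1/1000"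
    using \<delta> \<delta>0 by simp_all
  have nn4: "1/4 \<le> \<nu>0 \<bullet> \<nu>0" "1/4 \<le> \<nu>h \<bullet> \<nu>h" "1/4 \<le> \<nu>1 \<bullet> \<nu>1"
    using nn by (simp_all add: norm_eq_1)
  have ang: "\<bar>vartheta j (t + hh) - vartheta j t\<bar> \<le> 1" "\<bar>vartheta j t - vartheta j (t + hh)\<bar> \<le> 1"
    "\<bar>vartheta j (t + H) - vartheta j (t + hh)\<bar> \<le> 1" "\<bar>vartheta j (t + hh) - vartheta j (t + H)\<bar> \<le> 1"
  proof -
    have "2 / hj j * hh = 1" using H by (simp add: hh_def H_def)
    then show "\<bar>vartheta j (t + hh) - vartheta j t\<bar> \<le> 1" "\<bar>vartheta j (t + H) - vartheta j (t + hh)\<bar> \<le> 1"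
      using vartheta_lipschitz[of t "t + hh" j] vartheta_lipschitz[of "t + hh" "t + H" j] hh by (auto simp: field_simps)
    then show "\<bar>vartheta j t - vartheta j (t + hh)\<bar> \<le> 1" "\<bar>vartheta j (t + hh) - vartheta j (t + H)\<bar> \<le> 1"
      by linarith+
  qed
  have pv: "\<nu> v* normal_proj n = normal_proj n *v \<nu>" if "orth_proj (normal_proj n)" for n \<nu>
    by (rule orth_proj_vec_mult[OF that])
  have pd: "normal_proj n *v \<nu> = \<nu> - (n \<bullet> \<nu>) *\<^sub>R n" for n \<nu> by (rule normal_proj_vec)
  have p1: "\<bar>(normal_proj n *v \<nu>) $ 1\<bar> \<le> \<bar>n $ 1\<bar>" if "norm n = 1" "norm \<nu> = 1" "\<nu> $ 1 = 0" for n \<nu> :: "real^3"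
  proof -
    have "\<bar>n \<bullet> \<nu>\<bar> * \<bar>n $ 1\<bar> \<le> 1 * \<bar>n $ 1\<bar>"
      using Cauchy_Schwarz_ineq2[of n \<nu>] that by (intro mult_right_mono) auto
    then show ?thesis using that by (simp add: pd abs_mult)
  qed
  have dk: "\<delta>' * k \<le> \<delta>'" if "0 \<le> \<delta>'" for \<delta>' using that k by (simp add: mult_left_le)
  have two: "norm (x *\<^sub>R outer a b - y *\<^sub>R outer c d) \<le> x' + y'"
    if "\<bar>x\<bar> \<le> x'" "norm a \<le> 1" "norm b \<le> 1" "\<bar>y\<bar> \<le> y'" "norm c \<le> 1" "norm d \<le> 1"
    for x x' y y' and a b c d :: "real^3"
  proof (rule order_trans[OF norm_triangle_ineq4 add_mono])
    have le: "norm (x *\<^sub>R outer a b) \<le> x'" if "\<bar>x\<bar> \<le> x'" "norm a \<le> 1" "norm b \<le> 1" for x x' and a b :: "real^3"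
    proof -
      have "norm a * norm b \<le> 1 * 1" using that by (intro mult_mono) auto
      then have "\<bar>x\<bar> * (norm a * norm b) \<le> x' * 1" using that by (intro mult_mono) auto
      then show ?thesis by (simp add: norm_outer)
    qed
    show "norm (x *\<^sub>R outer a b) \<le> x'" "norm (y *\<^sub>R outer c d) \<le> y'" using le that by auto
  qed
  have one: "\<bar>1 :: real\<bar> = 1" "\<bar>- 1 :: real\<bar> = 1" by simp_all
  have tle: "t \<le> t + hh" "t \<le> t + H" "t + hh \<le> t + H" using hh H by auto
  have X0f: "norm (Y - outer u0 v0 - k *\<^sub>R outer \<nu>0 \<nu>0) \<le> \<delta> * k"
    using Y W by (simp add: k_def H_def)
  have Yn0: "Y *v n0 = 0"
    unfolding Yeq using n0(2) by (simp add: matrix_vector_mul_assoc[symmetric])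
  have u\<nu>0: "\<bar>u0 \<bullet> \<nu>0\<bar> \<le> \<delta>" using abs_nth_le_near_e1(1)[OF u0(2), of \<nu>0] nn by simp
  note e0 = right_null_estimate[OF X0f k(1) n0(1) Yn0 u0(1) u\<nu>0 nn4(1) nl(1) nl(1) \<delta>0 \<delta>s(1)]
  have n0v: "\<bar>n0 \<bullet> v0\<bar> \<le> 2 * \<delta>" and n0\<nu>: "\<bar>n0 \<bullet> \<nu>0\<bar> \<le> 8 * \<delta>"
    using e0 dk[of "2 * \<delta>"] \<delta>0 by simp_all
  have n01: "\<bar>n0 $ 1\<bar> \<le> 3 * \<delta>"
    using abs_nth_le_near_e1(2)[OF v0(2), of n0] n0v n0(1) by (simp add: inner_commute)
  have near0: "near_normal (8 * \<delta>) n0 (vartheta j t)"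
    using n0 n01 n0\<nu> \<delta>0 by (simp add: near_normal_def \<nu>0_def)
  define X1 where "X1 = (\<lambda>s. K1 s ** transpose V0)"
  have X1t: "X1 t = Y" using K1 by (simp add: X1_def ode_solution_def Yeq)
  have X1d: "(X1 has_vector_derivative 1 *\<^sub>R (q_fam \<eta> (X1 s) *\<^sub>R (compressed_Omega (mat 1) ** X1 s
      - X1 s ** compressed_Omega (normal_proj n0)) + mat 1 ** R_fam j s ** normal_proj n0)) (at s within {t..t+hh})"
    if "s \<in> {t..t+hh}" for s
    using K_flow_lifted[OF K1 oV0 that] unfolding X1_def n0(3) .
  define \<kappa>1 where "\<kappa>1 = normal_proj n0 *v \<nu>h"
  \<comment> \<open>K1 moves the left direction to \<open>\<nu>h\<close> and projects the right one.
    The only miss is the component of \<open>\<nu>0\<close> along \<open>n0\<close>.\<close>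
  have tgt1: "norm (outer \<nu>0 \<nu>0 + (1) *\<^sub>R (mat 1 ** (W (vartheta j (t + hh)) - W (vartheta j (t))) ** normal_proj n0)
      - outer \<nu>h \<kappa>1) \<le> 8 * \<delta>" (is "norm ?D \<le> _")
  proof -
    have "?D = (n0 \<bullet> \<nu>0) *\<^sub>R outer \<nu>0 n0"
      unfolding W \<kappa>1_def by (simp add: mm_simps outer_mm pv[OF pn0] pd outer_simps)
    then show ?thesis using n0\<nu> by (simp add: norm_outer nn n0)
  qed
  \<comment> \<open>As \<open>H \<le> \<delta>\<close>, the growth over half a step is at most
    \<open>6 * \<delta>\<close>, and 1 + 6 + 8 fits into 16. The later constants 160, 172, 1700 and
    4000 arise in the same way.\<close>
  have ar1: "\<delta> + 12 * (t + hh - t) \<le> 2" "\<delta> + 12 * (t + hh - t) + 8 * \<delta> \<le> 16 * \<delta>" "\<delta> + 2 * (t + hh - t) \<le> 2 * \<delta>"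
    using H hh \<delta> \<delta>0 by simp_all
  obtain u1 v1 where ph1: "phase \<eta> (5 * (hj j)^3) (t) (t + hh) (1) (mat 1) (normal_proj n0) X1 u1 v1"
    and st1: "u1 (t) = u0" "v1 (t) = v0"
    and fin1: "norm (u1 (t + hh)) = 1" "norm (v1 (t + hh)) = 1" "norm (u1 (t + hh) - e1) \<le> 2 * \<delta>" "norm (v1 (t + hh) - e1) \<le> 2 * \<delta>"
      "norm (X1 (t + hh) - outer (u1 (t + hh)) (v1 (t + hh)) - (hj j)^3 *\<^sub>R outer \<nu>h \<kappa>1) \<le> (16 * \<delta>) * (hj j)^3"
    by (rule flow_stage[OF tle(1) orth_proj_mat_1 pn0 one(1) \<eta> X1d u0(1) u0(2) v0(1) v0(2) X0f[folded X1t, unfolded k_def H_def] nl(1) nl(1) tgt1 ar1])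
  define a1 where "a1 = u1 (t + hh)"
  define b1 where "b1 = v1 (t + hh)"
  note nab1 = fin1(1,2)[folded a1_def b1_def]
  note ab1 = fin1(3,4)[folded a1_def b1_def]
  note f1 = fin1(5)[folded a1_def b1_def H_def, folded k_def]
  have X1e: "X1 (t + hh) = U1 ** Sh1 ** transpose V0" by (simp add: X1_def K1e)
  have \<kappa>1: "1/4 \<le> \<kappa>1 \<bullet> \<kappa>1" "norm \<kappa>1 \<le> 1"
    unfolding \<kappa>1_def \<nu>h_def using projected_nu_bounds[OF near0 ang(1)] \<delta> by auto
  have b\<kappa>1: "\<bar>b1 \<bullet> \<kappa>1\<bar> \<le> 16 * \<delta>"
    using abs_nth_le_near_e1(1)[OF ab1(2) \<kappa>1(2)] p1[of n0 \<nu>h] n0 nn n01 \<delta>0 unfolding \<kappa>1_def by linarith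
  have a\<nu>h: "\<bar>a1 \<bullet> \<nu>h\<bar> \<le> 16 * \<delta>"
    using abs_nth_le_near_e1(1)[OF ab1(1), of \<nu>h] nn \<delta>0 by linarith
  have inv1: "invertible Sh1"
    by (rule core_invertible[OF f1[unfolded X1e] k oU1 nab1 b\<kappa>1 a\<nu>h \<kappa>1 nn4(2) nl(2) \<delta>s(2,6)])
  have mX1: "m v* X1 (t + hh) = 0"
    unfolding X1e using m(2) by (simp add: vector_matrix_mul_assoc[symmetric])
  note e1 = left_null_estimate[OF f1 k(1) m(1) mX1 nab1(2) b\<kappa>1 \<kappa>1 nl(2) \<delta>s(2,3)]
  have ma: "\<bar>m \<bullet> a1\<bar> \<le> 32 * \<delta>" and m\<nu>: "\<bar>m \<bullet> \<nu>h\<bar> \<le> 128 * \<delta>"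
    using e1 dk[of "32 * \<delta>"] \<delta>0 by simp_all
  have m1: "\<bar>m $ 1\<bar> \<le> 34 * \<delta>"
    using abs_nth_le_near_e1(2)[OF ab1(1), of m] ma m(1) by (simp add: inner_commute)
  have nearm: "near_normal (128 * \<delta>) m (vartheta j (t + hh))"
    using m m1 m\<nu> \<delta>0 by (simp add: near_normal_def \<nu>h_def)
  define \<mu>0 where "\<mu>0 = normal_proj m *v \<nu>0"
  define \<mu>1 where "\<mu>1 = normal_proj m *v \<nu>1"
  have \<mu>0: "1/4 \<le> \<mu>0 \<bullet> \<mu>0" "norm \<mu>0 \<le> 1" and \<mu>1: "1/4 \<le> \<mu>1 \<bullet> \<mu>1" "norm \<mu>1 \<le> 1"
    unfolding \<mu>0_def \<mu>1_def \<nu>0_def \<nu>1_def using projected_nu_bounds[OF nearm ang(2)] projected_nu_bounds[OF nearm ang(3)] \<delta>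
    by auto
  define X2 where "X2 = (\<lambda>s. U1 ** S1 s ** transpose V0)"
  have X2t: "X2 t = X1 (t + hh)" using S1 by (simp add: X2_def ode_solution_def X1e)
  have X2d: "(X2 has_vector_derivative (- 1) *\<^sub>R (q_fam \<eta> (X2 s) *\<^sub>R (compressed_Omega (normal_proj m) ** X2 s
      - X2 s ** compressed_Omega (normal_proj n0)) + normal_proj m ** R_fam j s ** normal_proj n0)) (at s within {t..t+hh})"
    if "s \<in> {t..t+hh}" for s
    using S_flow_lifted[OF S1 oU1 oV0 that] unfolding X2_def n0(3) m(3) .
  \<comment> \<open>S1 runs with the opposite sign: it takes back the forcing of K1 and returns to
    the initial angle, now seen through the new left plane. Both normals contribute to the
    miss.\<close>
  have tgt2: "norm (outer \<nu>h \<kappa>1 + (- 1) *\<^sub>R (normal_proj m ** (W (vartheta j (t + hh)) - W (vartheta j (t))) ** normal_proj n0)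
      - outer \<mu>0 \<nu>0) \<le> 136 * \<delta>" (is "norm ?D \<le> _")
  proof -
    have "?D = (m \<bullet> \<nu>h) *\<^sub>R outer m \<kappa>1 - (n0 \<bullet> \<nu>0) *\<^sub>R outer \<mu>0 n0"
      unfolding W \<kappa>1_def \<mu>0_def
      by (simp add: mm_simps mm_outer outer_mm pv[OF pn0] pd outer_simps algebra_simps)
    then show ?thesis
      using two[of "m \<bullet> \<nu>h" "128 * \<delta>" m \<kappa>1 "n0 \<bullet> \<nu>0" "8 * \<delta>" \<mu>0 n0] m\<nu> n0\<nu> m(1) n0(1) \<kappa>1(2) \<mu>0(2) by simp
  qed
  have ar2: "16 * \<delta> + 12 * (t + hh - t) \<le> 2" "16 * \<delta> + 12 * (t + hh - t) + 136 * \<delta> \<le> 160 * \<delta>" "2 * \<delta> + 2 * (t + hh - t) \<le> 3 * \<delta>"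
    using H hh \<delta> \<delta>0 by simp_all
  obtain u2 v2 where ph2: "phase \<eta> (5 * (hj j)^3) (t) (t + hh) (- 1) (normal_proj m) (normal_proj n0) X2 u2 v2"
    and st2: "u2 (t) = a1" "v2 (t) = b1"
    and fin2: "norm (u2 (t + hh)) = 1" "norm (v2 (t + hh)) = 1" "norm (u2 (t + hh) - e1) \<le> 3 * \<delta>" "norm (v2 (t + hh) - e1) \<le> 3 * \<delta>"
      "norm (X2 (t + hh) - outer (u2 (t + hh)) (v2 (t + hh)) - (hj j)^3 *\<^sub>R outer \<mu>0 \<nu>0) \<le> (160 * \<delta>) * (hj j)^3"
    by (rule flow_stage[OF tle(1) pm pn0 one(2) \<eta> X2d nab1(1) ab1(1) nab1(2) ab1(2) f1[folded X2t, unfolded k_def H_def] nl(2) \<kappa>1(2) tgt2 ar2])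
  define a2 where "a2 = u2 (t + hh)"
  define b2 where "b2 = v2 (t + hh)"
  note nab2 = fin2(1,2)[folded a2_def b2_def]
  note ab2 = fin2(3,4)[folded a2_def b2_def]
  note f2 = fin2(5)[folded a2_def b2_def H_def, folded k_def]
  have X2e: "X2 (t + hh) = U1 ** S1 (t + hh) ** transpose V0" by (simp add: X2_def)
  have a\<mu>0: "\<bar>a2 \<bullet> \<mu>0\<bar> \<le> 160 * \<delta>"
    using abs_nth_le_near_e1(1)[OF ab2(1) \<mu>0(2)] p1[of m \<nu>0] m nn m1 \<delta>0 unfolding \<mu>0_def by linarith
  have b\<nu>0: "\<bar>b2 \<bullet> \<nu>0\<bar> \<le> 160 * \<delta>"
    using abs_nth_le_near_e1(1)[OF ab2(2), of \<nu>0] nn \<delta>0 by linarith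
  have inv2: "invertible (S1 (t + hh))"
    by (rule core_invertible[OF f2[unfolded X2e] k oU1 nab2 b\<nu>0 a\<mu>0 nn4(1) nl(1) \<mu>0 \<delta>s(7,8)])
  define X3 where "X3 = (\<lambda>s. U1 ** transpose (L s))"
  have X3t: "X3 t = X2 (t + hh)"
    using L by (simp add: X3_def ode_solution_def X2e matrix_transpose_mul matrix_mul_assoc)
  have X3d: "(X3 has_vector_derivative 1 *\<^sub>R (q_fam \<eta> (X3 s) *\<^sub>R (compressed_Omega (normal_proj m) ** X3 s
      - X3 s ** compressed_Omega (mat 1)) + normal_proj m ** R_fam j s ** mat 1)) (at s within {t..t+H})"
    if "s \<in> {t..t+H}" for s
    using L_flow_lifted[OF L oU1 that] unfolding X3_def m(3) .
  \<comment> \<open>The right projection is the identity here and the left one is already built into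
    \<open>\<mu>0\<close>, so the L substep meets its target exactly.\<close>
  have tgt3: "norm (outer \<mu>0 \<nu>0 + (1) *\<^sub>R (normal_proj m ** (W (vartheta j (t + H)) - W (vartheta j (t))) ** mat 1)
      - outer \<mu>1 \<nu>1) \<le> 0" (is "norm ?D \<le> _")
  proof -
    show ?thesis unfolding W \<mu>0_def \<mu>1_def by (simp add: mm_simps mm_outer)
  qed
  have ar3: "160 * \<delta> + 12 * (t + H - t) \<le> 2" "160 * \<delta> + 12 * (t + H - t) + 0 \<le> 172 * \<delta>" "3 * \<delta> + 2 * (t + H - t) \<le> 5 * \<delta>"
    using H hh \<delta> \<delta>0 by simp_all
  obtain u3 v3 where ph3: "phase \<eta> (5 * (hj j)^3) (t) (t + H) (1) (normal_proj m) (mat 1) X3 u3 v3"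
    and st3: "u3 (t) = a2" "v3 (t) = b2"
    and fin3: "norm (u3 (t + H)) = 1" "norm (v3 (t + H)) = 1" "norm (u3 (t + H) - e1) \<le> 5 * \<delta>" "norm (v3 (t + H) - e1) \<le> 5 * \<delta>"
      "norm (X3 (t + H) - outer (u3 (t + H)) (v3 (t + H)) - (hj j)^3 *\<^sub>R outer \<mu>1 \<nu>1) \<le> (172 * \<delta>) * (hj j)^3"
    by (rule flow_stage[OF tle(2) pm orth_proj_mat_1 one(1) \<eta> X3d nab2(1) ab2(1) nab2(2) ab2(2) f2[folded X3t, unfolded k_def H_def] \<mu>0(2) nl(1) tgt3 ar3])
  define a3 where "a3 = u3 (t + H)"
  define b3 where "b3 = v3 (t + H)"
  note nab3 = fin3(1,2)[folded a3_def b3_def]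
  note ab3 = fin3(3,4)[folded a3_def b3_def]
  note f3 = fin3(5)[folded a3_def b3_def H_def, folded k_def]
  have X3e: "X3 (t + H) = U1 ** Sh2 ** transpose V1"
    by (simp add: X3_def Le matrix_transpose_mul matrix_mul_assoc)
  have a\<mu>1: "\<bar>a3 \<bullet> \<mu>1\<bar> \<le> 172 * \<delta>"
    using abs_nth_le_near_e1(1)[OF ab3(1) \<mu>1(2)] p1[of m \<nu>1] m nn m1 \<delta>0 unfolding \<mu>1_def by linarith
  have b\<nu>1: "\<bar>b3 \<bullet> \<nu>1\<bar> \<le> 172 * \<delta>"
    using abs_nth_le_near_e1(1)[OF ab3(2), of \<nu>1] nn \<delta>0 by linarith
  have inv3: "invertible Sh2"
    by (rule core_invertible[OF f3[unfolded X3e] k oU1 nab3 b\<nu>1 a\<mu>1 nn4(3) nl(3) \<mu>1 \<delta>s(4,9)])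
  have X3n1: "X3 (t + H) *v n1 = 0"
    unfolding X3e using n1(2) by (simp add: matrix_vector_mul_assoc[symmetric])
  note e3 = right_null_estimate[OF f3 k(1) n1(1) X3n1 nab3(1) a\<mu>1 \<mu>1 nl(3) \<delta>s(4,5)]
  have n1b: "\<bar>n1 \<bullet> b3\<bar> \<le> 344 * \<delta>" and n1\<nu>: "\<bar>n1 \<bullet> \<nu>1\<bar> \<le> 1376 * \<delta>"
    using e3 dk[of "344 * \<delta>"] \<delta>0 by simp_all
  have n11: "\<bar>n1 $ 1\<bar> \<le> 349 * \<delta>"
    using abs_nth_le_near_e1(2)[OF ab3(2), of n1] n1b n1(1) by (simp add: inner_commute)
  have near1: "near_normal (1376 * \<delta>) n1 (vartheta j (t + H))"
    using n1 n11 n1\<nu> \<delta>0 by (simp add: near_normal_def \<nu>1_def)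
  define \<kappa>h where "\<kappa>h = normal_proj n1 *v \<nu>h"
  have \<kappa>h: "1/4 \<le> \<kappa>h \<bullet> \<kappa>h" "norm \<kappa>h \<le> 1"
    unfolding \<kappa>h_def \<nu>h_def using projected_nu_bounds[OF near1 ang(4)] \<delta> by auto
  define X4 where "X4 = (\<lambda>s. U1 ** S2 s ** transpose V1)"
  have X4t: "X4 (t + hh) = X3 (t + H)" using S2 by (simp add: X4_def ode_solution_def X3e)
  have X4d: "(X4 has_vector_derivative (- 1) *\<^sub>R (q_fam \<eta> (X4 s) *\<^sub>R (compressed_Omega (normal_proj m) ** X4 s
      - X4 s ** compressed_Omega (normal_proj n1)) + normal_proj m ** R_fam j s ** normal_proj n1)) (at s within {t+hh..t+H})"
    if "s \<in> {t+hh..t+H}" for s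
    using S_flow_lifted[OF S2 oU1 oV1 that] unfolding X4_def n1(3) m(3) .
  have tgt4: "norm (outer \<mu>1 \<nu>1 + (- 1) *\<^sub>R (normal_proj m ** (W (vartheta j (t + H)) - W (vartheta j (t + hh))) ** normal_proj n1)
      - outer \<nu>h \<kappa>h) \<le> 1504 * \<delta>" (is "norm ?D \<le> _")
  proof -
    have "?D = (n1 \<bullet> \<nu>1) *\<^sub>R outer \<mu>1 n1 - (m \<bullet> \<nu>h) *\<^sub>R outer m \<kappa>h"
      unfolding W \<kappa>h_def \<mu>1_def
      by (simp add: mm_simps mm_outer outer_mm pv[OF pn1] pd outer_simps algebra_simps)
    then show ?thesis
      using two[of "n1 \<bullet> \<nu>1" "1376 * \<delta>" \<mu>1 n1 "m \<bullet> \<nu>h" "128 * \<delta>" m \<kappa>h] m\<nu> n1\<nu> m(1) n1(1) \<kappa>h(2) \<mu>1(2) by simp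
  qed
  have ar4: "172 * \<delta> + 12 * (t + H - (t + hh)) \<le> 2" "172 * \<delta> + 12 * (t + H - (t + hh)) + 1504 * \<delta> \<le> 1700 * \<delta>" "5 * \<delta> + 2 * (t + H - (t + hh)) \<le> 6 * \<delta>"
    using H hh \<delta> \<delta>0 by simp_all
  obtain u4 v4 where ph4: "phase \<eta> (5 * (hj j)^3) (t + hh) (t + H) (- 1) (normal_proj m) (normal_proj n1) X4 u4 v4"
    and st4: "u4 (t + hh) = a3" "v4 (t + hh) = b3"
    and fin4: "norm (u4 (t + H)) = 1" "norm (v4 (t + H)) = 1" "norm (u4 (t + H) - e1) \<le> 6 * \<delta>" "norm (v4 (t + H) - e1) \<le> 6 * \<delta>"
      "norm (X4 (t + H) - outer (u4 (t + H)) (v4 (t + H)) - (hj j)^3 *\<^sub>R outer \<nu>h \<kappa>h) \<le> (1700 * \<delta>) * (hj j)^3"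
    by (rule flow_stage[OF tle(3) pm pn1 one(2) \<eta> X4d nab3(1) ab3(1) nab3(2) ab3(2) f3[folded X4t, unfolded k_def H_def] \<mu>1(2) nl(3) tgt4 ar4])
  define a4 where "a4 = u4 (t + H)"
  define b4 where "b4 = v4 (t + H)"
  note nab4 = fin4(1,2)[folded a4_def b4_def]
  note ab4 = fin4(3,4)[folded a4_def b4_def]
  note f4 = fin4(5)[folded a4_def b4_def H_def, folded k_def]
  have X4e: "X4 (t + H) = U1 ** S2 (t + H) ** transpose V1" by (simp add: X4_def)
  have b\<kappa>h: "\<bar>b4 \<bullet> \<kappa>h\<bar> \<le> 1700 * \<delta>"
    using abs_nth_le_near_e1(1)[OF ab4(2) \<kappa>h(2)] p1[of n1 \<nu>h] n1 nn n11 \<delta>0 unfolding \<kappa>h_def by linarith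
  have a\<nu>h4: "\<bar>a4 \<bullet> \<nu>h\<bar> \<le> 1700 * \<delta>"
    using abs_nth_le_near_e1(1)[OF ab4(1), of \<nu>h] nn \<delta>0 by linarith
  have inv4: "invertible (S2 (t + H))"
    by (rule core_invertible[OF f4[unfolded X4e] k oU1 nab4 b\<kappa>h a\<nu>h4 \<kappa>h nn4(2) nl(2) \<delta>s(10,11)])
  define X5 where "X5 = (\<lambda>s. K2 s ** transpose V1)"
  have X5t: "X5 (t + hh) = X4 (t + H)" using K2 by (simp add: X5_def ode_solution_def X4e)
  have X5d: "(X5 has_vector_derivative 1 *\<^sub>R (q_fam \<eta> (X5 s) *\<^sub>R (compressed_Omega (mat 1) ** X5 s
      - X5 s ** compressed_Omega (normal_proj n1)) + mat 1 ** R_fam j s ** normal_proj n1)) (at s within {t+hh..t+H})"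
    if "s \<in> {t+hh..t+H}" for s
    using K_flow_lifted[OF K2 oV1 that] unfolding X5_def n1(3) .
  have tgt5: "norm (outer \<nu>h \<kappa>h + (1) *\<^sub>R (mat 1 ** (W (vartheta j (t + H)) - W (vartheta j (t + hh))) ** normal_proj n1)
      - outer \<nu>1 \<nu>1) \<le> 1376 * \<delta>" (is "norm ?D \<le> _")
  proof -
    have "?D = - ((n1 \<bullet> \<nu>1) *\<^sub>R outer \<nu>1 n1)"
      unfolding W \<kappa>h_def by (simp add: mm_simps outer_mm pv[OF pn1] pd outer_simps)
    then show ?thesis using n1\<nu> by (simp add: norm_outer nn n1)
  qed
  have ar5: "1700 * \<delta> + 12 * (t + H - (t + hh)) \<le> 2" "1700 * \<delta> + 12 * (t + H - (t + hh)) + 1376 * \<delta> \<le> 4000 * \<delta>" "6 * \<delta> + 2 * (t + H - (t + hh)) \<le> 7 * \<delta>"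
    using H hh \<delta> \<delta>0 by simp_all
  obtain u5 v5 where ph5: "phase \<eta> (5 * (hj j)^3) (t + hh) (t + H) (1) (mat 1) (normal_proj n1) X5 u5 v5"
    and st5: "u5 (t + hh) = a4" "v5 (t + hh) = b4"
    and fin5: "norm (u5 (t + H)) = 1" "norm (v5 (t + H)) = 1" "norm (u5 (t + H) - e1) \<le> 7 * \<delta>" "norm (v5 (t + H) - e1) \<le> 7 * \<delta>"
      "norm (X5 (t + H) - outer (u5 (t + H)) (v5 (t + H)) - (hj j)^3 *\<^sub>R outer \<nu>1 \<nu>1) \<le> (4000 * \<delta>) * (hj j)^3"
    by (rule flow_stage[OF tle(3) orth_proj_mat_1 pn1 one(1) \<eta> X5d nab4(1) ab4(1) nab4(2) ab4(2) f4[folded X5t, unfolded k_def H_def] nl(2) \<kappa>h(2) tgt5 ar5])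
  define a5 where "a5 = u5 (t + H)"
  define b5 where "b5 = v5 (t + H)"
  note nab5 = fin5(1,2)[folded a5_def b5_def]
  note ab5 = fin5(3,4)[folded a5_def b5_def]
  note f5 = fin5(5)[folded a5_def b5_def H_def, folded k_def]
  have X5e: "X5 (t + H) = U2 ** Sp ** transpose V1" by (simp add: X5_def K2e)
  have a\<nu>1: "\<bar>a5 \<bullet> \<nu>1\<bar> \<le> 4000 * \<delta>" and b\<nu>15: "\<bar>b5 \<bullet> \<nu>1\<bar> \<le> 4000 * \<delta>"
    using abs_nth_le_near_e1(1)[OF ab5(1), of \<nu>1] abs_nth_le_near_e1(1)[OF ab5(2), of \<nu>1] nn \<delta>0 by linarith+
  have inv5: "invertible Sp"
    by (rule core_invertible[OF f5[unfolded X5e] k oU2 nab5 b\<nu>15 a\<nu>1 nn4(3) nl(3) nn4(3) nl(3) \<delta>s(12,13)])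

  have rk: "rank (K1 (t + hh)) = CARD(2)" "rank (L (t + H)) = CARD(2)" "rank (K2 (t + H)) = CARD(2)"
    using qr_factors_rank[OF Q1 inv1] qr_factors_rank[OF QL] qr_factors_rank[OF Q2 inv5] transpose_invertible[OF inv3]
    by auto
  have "rank_admissible_trace t (hj j) d"
    unfolding rank_admissible_trace_def
    using rk inv1 inv2 inv3 inv4 inv5 unfolding defs H_def hh_def by simp
  moreover have "strang_result d = X5 (t + H)"
    unfolding strang_result_def X5e by (simp add: defs)
  then have "norm (strang_result d - outer a5 b5 - (hj j)^3 *\<^sub>R W (vartheta j (t + hj j))) \<le> 10000 * \<delta> * (hj j)^3"
  proof -
    have "(4000 * \<delta>) * k \<le> (10000 * \<delta>) * k" using \<delta>0 k by (intro mult_right_mono) auto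
    then show "norm (strang_result d - outer a5 b5 - (hj j)^3 *\<^sub>R W (vartheta j (t + hj j))) \<le> 10000 * \<delta> * (hj j)^3"
      using f5 W(3) \<open>strang_result d = X5 (t + H)\<close> unfolding H_def[symmetric] k_def[symmetric] by simp
  qed
  moreover have "step_phases \<eta> j t (10000 * \<delta>) u0 v0 a5 b5"
  proof -
    have "near_normal (10000 * \<delta>) n0 (vartheta j t)" "near_normal (10000 * \<delta>) m (vartheta j (t + hj j / 2))"
      "near_normal (10000 * \<delta>) n1 (vartheta j (t + hj j))"
      using near_normal_mono[OF near0] near_normal_mono[OF nearm] near_normal_mono[OF near1] \<delta>0
      by (auto simp: hh_def H_def)
    then show ?thesis unfolding step_phases_def
      using ph1 ph2 ph3 ph4 ph5 st1 st2 st3 st4 st5 a1_def a2_def a3_def a4_def a5_def b1_def b2_def b3_def b4_def b5_def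
      unfolding hh_def H_def by blast
  qed
  moreover have "norm (a5 - e1) \<le> 10000 * \<delta>" "norm (b5 - e1) \<le> 10000 * \<delta>" using ab5 \<delta>0 by linarith+
  ultimately show ?thesis using nab5 by blast
qed


section \<open>The second-order defect of adjacent substeps\<close>

abbreviation "e3 \<equiv> axis 3 1 :: real^3"

lemma norm_e1_e3 [simp]: "norm e1 = 1" "norm e3 = 1"
  by (simp_all add: norm_axis_1)

lemma abs_nth_le_norm: "\<bar>(x :: real^3) $ i\<bar> \<le> norm x"
  by (rule component_le_norm_cart)

lemma Omega_e1: "Omega *v e1 = e3"
  by (simp add: Omega_mult_vec vec_eq_iff forall_3 axis_def)

lemma norm_matrix_entry_le: "\<bar>(X :: real^3^3) $ i $ k\<bar> \<le> norm X"
  by (rule order_trans[OF component_le_norm_cart Finite_Cartesian_Product.norm_nth_le])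

text \<open>Since \<open>Omega\<close> sends the first axis to the third, a factor near
  \<open>e1\<close> moves, to leading order, in the direction \<open>P *v e3\<close>.\<close>

lemma compressed_Omega_near_e1:
  assumes P: "orth_proj P" and Pe: "norm (P *v e1 - e1) \<le> e" and u: "norm (u - e1) \<le> e"
  shows "norm (compressed_Omega P *v u - P *v e3) \<le> 2 * e"
proof -
  have "compressed_Omega P *v u - P *v e3 = P *v (Omega *v (P *v u - e1))"
    by (simp add: compressed_Omega_vec matrix_vector_mult_diff_distrib Omega_e1)
  then have "norm (compressed_Omega P *v u - P *v e3) \<le> norm (P *v u - e1)"
    by (metis norm_orth_proj_vec_le[OF P] norm_Omega_vec_le order_trans)
  also have "P *v u - e1 = P *v (u - e1) + (P *v e1 - e1)"
    by (simp add: matrix_vector_mult_diff_distrib)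
  also have "norm \<dots> \<le> norm (P *v (u - e1)) + norm (P *v e1 - e1)" by (rule norm_triangle_ineq)
  also have "\<dots> \<le> e + e" using norm_orth_proj_vec_le[OF P, of "u - e1"] u Pe by linarith
  finally show ?thesis by simp
qed

text \<open>The derivative of \<open>tanh z - z\<close> is \<open>- (tanh z)\<^sup>2\<close>, and
  |tanh z| is at most |z|; so near 0 the difference of two values is that of the arguments up to a
  quadratically small factor.\<close>

lemma tanh_diff_linear:
  fixes x y :: real
  assumes "\<bar>x\<bar> \<le> c" "\<bar>y\<bar> \<le> c"
  shows "\<bar>(tanh x - tanh y) - (x - y)\<bar> \<le> c\<^sup>2 * \<bar>x - y\<bar>" "\<bar>tanh x\<bar> \<le> c"
proof -
  have c: "c \<ge> 0" using assms by linarith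
  have d: "(tanh has_real_derivative 1 - (tanh z)\<^sup>2) (at z within S)" for z :: real and S
    using has_field_derivative_tanh[OF _ DERIV_ident, of z S] by simp
  have t: "\<bar>tanh z\<bar> \<le> \<bar>z\<bar>" for z :: real
  proof -
    have "norm (tanh z - tanh 0) \<le> 1 * norm (z - 0)"
    proof (rule field_differentiable_bound[where S=UNIV and f'="\<lambda>z. 1 - (tanh z)\<^sup>2"])
      fix w :: real
      have "\<bar>tanh w\<bar> \<le> 1" using tanh_real_bounds[of w] by auto
      then have "(tanh w)\<^sup>2 \<le> 1" by (simp add: abs_square_le_1)
      then show "norm (1 - (tanh w)\<^sup>2) \<le> 1" by simp
    qed (auto intro: d)
    then show ?thesis by simp
  qed
  show "\<bar>tanh x\<bar> \<le> c" using t[of x] assms by linarith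
  have "norm ((tanh x - x) - (tanh y - y)) \<le> c\<^sup>2 * norm (x - y)"
  proof (rule field_differentiable_bound[where S="{-c..c}" and f'="\<lambda>z. - (tanh z)\<^sup>2"])
    fix z assume z: "z \<in> {-c..c}"
    show "((\<lambda>z. tanh z - z) has_field_derivative - (tanh z)\<^sup>2) (at z within {-c..c})"
      by (rule derivative_eq_intros d refl)+ simp
    have "\<bar>tanh z\<bar>\<^sup>2 \<le> c\<^sup>2" using t[of z] z by (intro power_mono) auto
    then show "norm (- (tanh z)\<^sup>2) \<le> c\<^sup>2" by simp
  qed (use assms in auto)
  then show "\<bar>(tanh x - tanh y) - (x - y)\<bar> \<le> c\<^sup>2 * \<bar>x - y\<bar>" by (simp add: algebra_simps)
qed

text \<open>The rank-one part has norm 1, so the denominator is frozen at sqrt 2 up to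
  \<open>e0\<close>, and to leading order the speed varies only through the entry (3,1).\<close>

lemma q_fam_near:
  assumes \<eta>: "\<bar>\<eta>\<bar> = 1" and u: "norm u = 1" and v: "norm v = 1" and X: "norm (X - outer u v) \<le> e0" and e0: "e0 \<le> 1"
  shows "\<bar>q_fam \<eta> X - (1 + \<eta> * tanh (X $ 3 $ 1)) / sqrt 2\<bar> \<le> 3 * e0"
proof -
  define N where "N = (norm X)\<^sup>2"
  have e00: "0 \<le> e0" using X norm_ge_zero order_trans by blast
  have no: "norm (outer u v) = 1" using u v by (simp add: norm_outer)
  have nX: "\<bar>norm X - 1\<bar> \<le> e0"
    using norm_triangle_ineq3[of X "outer u v"] X no by linarith
  have "N - 1 = (norm X - 1) * (norm X + 1)"
    unfolding N_def by (simp add: power2_eq_square algebra_simps)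
  then have "\<bar>N - 1\<bar> = \<bar>norm X - 1\<bar> * (norm X + 1)" by (simp add: abs_mult)
  also have "\<dots> \<le> e0 * 3" using nX e0 e00 by (intro mult_mono) auto
  finally have N: "\<bar>N - 1\<bar> \<le> 3 * e0" by simp
  have N0: "N \<ge> 0" by (simp add: N_def)
  define r where "r = sqrt (1 + N)"
  have r: "r \<ge> 1" "r * r = 1 + N" using N0 by (simp_all add: r_def)
  have s: "sqrt 2 \<ge> 1" "sqrt 2 * sqrt 2 = (2::real)" by simp_all
  have "1 / r - 1 / sqrt 2 = (sqrt 2 - r) / (r * sqrt 2)" using r s by (simp add: field_simps)
  also have "\<dots> = (sqrt 2 - r) * (sqrt 2 + r) / (r * sqrt 2 * (sqrt 2 + r))"
  proof -
    have "sqrt 2 + r \<noteq> 0" using r s by linarith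
    then show ?thesis by simp
  qed
  also have "(sqrt 2 - r) * (sqrt 2 + r) = 1 - N" using r s by (simp add: algebra_simps)
  finally have eq: "1 / r - 1 / sqrt 2 = (1 - N) / (r * sqrt 2 * (sqrt 2 + r))" .
  have "0 < r" "0 < sqrt 2 + r" using r s by linarith+
  then have "0 < r * sqrt 2 * (sqrt 2 + r)" by (intro mult_pos_pos) auto
  then have "\<bar>1 / r - 1 / sqrt 2\<bar> = \<bar>1 - N\<bar> / (r * sqrt 2 * (sqrt 2 + r))"
    unfolding eq by (simp only: abs_divide abs_of_pos)
  also have "\<dots> \<le> (3 * e0) / 2"
  proof (rule frac_le)
    have "1 * 1 * (1 + 1) \<le> r * sqrt 2 * (sqrt 2 + r)" using r s by (intro mult_mono add_mono) auto
    then show "2 \<le> r * sqrt 2 * (sqrt 2 + r)" by simp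
  qed (use N in auto)
  finally have R: "\<bar>1 / r - 1 / sqrt 2\<bar> \<le> (3 * e0) / 2" .
  have T: "\<bar>1 + \<eta> * tanh (X $ 3 $ 1)\<bar> \<le> 2"
  proof -
    have "\<bar>\<eta> * tanh (X $ 3 $ 1)\<bar> \<le> 1"
      using tanh_real_bounds[of "X $ 3 $ 1"] \<eta> by (auto simp: abs_mult)
    then show ?thesis by linarith
  qed
  have "q_fam \<eta> X - (1 + \<eta> * tanh (X $ 3 $ 1)) / sqrt 2 = (1 + \<eta> * tanh (X $ 3 $ 1)) * (1 / r - 1 / sqrt 2)"
    by (simp add: q_fam_def r_def N_def algebra_simps diff_divide_distrib add_divide_distrib)
  also have "\<bar>\<dots>\<bar> \<le> 2 * ((3 * e0) / 2)"
    unfolding abs_mult by (intro mult_mono T R) auto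
  finally show ?thesis by simp
qed

lemma has_vector_derivative_mult_const: "((\<lambda>s. c * s) has_vector_derivative (c :: real)) (at s within S)"
  by (auto intro!: derivative_eq_intros simp: has_real_derivative_iff_has_vector_derivative[symmetric])

lemma has_vector_derivative_vec_nth:
  "(f has_vector_derivative f') (at s within S) \<Longrightarrow> ((\<lambda>s. f s $ i) has_vector_derivative f' $ i) (at s within S)"
  by (rule bounded_linear.has_vector_derivative[OF bounded_linear_vec_nth])

lemma near_rank_one_entries:
  fixes u v :: "real^3"
  assumes \<eta>: "\<bar>\<eta>\<bar> = 1" and that: "norm (X - outer u v) \<le> e0" "norm u = 1" "norm v = 1"
      "norm (u - e1) \<le> e" "norm (v - e1) \<le> e"
    and e0le: "e0 \<le> e" "e0 \<le> 1"
  shows "\<bar>X $ 3 $ 1 - u $ 3 * v $ 1\<bar> \<le> e0" "\<bar>X $ 3 $ 1\<bar> \<le> 2 * e"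
      "\<bar>q_fam \<eta> X - 1 / sqrt 2\<bar> \<le> 5 * e" "\<bar>u $ 3\<bar> \<le> e" "\<bar>v $ 1 - 1\<bar> \<le> e"
proof -
  show 1: "\<bar>X $ 3 $ 1 - u $ 3 * v $ 1\<bar> \<le> e0"
    using norm_matrix_entry_le[of "X - outer u v" 3 1] that(1) by simp
  have u3: "\<bar>u $ 3\<bar> \<le> e" using abs_nth_le_norm[of "u - e1" 3] that(4) by (simp add: axis_def)
  have v1: "\<bar>v $ 1\<bar> \<le> 1" using abs_nth_le_norm[of v 1] that(3) by simp
  show "\<bar>u $ 3\<bar> \<le> e" by (fact u3)
  show "\<bar>v $ 1 - 1\<bar> \<le> e" using abs_nth_le_norm[of "v - e1" 1] that(5) by (simp add: axis_def)
  have "\<bar>u $ 3 * v $ 1\<bar> \<le> e * 1" unfolding abs_mult using u3 v1 order_trans[OF abs_ge_zero u3] by (intro mult_mono) auto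
  then show x: "\<bar>X $ 3 $ 1\<bar> \<le> 2 * e" using 1 e0le by linarith
  have "\<bar>tanh (X $ 3 $ 1)\<bar> \<le> 2 * e" using tanh_diff_linear(2)[OF x x] .
  then have t: "\<bar>\<eta> * tanh (X $ 3 $ 1)\<bar> \<le> 2 * e" using \<eta> by (simp add: abs_mult)
  have "(1 + \<eta> * tanh (X $ 3 $ 1)) / sqrt 2 - 1 / sqrt 2 = (\<eta> * tanh (X $ 3 $ 1)) / sqrt 2"
    by (simp add: field_simps)
  also have "\<bar>\<dots>\<bar> \<le> (2 * e) / 1"
    unfolding abs_divide using t by (intro frac_le) auto
  finally have "\<bar>(1 + \<eta> * tanh (X $ 3 $ 1)) / sqrt 2 - 1 / sqrt 2\<bar> \<le> 2 * e" by simp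
  then show "\<bar>q_fam \<eta> X - 1 / sqrt 2\<bar> \<le> 5 * e"
    using q_fam_near[OF \<eta> that(2,3,1) e0le(2)] e0le(1) by linarith
qed

text \<open>The left factor leaves the first axis with third component growing at rate
  \<open>r / sqrt 2\<close>. The projection enters through \<open>r\<close>, which is what
  distinguishes a K substep from an S substep. In the error, \<open>5 * e\<close> comes from the
  speed and \<open>2 * e\<close> from the direction.\<close>

lemma phase_third_component:
  assumes ph: "phase \<eta> e0 a b \<sigma> P Q X u v" and s: "a \<le> s" "s \<le> s'" "s' \<le> b"
    and \<sigma>: "\<bar>\<sigma>\<bar> = 1" and \<eta>: "\<bar>\<eta>\<bar> = 1" and e0: "e0 \<le> e" "e0 \<le> 1"
    and near: "\<And>s. s \<in> {a..b} \<Longrightarrow> norm (u s - e1) \<le> e" "\<And>s. s \<in> {a..b} \<Longrightarrow> norm (v s - e1) \<le> e"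
    and Pe: "norm (P *v e1 - e1) \<le> e" and r: "r = (P *v e3) $ 3"
  shows "\<bar>u s' $ 3 - u s $ 3 - \<sigma> * r / sqrt 2 * (s' - s)\<bar> \<le> 7 * e * (s' - s)"
proof -
  have P: "orth_proj P" using ph by (simp add: phase_def)
  have ph': "(u has_vector_derivative (\<sigma> * q_fam \<eta> (X z)) *\<^sub>R (compressed_Omega P *v u z)) (at z within {a..b})"
    "norm (u z) = 1" "norm (v z) = 1" "norm (X z - outer (u z) (v z)) \<le> e0" if "z \<in> {a..b}" for z
    using ph that by (auto simp: phase_def)
  have is2: "1 / sqrt 2 \<le> (1::real)" "1 / sqrt 2 \<ge> (0::real)" by simp_all
  have "norm ((u s' $ 3 - (\<sigma> * r / sqrt 2) * s') - (u s $ 3 - (\<sigma> * r / sqrt 2) * s)) \<le> 7 * e * (s' - s)"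
  proof (rule norm_diff_le_deriv_bound[where b=s' and x="\<lambda>z. u z $ 3 - (\<sigma> * r / sqrt 2) * z"
        and d="\<lambda>z. ((\<sigma> * q_fam \<eta> (X z)) *\<^sub>R (compressed_Omega P *v u z)) $ 3 - \<sigma> * r / sqrt 2"])
    fix z assume zz: "z \<in> {s..s'}"
    then have z: "z \<in> {a..b}" using s by auto
    have "(u has_vector_derivative (\<sigma> * q_fam \<eta> (X z)) *\<^sub>R (compressed_Omega P *v u z)) (at z within {s..s'})"
      using has_vector_derivative_within_subset[OF ph'(1)[OF z]] s by auto
    then show "((\<lambda>z. u z $ 3 - (\<sigma> * r / sqrt 2) * z) has_vector_derivative
        ((\<sigma> * q_fam \<eta> (X z)) *\<^sub>R (compressed_Omega P *v u z)) $ 3 - \<sigma> * r / sqrt 2) (at z within {s..s'})"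
      by (intro has_vector_derivative_diff has_vector_derivative_vec_nth has_vector_derivative_mult_const)
    define w where "w = compressed_Omega P *v u z"
    define q where "q = q_fam \<eta> (X z)"
    have q: "\<bar>q - 1 / sqrt 2\<bar> \<le> 5 * e"
      unfolding q_def by (rule near_rank_one_entries(3)[OF \<eta> ph'(4,2,3)[OF z] near[OF z] e0])
    have w3: "\<bar>w $ 3 - r\<bar> \<le> 2 * e"
      using abs_nth_le_norm[of "w - P *v e3" 3] compressed_Omega_near_e1[OF P Pe near(1)[OF z]] r by (simp add: w_def)
    have w1: "\<bar>w $ 3\<bar> \<le> 1"
      using abs_nth_le_norm[of w 3] norm_compressed_Omega_vec_le[OF P, of "u z"] ph'(2)[OF z] by (simp add: w_def)
    have "q * w $ 3 - r / sqrt 2 = (q - 1 / sqrt 2) * w $ 3 + (1 / sqrt 2) * (w $ 3 - r)"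
      by (simp add: algebra_simps)
    also have "\<bar>\<dots>\<bar> \<le> \<bar>(q - 1 / sqrt 2) * w $ 3\<bar> + \<bar>(1 / sqrt 2) * (w $ 3 - r)\<bar>" by (rule abs_triangle_ineq)
    also have "\<dots> \<le> (5 * e) * 1 + 1 * (2 * e)"
      unfolding abs_mult using q w1 w3 is2 by (intro add_mono mult_mono) auto
    finally have "\<bar>q * w $ 3 - r / sqrt 2\<bar> \<le> 7 * e" by simp
    moreover have "((\<sigma> * q) *\<^sub>R w) $ 3 - \<sigma> * r / sqrt 2 = \<sigma> * (q * w $ 3 - r / sqrt 2)"
      by (simp add: algebra_simps)
    ultimately show "norm (((\<sigma> * q_fam \<eta> (X z)) *\<^sub>R (compressed_Omega P *v u z)) $ 3 - \<sigma> * r / sqrt 2) \<le> 7 * e"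
      using \<sigma> unfolding w_def[symmetric] q_def[symmetric] by (simp only: real_norm_def abs_mult mult_1)
  qed (use s in auto)
  moreover have "(u s' $ 3 - (\<sigma> * r / sqrt 2) * s') - (u s $ 3 - (\<sigma> * r / sqrt 2) * s)
      = u s' $ 3 - u s $ 3 - \<sigma> * r / sqrt 2 * (s' - s)"
    by (simp add: algebra_simps diff_divide_distrib)
  ultimately show ?thesis by simp
qed

text \<open>A K substep and the S substep adjacent to it act on the right factor \<open>v\<close> by the same
  projected generator with opposite signs, so \<open>v\<close> would return to its starting point if the
  speeds \<open>q\<close> agreed. Running the first substep backwards in time compares the two at the same
  distance from their junction, where the speeds differ through the entry \<open>(3,1)\<close> of the solution,
  i.e. through the different projections \<open>P1\<close>, \<open>P2\<close> acting on the left factor.\<close>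

lemma adjacent_phases_turn:
  fixes a b :: real and e l :: real
  assumes A: "phase \<eta> e0 a b \<sigma> P1 Q X1 u1 v1" and B: "phase \<eta> e0 a b (- \<sigma>) P2 Q X2 u2 v2"
    and j: "u2 a = u1 b" "v2 a = v1 b" and ab: "a \<le> b" and l: "l = b - a" "l \<le> e"
    and \<sigma>: "\<bar>\<sigma>\<bar> = 1" and \<eta>: "\<bar>\<eta>\<bar> = 1" and e: "e \<le> 1/100" and e0: "e0 \<le> e * l"
    and near: "\<And>s. s \<in> {a..b} \<Longrightarrow> norm (u1 s - e1) \<le> e" "\<And>s. s \<in> {a..b} \<Longrightarrow> norm (v1 s - e1) \<le> e"
      "\<And>s. s \<in> {a..b} \<Longrightarrow> norm (u2 s - e1) \<le> e" "\<And>s. s \<in> {a..b} \<Longrightarrow> norm (v2 s - e1) \<le> e"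
    and P: "norm (P1 *v e1 - e1) \<le> e" "norm (P2 *v e1 - e1) \<le> e" "norm (Q *v e1 - e1) \<le> e"
    and r: "r1 = (P1 *v e3) $ 3" "r2 = (P2 *v e3) $ 3" "0 \<le> r1" "r1 \<le> 1" "0 \<le> r2" "r2 \<le> 1"
  shows "\<bar>v2 b $ 2 - v1 a $ 2 - \<eta> / 4 * (r2 - r1) * l\<^sup>2 * (Q *v e3) $ 2\<bar> \<le> 40 * e * l\<^sup>2"
proof -
  define q1 where "q1 = (\<lambda>s. q_fam \<eta> (X1 s))"
  define q2 where "q2 = (\<lambda>s. q_fam \<eta> (X2 s))"
  define C where "C = compressed_Omega Q"
  define \<kappa> where "\<kappa> = (Q *v e3) $ 2"
  have l0: "0 \<le> l" and ll: "l \<le> 1/100" using l ab e by auto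
  have e'0: "0 \<le> e" using l l0 by linarith
  have el: "0 \<le> e * l" using e'0 l0 by simp
  have el': "e * l \<le> l / 100" using mult_right_mono[OF e l0] by simp
  have lle: "l * l \<le> e * l" using mult_right_mono[OF l(2) l0] .
  have e0le: "e0 \<le> e" "e0 \<le> 1"
    using e0 e'0 ll mult_left_mono[of l 1 e] e by auto
  have pQ: "orth_proj Q" using A by (simp add: phase_def)
  have Ad: "(u1 has_vector_derivative (\<sigma> * q1 s) *\<^sub>R (compressed_Omega P1 *v u1 s)) (at s within {a..b})"
    "(v1 has_vector_derivative (\<sigma> * q1 s) *\<^sub>R (C *v v1 s)) (at s within {a..b})"
    "norm (u1 s) = 1" "norm (v1 s) = 1" "norm (X1 s - outer (u1 s) (v1 s)) \<le> e0" if "s \<in> {a..b}" for s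
    using A that by (auto simp: phase_def q1_def C_def)
  have Bd: "(u2 has_vector_derivative (- \<sigma> * q2 s) *\<^sub>R (compressed_Omega P2 *v u2 s)) (at s within {a..b})"
    "(v2 has_vector_derivative (- \<sigma> * q2 s) *\<^sub>R (C *v v2 s)) (at s within {a..b})"
    "norm (u2 s) = 1" "norm (v2 s) = 1" "norm (X2 s - outer (u2 s) (v2 s)) \<le> e0" if "s \<in> {a..b}" for s
    using B that by (auto simp: phase_def q2_def C_def)
  have qb: "\<bar>q_fam \<eta> X\<bar> \<le> 2" for X using q_fam_bounds[OF \<eta>, of X] by simp

  note entry = near_rank_one_entries[OF \<eta> _ _ _ _ _ e0le]
  have \<sigma>m: "\<bar>- \<sigma>\<bar> = 1" using \<sigma> by simp
  have B3: "\<bar>u2 s $ 3 - u2 a $ 3 + \<sigma> * r2 / sqrt 2 * (s - a)\<bar> \<le> 7 * e * (s - a)" if s: "s \<in> {a..b}" for s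
    using phase_third_component[OF B _ _ _ \<sigma>m \<eta> e0le near(3,4) P(2) r(2), of a s] s by simp
  have A3: "\<bar>u1 (a + b - s) $ 3 - u1 b $ 3 + \<sigma> * r1 / sqrt 2 * (s - a)\<bar> \<le> 7 * e * (s - a)" if s: "s \<in> {a..b}" for s
  proof -
    have "\<bar>u1 b $ 3 - u1 (a + b - s) $ 3 - \<sigma> * r1 / sqrt 2 * (s - a)\<bar> \<le> 7 * e * (s - a)"
      using phase_third_component[OF A _ _ _ \<sigma> \<eta> e0le near(1,2) P(1) r(1), of "a + b - s" b] s by simp
    then show ?thesis by (simp add: abs_le_iff)
  qed
  have V2: "norm (v2 s - v2 a) \<le> 2 * (s - a)" "norm (u2 s - u2 a) \<le> 2 * (s - a)" if s: "s \<in> {a..b}" for s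
    using phase_drift[OF B _ _ _ \<sigma>m \<eta>, of a s] s by auto
  have V1: "norm (v1 b - v1 s) \<le> 2 * (b - s)" "norm (u1 b - u1 s) \<le> 2 * (b - s)" if s: "s \<in> {a..b}" for s
    using phase_drift[OF A _ _ _ \<sigma> \<eta>, of s b] s by auto

  \<comment> \<open>The times \<open>s\<close> and \<open>a + b - s\<close> are equally far from the
    junction. There the entries (3,1) differ by about
    \<open>- \<sigma> * (r2 - r1) * (s - a) / sqrt 2\<close>; the slope
    \<open>\<eta> / sqrt 2\<close> of the speed turns this into the factor
    \<open>\<eta> / 2\<close>.\<close>
  define dq where "dq = (\<lambda>s. q2 s - q1 (a + b - s))"
  have dq: "\<bar>dq s + \<eta> / 2 * \<sigma> * (r2 - r1) * (s - a)\<bar> \<le> 32 * e * l" "\<bar>dq s\<bar> \<le> l" if s: "s \<in> {a..b}" for s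
  proof -
    define s' where "s' = a + b - s"
    define z where "z = s - a"
    have s': "s' \<in> {a..b}" "b - s' = z" using s by (auto simp: s'_def z_def)
    have z: "0 \<le> z" "z \<le> l" using s l by (auto simp: z_def)
    have ez: "e * z \<le> e * l" using z e'0 by (intro mult_left_mono) auto
    note E2 = entry[OF Bd(5,3,4)[OF s] near(3,4)[OF s]]
    note E1 = entry[OF Ad(5,3,4)[OF s'(1)] near(1,2)[OF s'(1)]]
    define x2 where "x2 = X2 s $ 3 $ 1"
    define x1 where "x1 = X1 s' $ 3 $ 1"
    define du where "du = u2 s $ 3 - u1 s' $ 3"
    have du: "\<bar>du + \<sigma> * (r2 - r1) * z / sqrt 2\<bar> \<le> 14 * (e * l)"
    proof -
      have "du + \<sigma> * (r2 - r1) * z / sqrt 2 = (u2 s $ 3 - u2 a $ 3 + \<sigma> * r2 / sqrt 2 * (s - a))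
         - (u1 s' $ 3 - u1 b $ 3 + \<sigma> * r1 / sqrt 2 * (s - a))"
        using j(1) by (simp add: du_def z_def algebra_simps diff_divide_distrib add_divide_distrib)
      then have "\<bar>du + \<sigma> * (r2 - r1) * z / sqrt 2\<bar> \<le> 7 * e * z + 7 * e * z"
        using B3[OF s] A3[OF s] unfolding s'_def[symmetric] z_def[symmetric] by linarith
      then show ?thesis using ez by linarith
    qed
    have du4: "\<bar>du\<bar> \<le> 4 * l"
    proof -
      have "\<bar>du\<bar> \<le> norm (u2 s - u1 s')" using abs_nth_le_norm[of "u2 s - u1 s'" 3] by (simp add: du_def)
      also have "u2 s - u1 s' = (u2 s - u2 a) + (u1 b - u1 s')" using j by simp
      also have "norm \<dots> \<le> norm (u2 s - u2 a) + norm (u1 b - u1 s')" by (rule norm_triangle_ineq)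
      also have "\<dots> \<le> 2 * l + 2 * l"
        using V2(2)[OF s] V1(2)[OF s'(1)] s'(2) z by (intro add_mono) (auto simp: z_def)
      finally show ?thesis by simp
    qed
    have dv4: "\<bar>v2 s $ 1 - v1 s' $ 1\<bar> \<le> 4 * l"
    proof -
      have "\<bar>v2 s $ 1 - v1 s' $ 1\<bar> \<le> norm (v2 s - v1 s')" using abs_nth_le_norm[of "v2 s - v1 s'" 1] by simp
      also have "v2 s - v1 s' = (v2 s - v2 a) + (v1 b - v1 s')" using j by simp
      also have "norm \<dots> \<le> norm (v2 s - v2 a) + norm (v1 b - v1 s')" by (rule norm_triangle_ineq)
      also have "\<dots> \<le> 2 * l + 2 * l"
        using V2(1)[OF s] V1(1)[OF s'(1)] s'(2) z by (intro add_mono) (auto simp: z_def)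
      finally show ?thesis by simp
    qed
    have x: "\<bar>x2 - x1 + \<sigma> * (r2 - r1) * z / sqrt 2\<bar> \<le> 24 * (e * l)"
    proof -
      have "u2 s $ 3 * v2 s $ 1 - u1 s' $ 3 * v1 s' $ 1 = du + du * (v2 s $ 1 - 1) + u1 s' $ 3 * (v2 s $ 1 - v1 s' $ 1)"
        by (simp add: du_def algebra_simps)
      moreover have "\<bar>du * (v2 s $ 1 - 1)\<bar> \<le> (4 * l) * e"
        unfolding abs_mult using du4 E2(5) l0 by (intro mult_mono) auto
      moreover have "\<bar>u1 s' $ 3 * (v2 s $ 1 - v1 s' $ 1)\<bar> \<le> e * (4 * l)"
        unfolding abs_mult using dv4 E1(4) e'0 by (intro mult_mono) auto
      ultimately have "\<bar>(u2 s $ 3 * v2 s $ 1 - u1 s' $ 3 * v1 s' $ 1) + \<sigma> * (r2 - r1) * z / sqrt 2\<bar> \<le> 22 * (e * l)"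
        using du by (simp add: mult_ac)
      then show ?thesis using E1(1) E2(1) e0 unfolding x1_def x2_def by linarith
    qed
    have main: "\<bar>\<sigma> * (r2 - r1) * z / sqrt 2\<bar> \<le> l"
    proof -
      have "\<bar>\<sigma>\<bar> * \<bar>r2 - r1\<bar> * \<bar>z\<bar> / sqrt 2 \<le> 1 * 1 * l / 1"
        using \<sigma> r z l0 by (intro frac_le mult_mono) auto
      then show ?thesis by (simp add: abs_mult)
    qed
    have x12: "\<bar>x2 - x1\<bar> \<le> 2 * l" using x main el' by linarith
    have t: "\<bar>(tanh x2 - tanh x1) - (x2 - x1)\<bar> \<le> e * l"
    proof -
      have "\<bar>(tanh x2 - tanh x1) - (x2 - x1)\<bar> \<le> (2 * e)\<^sup>2 * \<bar>x2 - x1\<bar>"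
        using tanh_diff_linear(1)[of x2 "2 * e" x1] E1(2) E2(2) by (simp add: x1_def x2_def)
      also have "\<dots> \<le> (2 * e)\<^sup>2 * (2 * l)" using x12 by (intro mult_left_mono) auto
      also have "\<dots> = (8 * e) * (e * l)" by (simp add: power2_eq_square)
      also have "\<dots> \<le> 1 * (e * l)" using e el by (intro mult_right_mono) auto
      finally show ?thesis by simp
    qed
    have tx: "\<bar>(tanh x2 - tanh x1) + \<sigma> * (r2 - r1) * z / sqrt 2\<bar> \<le> 25 * (e * l)" using t x by linarith
    have "dq s = (q2 s - (1 + \<eta> * tanh x2) / sqrt 2) - (q1 s' - (1 + \<eta> * tanh x1) / sqrt 2)
        + \<eta> / sqrt 2 * (tanh x2 - tanh x1)"
      by (simp add: dq_def s'_def field_simps)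
    moreover have "\<bar>q2 s - (1 + \<eta> * tanh x2) / sqrt 2\<bar> \<le> 3 * e0"
      unfolding q2_def x2_def by (rule q_fam_near[OF \<eta> Bd(3,4,5)[OF s] e0le(2)])
    moreover have "\<bar>q1 s' - (1 + \<eta> * tanh x1) / sqrt 2\<bar> \<le> 3 * e0"
      unfolding q1_def x1_def by (rule q_fam_near[OF \<eta> Ad(3,4,5)[OF s'(1)] e0le(2)])
    moreover have "\<bar>\<eta> / sqrt 2 * ((tanh x2 - tanh x1) + \<sigma> * (r2 - r1) * z / sqrt 2)\<bar> \<le> 1 * (25 * (e * l))"
      unfolding abs_mult using tx \<eta> by (intro mult_mono) auto
    moreover have "\<eta> / sqrt 2 * ((tanh x2 - tanh x1) + \<sigma> * (r2 - r1) * z / sqrt 2)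
      = \<eta> / sqrt 2 * (tanh x2 - tanh x1) + \<eta> / 2 * \<sigma> * (r2 - r1) * z"
      by (simp add: field_simps)
    ultimately have "\<bar>dq s + \<eta> / 2 * \<sigma> * (r2 - r1) * z\<bar> \<le> 6 * e0 + 25 * (e * l)" by linarith
    then show r1: "\<bar>dq s + \<eta> / 2 * \<sigma> * (r2 - r1) * (s - a)\<bar> \<le> 32 * e * l"
      using e0 el unfolding z_def by linarith
    have "\<bar>\<eta>\<bar> / 2 * \<bar>\<sigma>\<bar> * \<bar>r2 - r1\<bar> * \<bar>z\<bar> \<le> 1 / 2 * 1 * 1 * l"
      using \<sigma> \<eta> r z l0 by (intro mult_mono) auto
    then have "\<bar>\<eta> / 2 * \<sigma> * (r2 - r1) * z\<bar> \<le> l / 2" by (simp add: abs_mult)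
    then show "\<bar>dq s\<bar> \<le> l" using r1 el' unfolding z_def by linarith
  qed

  define w where "w = (\<lambda>s. v1 (a + b - s))"
  define D where "D = (\<lambda>s. v2 s - w s)"
  define D' where "D' = (\<lambda>s. (- \<sigma>) *\<^sub>R (q2 s *\<^sub>R (C *v D s) + dq s *\<^sub>R (C *v w s)))"
  have wd: "(w has_vector_derivative (- \<sigma> * q1 (a + b - s)) *\<^sub>R (C *v w s)) (at s within {a..b})" if s: "s \<in> {a..b}" for s
  proof -
    have im: "(\<lambda>s. a + b - s) ` {a..b} = {a..b}"
      by (auto simp: image_iff intro!: bexI[of _ "a + b - x" for x])
    have s': "a + b - s \<in> {a..b}" using s by auto
    have 1: "((\<lambda>s. a + b - s) has_vector_derivative -1) (at s within {a..b})"
      by (auto intro!: derivative_eq_intros simp: has_real_derivative_iff_has_vector_derivative[symmetric])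
    have "(v1 \<circ> (\<lambda>s. a + b - s) has_vector_derivative (-1) *\<^sub>R ((\<sigma> * q1 (a + b - s)) *\<^sub>R (C *v v1 (a + b - s)))) (at s within {a..b})"
      by (rule vector_diff_chain_within[OF 1]) (use Ad(2)[OF s'] im in simp)
    then show ?thesis by (simp add: w_def o_def)
  qed
  have Dd: "(D has_vector_derivative D' s) (at s within {a..b})" if s: "s \<in> {a..b}" for s
  proof -
    have "(D has_vector_derivative (- \<sigma> * q2 s) *\<^sub>R (C *v v2 s) - (- \<sigma> * q1 (a + b - s)) *\<^sub>R (C *v w s)) (at s within {a..b})"
      unfolding D_def by (rule has_vector_derivative_diff[OF Bd(2)[OF s] wd[OF s]])
    moreover have "(- \<sigma> * q2 s) *\<^sub>R (C *v v2 s) - (- \<sigma> * q1 (a + b - s)) *\<^sub>R (C *v w s) = D' s"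
      by (simp add: D'_def D_def dq_def matrix_vector_mult_diff_distrib algebra_simps)
    ultimately show ?thesis by simp
  qed
  have w1: "norm (w s) = 1" "norm (w s - e1) \<le> e" if s: "s \<in> {a..b}" for s
    using Ad(4)[of "a + b - s"] near(2)[of "a + b - s"] s by (auto simp: w_def)
  have Da: "D a = 0" using j by (simp add: D_def w_def)
  \<comment> \<open>A first crude bound: the term with \<open>q2\<close> is skew and drops out, and
    |dq| is at most \<open>l\<close>. It makes the feedback of \<open>D\<close> into its own second
    component negligible.\<close>
  have Dle: "norm (D s) \<le> l * l" if s: "s \<in> {a..b}" for s
  proof -
    have "norm (D s) \<le> norm (D a) + l * (s - a)"
    proof (rule norm_growth_le[where d=D'])
      show "(D has_vector_derivative D' r) (at r within {a..s})" if "r \<in> {a..s}" for r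
        using has_vector_derivative_within_subset[OF Dd[of r]] that s by auto
      fix r assume r: "r \<in> {a..s}"
      then have rr: "r \<in> {a..b}" using s by auto
      have "D r \<bullet> D' r = - \<sigma> * dq r * (D r \<bullet> (C *v w r))"
        by (simp add: D'_def C_def inner_add_right skew_inner_zero[OF compressed_Omega_skew[OF pQ]])
      also have "\<dots> \<le> \<bar>- \<sigma> * dq r * (D r \<bullet> (C *v w r))\<bar>" by simp
      also have "\<dots> = \<bar>dq r\<bar> * \<bar>D r \<bullet> (C *v w r)\<bar>" using \<sigma> by (simp add: abs_mult)
      also have "\<dots> \<le> l * (norm (D r) * 1)"
      proof (intro mult_mono dq(2)[OF rr])
        have "norm (C *v w r) \<le> 1" unfolding C_def using norm_compressed_Omega_vec_le[OF pQ, of "w r"] w1(1)[OF rr] by simp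
        then show "\<bar>D r \<bullet> (C *v w r)\<bar> \<le> norm (D r) * 1"
          using Cauchy_Schwarz_ineq2[of "D r" "C *v w r"] by (meson mult_left_mono norm_ge_zero order_trans)
      qed (use l0 in auto)
      finally show "D r \<bullet> D' r \<le> l * norm (D r)" by simp
    qed (use s l0 in auto)
    also have "\<dots> \<le> l * l" using Da s l l0 by (auto intro!: mult_left_mono)
    finally show ?thesis .
  qed
  \<comment> \<open>Integrating the leading rate
    \<open>\<eta> / 2 * (r2 - r1) * \<kappa> * (s - a)\<close> gives
    \<open>c * (s - a)\<^sup>2\<close>. The sign \<open>- \<sigma>\<close> of \<open>D'\<close>
    meets the one in \<open>dq\<close>, so \<sigma> disappears from the result.\<close>
  define c where "c = \<eta> / 4 * (r2 - r1) * \<kappa>"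
  have \<kappa>1: "\<bar>\<kappa>\<bar> \<le> 1" using abs_nth_le_norm[of "Q *v e3" 2] norm_orth_proj_vec_le[OF pQ, of e3] by (simp add: \<kappa>_def)
  have "norm ((D b $ 2 - c * (b - a)\<^sup>2) - (D a $ 2 - c * (a - a)\<^sup>2)) \<le> (40 * (e * l)) * (b - a)"
  proof (rule norm_diff_le_deriv_bound[where x="\<lambda>s. D s $ 2 - c * (s - a)\<^sup>2" and d="\<lambda>s. D' s $ 2 - 2 * c * (s - a)"])
    show "b \<in> {a..b}" using ab by simp
    fix s assume s: "s \<in> {a..b}"
    have "((\<lambda>s. c * (s - a)\<^sup>2) has_vector_derivative 2 * c * (s - a)) (at s within {a..b})"
      by (auto intro!: derivative_eq_intros simp: has_real_derivative_iff_has_vector_derivative[symmetric])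
    then show "((\<lambda>s. D s $ 2 - c * (s - a)\<^sup>2) has_vector_derivative D' s $ 2 - 2 * c * (s - a)) (at s within {a..b})"
      by (intro has_vector_derivative_diff has_vector_derivative_vec_nth[OF Dd[OF s]])
    have Cw: "\<bar>(C *v w s) $ 2 - \<kappa>\<bar> \<le> 2 * e"
      using abs_nth_le_norm[of "C *v w s - Q *v e3" 2] compressed_Omega_near_e1[OF pQ P(3) w1(2)[OF s]]
      by (simp add: \<kappa>_def C_def)
    have 1: "\<bar>q2 s * (C *v D s) $ 2\<bar> \<le> 2 * (e * l)"
      unfolding abs_mult
    proof (rule mult_mono)
      have "\<bar>(C *v D s) $ 2\<bar> \<le> norm (C *v D s)" by (rule abs_nth_le_norm)
      also have "\<dots> \<le> norm (D s)" unfolding C_def by (rule norm_compressed_Omega_vec_le[OF pQ])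
      also have "\<dots> \<le> e * l" using Dle[OF s] lle by linarith
      finally show "\<bar>(C *v D s) $ 2\<bar> \<le> e * l" .
    qed (use qb in \<open>auto simp: q2_def\<close>)
    have 2: "\<bar>dq s * ((C *v w s) $ 2 - \<kappa>)\<bar> \<le> l * (2 * e)"
      unfolding abs_mult using dq(2)[OF s] Cw l0 by (intro mult_mono) auto
    have 3: "\<bar>(dq s + \<eta> / 2 * \<sigma> * (r2 - r1) * (s - a)) * \<kappa>\<bar> \<le> (32 * e * l) * 1"
      unfolding abs_mult using dq(1)[OF s] \<kappa>1 el by (intro mult_mono) auto
    have \<sigma>\<sigma>: "\<sigma> * \<sigma> = 1" using \<sigma> by (metis abs_mult_self_eq mult.right_neutral)
    have "D' s $ 2 - 2 * c * (s - a) = - \<sigma> * (q2 s * (C *v D s) $ 2 + dq s * ((C *v w s) $ 2 - \<kappa>)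
      + (dq s + \<eta> / 2 * \<sigma> * (r2 - r1) * (s - a)) * \<kappa>) + (\<sigma> * \<sigma> - 1) * (\<eta> / 2 * (r2 - r1) * (s - a) * \<kappa>)"
      by (simp add: D'_def c_def field_simps)
    then have "D' s $ 2 - 2 * c * (s - a) = - \<sigma> * (q2 s * (C *v D s) $ 2 + dq s * ((C *v w s) $ 2 - \<kappa>)
      + (dq s + \<eta> / 2 * \<sigma> * (r2 - r1) * (s - a)) * \<kappa>)" using \<sigma>\<sigma> by simp
    then have "norm (D' s $ 2 - 2 * c * (s - a)) = \<bar>q2 s * (C *v D s) $ 2 + dq s * ((C *v w s) $ 2 - \<kappa>)
      + (dq s + \<eta> / 2 * \<sigma> * (r2 - r1) * (s - a)) * \<kappa>\<bar>" using \<sigma> by (simp only: real_norm_def abs_mult abs_minus_cancel mult_1)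
    also have "\<dots> \<le> 36 * (e * l)" using 1 2 3 by (simp add: mult_ac)
    finally show "norm (D' s $ 2 - 2 * c * (s - a)) \<le> 40 * (e * l)" using el by linarith
  qed
  then have "\<bar>D b $ 2 - c * l\<^sup>2\<bar> \<le> 40 * e * l * l" using Da l by simp
  moreover have "D b = v2 b - v1 a" by (simp add: D_def w_def)
  ultimately show ?thesis by (simp add: c_def \<kappa>_def power2_eq_square algebra_simps)
qed


section \<open>Bounds on the vector field\<close>

abbreviation "e31 \<equiv> matrix_unit 3 1"

lemma inner_e31: "X \<bullet> e31 = X $ 3 $ 1"
  by (simp add: inner_matrix sum_3 matrix_unit_def)

lemma norm_e31: "norm e31 = 1"
  by (simp add: norm_eq_sqrt_inner inner_e31) (simp add: matrix_unit_def)

definition comm_Omega :: "real^3^3 \<Rightarrow> real^3^3" where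
  "comm_Omega X = Omega ** X - X ** Omega"

lemma bounded_linear_comm_Omega: "bounded_linear comm_Omega"
  unfolding comm_Omega_def[abs_def]
  by (intro bounded_linear_sub bounded_bilinear.bounded_linear_left[OF bounded_bilinear_matrix_mult]
      bounded_bilinear.bounded_linear_right[OF bounded_bilinear_matrix_mult])

lemma norm_comm_Omega: "norm (comm_Omega X) \<le> 2 * norm X"
  unfolding comm_Omega_def by (rule norm_Omega_commutator_le)

definition q_den :: "real^3^3 \<Rightarrow> real" where "q_den X = inverse (sqrt (1 + X \<bullet> X))"
definition q_num :: "real \<Rightarrow> real^3^3 \<Rightarrow> real" where "q_num \<eta> X = 1 + \<eta> * tanh (X \<bullet> e31)"
definition q_num_d1 :: "real \<Rightarrow> real^3^3 \<Rightarrow> real" where "q_num_d1 \<eta> X = \<eta> * (1 - (tanh (X \<bullet> e31))\<^sup>2)"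
definition q_num_d2 :: "real \<Rightarrow> real^3^3 \<Rightarrow> real" where
  "q_num_d2 \<eta> X = - 2 * \<eta> * tanh (X \<bullet> e31) * (1 - (tanh (X \<bullet> e31))\<^sup>2)"

lemma q_den_pos: "0 < q_den X"
  unfolding q_den_def by (simp add: add_pos_nonneg)

lemma q_den_le_1: "q_den X \<le> 1"
  unfolding q_den_def by (rule inverse_le_1_iff[THEN iffD2]) simp

text \<open>The decay of the speed compensates the linear growth of the commutator. The global
  bounds below rest on pairing factors \<open>q_den X\<close> with factors of size
  \<open>norm X\<close>.\<close>

lemma q_den_norm_le_1: "q_den X * norm X \<le> 1"
proof -
  have "norm X \<le> sqrt (1 + X \<bullet> X)"
    unfolding norm_eq_sqrt_inner by simp
  moreover have "sqrt (1 + X \<bullet> X) > 0" by (simp add: add_pos_nonneg)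
  ultimately show ?thesis unfolding q_den_def by (simp add: field_simps)
qed

lemma q_den_deriv: "(q_den has_derivative (\<lambda>V. - ((q_den X)^3 * (X \<bullet> V)))) (at X)"
proof -
  have pos: "1 + X \<bullet> X > 0" by (simp add: add_pos_nonneg)
  have "((\<lambda>r. inverse (sqrt (1 + r))) has_real_derivative
      - ((inverse (sqrt (1 + X \<bullet> X)))^3 / 2)) (at (X \<bullet> X))"
  proof -
    have "((\<lambda>r. sqrt (1 + r)) has_real_derivative inverse (sqrt (1 + X \<bullet> X)) / 2 * 1) (at (X \<bullet> X))"
      by (rule DERIV_chain2[where f=sqrt and g="\<lambda>r. 1 + r"]) (use DERIV_real_sqrt[OF pos] in \<open>auto intro!: derivative_eq_intros\<close>)
    from DERIV_inverse'[OF this] pos show ?thesis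
      by (simp add: power3_eq_cube)
  qed
  moreover have "((\<lambda>X. X \<bullet> X) has_derivative (\<lambda>V. X \<bullet> V + V \<bullet> X)) (at X)"
    by (auto intro!: derivative_eq_intros)
  ultimately have "((\<lambda>X. inverse (sqrt (1 + X \<bullet> X))) has_derivative
     (\<lambda>V. (X \<bullet> V + V \<bullet> X) * - ((inverse (sqrt (1 + X \<bullet> X)))^3 / 2))) (at X)"
    by (rule DERIV_compose_FDERIV)
  then show ?thesis unfolding q_den_def[abs_def] by (simp add: inner_commute algebra_simps)
qed

lemma inner_e31_deriv: "((\<lambda>X. X \<bullet> e31) has_derivative (\<lambda>V. V \<bullet> e31)) (at X)"
  by (auto intro!: derivative_eq_intros)

lemma DERIV_tanh_real: "(tanh has_real_derivative 1 - (tanh x)\<^sup>2) (at (x :: real))"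
  using has_field_derivative_tanh[OF _ DERIV_ident, of x UNIV] by simp

lemma q_num_deriv: "(q_num \<eta> has_derivative (\<lambda>V. (V \<bullet> e31) * q_num_d1 \<eta> X)) (at X)"
proof -
  have "((\<lambda>x. 1 + \<eta> * tanh x) has_real_derivative q_num_d1 \<eta> X) (at (X \<bullet> e31))"
    unfolding q_num_d1_def using DERIV_cmult[OF DERIV_tanh_real] by (auto intro!: derivative_eq_intros)
  from DERIV_compose_FDERIV[OF this inner_e31_deriv] show ?thesis
    unfolding q_num_def[abs_def] .
qed

lemma q_num_d1_deriv: "(q_num_d1 \<eta> has_derivative (\<lambda>V. (V \<bullet> e31) * q_num_d2 \<eta> X)) (at X)"
proof -
  have "((\<lambda>x. \<eta> * (1 - (tanh x)\<^sup>2)) has_real_derivative q_num_d2 \<eta> X) (at (X \<bullet> e31))"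
    unfolding q_num_d2_def by (auto intro!: derivative_eq_intros DERIV_tanh_real)
  from DERIV_compose_FDERIV[OF this inner_e31_deriv] show ?thesis
    unfolding q_num_d1_def[abs_def] .
qed

lemma M_fam_alt: "M_fam \<eta> X = (q_num \<eta> X * q_den X) *\<^sub>R comm_Omega X"
  unfolding M_fam_def q_fam_def q_num_def q_den_def comm_Omega_def inner_e31
  by (simp add: power2_norm_eq_inner divide_inverse)

text \<open>The gradient of the speed is \<open>q_coef_entry \<eta> X *\<^sub>R e31 - q_coef_radial
  \<eta> X *\<^sub>R X\<close>. The suffix \<open>_diff\<close> marks derivatives in the direction
  \<open>V\<close>.\<close>

definition q_coef_entry where "q_coef_entry \<eta> X = q_num_d1 \<eta> X * q_den X"
definition q_coef_radial where "q_coef_radial \<eta> X = q_num \<eta> X * (q_den X)^3"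
definition q_prod where "q_prod \<eta> X = q_num \<eta> X * q_den X"

definition q_coef_entry_diff where "q_coef_entry_diff \<eta> X V = (V \<bullet> e31) * q_num_d2 \<eta> X * q_den X - q_num_d1 \<eta> X * ((q_den X)^3 * (X \<bullet> V))"
definition q_coef_radial_diff where "q_coef_radial_diff \<eta> X V = (V \<bullet> e31) * q_num_d1 \<eta> X * (q_den X)^3 - q_num \<eta> X * (3 * (q_den X)^5 * (X \<bullet> V))"
definition q_prod_diff where "q_prod_diff \<eta> X V = q_coef_entry \<eta> X * (V \<bullet> e31) - q_coef_radial \<eta> X * (X \<bullet> V)"

lemma q_coef_entry_deriv: "(q_coef_entry \<eta> has_derivative q_coef_entry_diff \<eta> X) (at X)"
  unfolding q_coef_entry_def[abs_def] q_coef_entry_diff_def[abs_def]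
  by (rule has_derivative_eq_rhs[OF has_derivative_mult[OF q_num_d1_deriv q_den_deriv]]) (simp add: fun_eq_iff algebra_simps)

lemma q_coef_radial_deriv: "(q_coef_radial \<eta> has_derivative q_coef_radial_diff \<eta> X) (at X)"
  unfolding q_coef_radial_def[abs_def] q_coef_radial_diff_def[abs_def]
  by (rule has_derivative_eq_rhs[OF has_derivative_mult[OF q_num_deriv has_derivative_power[OF q_den_deriv]]])
    (simp add: fun_eq_iff algebra_simps power2_eq_square eval_nat_numeral)

lemma q_prod_deriv: "(q_prod \<eta> has_derivative q_prod_diff \<eta> X) (at X)"
  unfolding q_prod_def[abs_def] q_prod_diff_def[abs_def] q_coef_entry_def q_coef_radial_def
  by (rule has_derivative_eq_rhs[OF has_derivative_mult[OF q_num_deriv q_den_deriv]]) (simp add: fun_eq_iff algebra_simps)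

definition comm_b :: "(real^3^3) \<Rightarrow>\<^sub>L (real^3^3)" where "comm_b = Blinfun comm_Omega"

lemma comm_b_apply [simp]: "blinfun_apply comm_b X = comm_Omega X"
  unfolding comm_b_def by (simp add: bounded_linear_Blinfun_apply bounded_linear_comm_Omega)

text \<open>Assembled from bounded bilinear operations on the space of bounded linear maps, so that
  \<open>DM \<eta>\<close> can itself be differentiated by product rules, as
  \<open>derivatives_bounded\<close> demands.\<close>

definition DM :: "real \<Rightarrow> real^3^3 \<Rightarrow> (real^3^3) \<Rightarrow>\<^sub>L (real^3^3)" where
  "DM \<eta> X = (blinfun_scaleR_left (comm_Omega X) o\<^sub>L
      (q_coef_entry \<eta> X *\<^sub>R blinfun_inner_right e31 - q_coef_radial \<eta> X *\<^sub>R blinfun_inner_right X)) + q_prod \<eta> X *\<^sub>R comm_b"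

definition D2M :: "real \<Rightarrow> real^3^3 \<Rightarrow> real^3^3 \<Rightarrow> (real^3^3) \<Rightarrow>\<^sub>L (real^3^3)" where
  "D2M \<eta> X V = ((blinfun_scaleR_left (comm_Omega X) o\<^sub>L
        (q_coef_entry_diff \<eta> X V *\<^sub>R blinfun_inner_right e31 - (q_coef_radial \<eta> X *\<^sub>R blinfun_inner_right V + q_coef_radial_diff \<eta> X V *\<^sub>R blinfun_inner_right X)))
     + (blinfun_scaleR_left (comm_Omega V) o\<^sub>L
        (q_coef_entry \<eta> X *\<^sub>R blinfun_inner_right e31 - q_coef_radial \<eta> X *\<^sub>R blinfun_inner_right X)))
     + q_prod_diff \<eta> X V *\<^sub>R comm_b"

lemma M_fam_deriv: "(M_fam \<eta> has_derivative blinfun_apply (DM \<eta> X)) (at X)"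
proof -
  have "((\<lambda>X. q_prod \<eta> X *\<^sub>R comm_Omega X) has_derivative
     (\<lambda>V. q_prod \<eta> X *\<^sub>R comm_Omega V + q_prod_diff \<eta> X V *\<^sub>R comm_Omega X)) (at X)"
    by (rule has_derivative_scaleR[OF q_prod_deriv bounded_linear_imp_has_derivative[OF bounded_linear_comm_Omega]])
  moreover have "(\<lambda>V. q_prod \<eta> X *\<^sub>R comm_Omega V + q_prod_diff \<eta> X V *\<^sub>R comm_Omega X) = blinfun_apply (DM \<eta> X)"
    by (rule ext) (simp add: DM_def q_prod_diff_def blinfun.add_left blinfun.diff_left blinfun.scaleR_left inner_commute algebra_simps)
  ultimately show ?thesis unfolding M_fam_alt[abs_def] q_prod_def by simp
qed

lemma DM_deriv: "(DM \<eta> has_derivative D2M \<eta> X) (at X)"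
proof -
  have A: "((\<lambda>X. blinfun_scaleR_left (comm_Omega X)) has_derivative (\<lambda>V. blinfun_scaleR_left (comm_Omega V))) (at X)"
    by (rule bounded_linear.has_derivative[OF bounded_linear_blinfun_scaleR_left
          bounded_linear_imp_has_derivative[OF bounded_linear_comm_Omega]])
  have B1: "((\<lambda>X. q_coef_entry \<eta> X *\<^sub>R blinfun_inner_right e31) has_derivative
      (\<lambda>V. q_coef_entry_diff \<eta> X V *\<^sub>R blinfun_inner_right e31)) (at X)"
    using has_derivative_scaleR[OF q_coef_entry_deriv has_derivative_const[of "blinfun_inner_right e31"]] by simp
  have B2: "((\<lambda>X. q_coef_radial \<eta> X *\<^sub>R blinfun_inner_right X) has_derivative
      (\<lambda>V. q_coef_radial \<eta> X *\<^sub>R blinfun_inner_right V + q_coef_radial_diff \<eta> X V *\<^sub>R blinfun_inner_right X)) (at X)"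
    by (rule has_derivative_scaleR[OF q_coef_radial_deriv bounded_linear_imp_has_derivative[OF bounded_linear_blinfun_inner_right]])
  have C: "((\<lambda>X. q_prod \<eta> X *\<^sub>R comm_b) has_derivative (\<lambda>V. q_prod_diff \<eta> X V *\<^sub>R comm_b)) (at X)"
    using has_derivative_scaleR[OF q_prod_deriv has_derivative_const[of comm_b]] by simp
  show ?thesis unfolding DM_def[abs_def] D2M_def[abs_def]
    by (rule has_derivative_add[OF bounded_bilinear.FDERIV[OF bounded_bilinear_blinfun_compose A has_derivative_diff[OF B1 B2]] C])
qed

context
  fixes \<eta> :: real
  assumes eta: "\<bar>\<eta>\<bar> = 1"
begin

lemma q_num_bounds: "\<bar>q_num \<eta> X\<bar> \<le> 2" "\<bar>q_num_d1 \<eta> X\<bar> \<le> 1" "\<bar>q_num_d2 \<eta> X\<bar> \<le> 2"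
proof -
  let ?t = "tanh (X \<bullet> e31)"
  have t: "\<bar>?t\<bar> \<le> 1" using tanh_real_bounds[of "X \<bullet> e31"] by auto
  have t2: "?t\<^sup>2 \<le> 1" using t by (simp add: abs_square_le_1)
  have "\<bar>\<eta> * ?t\<bar> \<le> 1" using t eta by (simp add: abs_mult)
  then show "\<bar>q_num \<eta> X\<bar> \<le> 2" unfolding q_num_def by linarith
  have s: "\<bar>1 - ?t\<^sup>2\<bar> \<le> 1" using t2 by simp
  then show "\<bar>q_num_d1 \<eta> X\<bar> \<le> 1" unfolding q_num_d1_def using eta by (simp add: abs_mult)
  have "\<bar>?t\<bar> * \<bar>1 - ?t\<^sup>2\<bar> \<le> 1 * 1" using t s by (intro mult_mono) auto
  then show "\<bar>q_num_d2 \<eta> X\<bar> \<le> 2" unfolding q_num_d2_def using eta by (simp add: abs_mult)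
qed

lemma s_bounds:
  shows "\<bar>q_coef_entry \<eta> X\<bar> \<le> q_den X" "\<bar>q_coef_radial \<eta> X\<bar> \<le> 2 * (q_den X)^3" "\<bar>q_prod \<eta> X\<bar> \<le> 2 * q_den X"
  unfolding q_coef_entry_def q_coef_radial_def q_prod_def
  using mult_right_mono[OF q_num_bounds(2), of "q_den X" X] mult_right_mono[OF q_num_bounds(1), of "q_den X" X]
    mult_right_mono[OF q_num_bounds(1), of "(q_den X)^3" X] q_den_pos[of X]
  by (simp_all add: abs_mult)

lemma abs_inner_e31: "\<bar>V \<bullet> e31\<bar> \<le> norm V"
  using Cauchy_Schwarz_ineq2[of V e31] by (simp add: norm_e31)

lemma abs_inner_qb: "\<bar>q_den X * (X \<bullet> V)\<bar> \<le> norm V"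
proof -
  have "\<bar>q_den X * (X \<bullet> V)\<bar> \<le> (q_den X * norm X) * norm V"
    using mult_left_mono[OF Cauchy_Schwarz_ineq2[of X V], of "q_den X"] q_den_pos[of X]
    by (simp add: abs_mult mult_ac)
  also have "\<dots> \<le> 1 * norm V" by (intro mult_right_mono q_den_norm_le_1) auto
  finally show ?thesis by simp
qed

lemma q_den_power_le: "(q_den X)^(Suc n) \<le> q_den X"
  using q_den_pos[of X] q_den_le_1[of X] by (simp add: power_le_one mult_left_le)

lemma q_coef_radial_inner_le: "\<bar>q_coef_radial \<eta> X * (X \<bullet> V)\<bar> \<le> 2 * q_den X * norm V"
proof -
  have "\<bar>q_coef_radial \<eta> X * (X \<bullet> V)\<bar> = \<bar>q_num \<eta> X\<bar> * (q_den X)^2 * \<bar>q_den X * (X \<bullet> V)\<bar>"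
    unfolding q_coef_radial_def using q_den_pos[of X] by (simp add: abs_mult power2_eq_square power3_eq_cube)
  also have "\<dots> \<le> 2 * q_den X * norm V"
    using q_den_power_le[of X 1] q_den_pos[of X]
    by (intro mult_mono q_num_bounds abs_inner_qb) (auto simp: numeral_2_eq_2)
  finally show ?thesis .
qed

lemma q_prod_diff_le: "\<bar>q_prod_diff \<eta> X V\<bar> \<le> 3 * q_den X * norm V"
proof -
  have "\<bar>q_coef_entry \<eta> X * (V \<bullet> e31)\<bar> \<le> q_den X * norm V"
    unfolding abs_mult using q_den_pos[of X] by (intro mult_mono s_bounds abs_inner_e31) auto
  then show ?thesis unfolding q_prod_diff_def using q_coef_radial_inner_le[of X V] by (simp add: abs_le_iff)
qed

lemma q_coef_entry_diff_le: "\<bar>q_coef_entry_diff \<eta> X V\<bar> \<le> 3 * q_den X * norm V"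
proof -
  have "\<bar>(V \<bullet> e31) * q_num_d2 \<eta> X * q_den X\<bar> \<le> norm V * 2 * q_den X"
    unfolding abs_mult using q_den_pos[of X] by (intro mult_mono q_num_bounds abs_inner_e31) auto
  moreover have "\<bar>q_num_d1 \<eta> X * ((q_den X)^3 * (X \<bullet> V))\<bar> \<le> 1 * q_den X * norm V"
  proof -
    have "\<bar>q_num_d1 \<eta> X * ((q_den X)^3 * (X \<bullet> V))\<bar> = \<bar>q_num_d1 \<eta> X\<bar> * (q_den X)^2 * \<bar>q_den X * (X \<bullet> V)\<bar>"
      using q_den_pos[of X] by (simp add: abs_mult power2_eq_square power3_eq_cube)
    also have "\<dots> \<le> 1 * q_den X * norm V"
      using q_den_power_le[of X 1] q_den_pos[of X]
      by (intro mult_mono q_num_bounds abs_inner_qb) (auto simp: numeral_2_eq_2)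
    finally show ?thesis .
  qed
  ultimately show ?thesis unfolding q_coef_entry_diff_def by (simp add: abs_le_iff algebra_simps)
qed

lemma q_coef_radial_diff_inner_le: "\<bar>q_coef_radial_diff \<eta> X V * (X \<bullet> W')\<bar> \<le> 7 * q_den X * norm V * norm W'"
proof -
  have 1: "\<bar>(V \<bullet> e31) * q_num_d1 \<eta> X * (q_den X)^2\<bar> \<le> norm V * 1 * q_den X"
    unfolding abs_mult using q_den_power_le[of X 1] q_den_pos[of X]
    by (intro mult_mono q_num_bounds abs_inner_e31) (auto simp: numeral_2_eq_2)
  have 2: "\<bar>q_num \<eta> X * (3 * (q_den X)^3 * (q_den X * (X \<bullet> V)))\<bar> \<le> 2 * (3 * q_den X * norm V)"
    unfolding abs_mult[of "q_num \<eta> X"] abs_mult[of "3 * (q_den X)^3"]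
    using q_den_power_le[of X 2] q_den_pos[of X]
    by (intro mult_mono q_num_bounds abs_inner_qb) (auto simp: numeral_3_eq_3 numeral_2_eq_2)
  have "\<bar>(V \<bullet> e31) * q_num_d1 \<eta> X * (q_den X)^2 - q_num \<eta> X * (3 * (q_den X)^3 * (q_den X * (X \<bullet> V)))\<bar>
     \<le> 7 * q_den X * norm V"
    using 1 2 by (simp add: abs_le_iff algebra_simps)
  then have "\<bar>(V \<bullet> e31) * q_num_d1 \<eta> X * (q_den X)^2 - q_num \<eta> X * (3 * (q_den X)^3 * (q_den X * (X \<bullet> V)))\<bar> * \<bar>q_den X * (X \<bullet> W')\<bar>
     \<le> (7 * q_den X * norm V) * norm W'"
    using q_den_pos[of X] by (intro mult_mono abs_inner_qb) auto
  moreover have "q_coef_radial_diff \<eta> X V * (X \<bullet> W') =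
    ((V \<bullet> e31) * q_num_d1 \<eta> X * (q_den X)^2 - q_num \<eta> X * (3 * (q_den X)^3 * (q_den X * (X \<bullet> V)))) * (q_den X * (X \<bullet> W'))"
    unfolding q_coef_radial_diff_def by (simp add: algebra_simps power2_eq_square eval_nat_numeral)
  ultimately show ?thesis by (simp only: abs_mult[symmetric])
qed

lemma norm_DM_le: "norm (blinfun_apply (DM \<eta> X) V) \<le> 10 * norm V"
proof -
  have 1: "blinfun_apply (DM \<eta> X) V = q_prod_diff \<eta> X V *\<^sub>R comm_Omega X + q_prod \<eta> X *\<^sub>R comm_Omega V"
    by (simp add: DM_def q_prod_diff_def blinfun.add_left blinfun.diff_left blinfun.scaleR_left inner_commute algebra_simps)
  have "norm (q_prod_diff \<eta> X V *\<^sub>R comm_Omega X) \<le> (3 * q_den X * norm V) * (2 * norm X)"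
    unfolding norm_scaleR using q_den_pos[of X] by (intro mult_mono q_prod_diff_le norm_comm_Omega) auto
  also have "\<dots> = 6 * norm V * (q_den X * norm X)" by simp
  also have "\<dots> \<le> 6 * norm V * 1" by (intro mult_left_mono q_den_norm_le_1) auto
  finally have 2: "norm (q_prod_diff \<eta> X V *\<^sub>R comm_Omega X) \<le> 6 * norm V" by simp
  have "norm (q_prod \<eta> X *\<^sub>R comm_Omega V) \<le> (2 * 1) * (2 * norm V)"
    unfolding norm_scaleR using s_bounds(3)[of X] q_den_le_1[of X] by (intro mult_mono norm_comm_Omega) auto
  then show ?thesis unfolding 1 using 2 norm_triangle_ineq[of "q_prod_diff \<eta> X V *\<^sub>R comm_Omega X" "q_prod \<eta> X *\<^sub>R comm_Omega V"]
    by linarith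
qed

lemma norm_D2M_le: "norm (blinfun_apply (D2M \<eta> X V) W') \<le> 36 * norm V * norm W'"
proof -
  \<comment> \<open>The second derivative of the speed. Its bound has the factor 3 + 2 + 7 = 12,
    doubled to 24 by the commutator; the two mixed terms add 6 each, which makes 36.\<close>
  let ?c = "q_coef_entry_diff \<eta> X V * (W' \<bullet> e31) - (q_coef_radial \<eta> X * (V \<bullet> W') + q_coef_radial_diff \<eta> X V * (X \<bullet> W'))"
  have 1: "blinfun_apply (D2M \<eta> X V) W' = ?c *\<^sub>R comm_Omega X + q_prod_diff \<eta> X W' *\<^sub>R comm_Omega V + q_prod_diff \<eta> X V *\<^sub>R comm_Omega W'"
    by (simp add: D2M_def q_prod_diff_def blinfun.add_left blinfun.diff_left blinfun.scaleR_left inner_commute algebra_simps)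
  let ?n = "norm V * norm W'"
  have "\<bar>q_coef_entry_diff \<eta> X V * (W' \<bullet> e31)\<bar> \<le> (3 * q_den X * norm V) * norm W'"
    unfolding abs_mult using q_den_pos[of X] by (intro mult_mono q_coef_entry_diff_le abs_inner_e31) auto
  moreover have "\<bar>q_coef_radial \<eta> X * (V \<bullet> W')\<bar> \<le> (2 * q_den X) * ?n"
    unfolding abs_mult
  proof (rule mult_mono)
    have "(q_den X)^3 \<le> q_den X" using q_den_power_le[of X 2] by (simp add: eval_nat_numeral)
    then show "\<bar>q_coef_radial \<eta> X\<bar> \<le> 2 * q_den X" using s_bounds(2)[of X] by linarith
  qed (use q_den_pos[of X] Cauchy_Schwarz_ineq2[of V W'] in auto)
  ultimately have "\<bar>?c\<bar> \<le> 12 * q_den X * ?n"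
    using q_coef_radial_diff_inner_le[of X V W'] by (simp add: abs_le_iff algebra_simps)
  then have "norm (?c *\<^sub>R comm_Omega X) \<le> (12 * q_den X * ?n) * (2 * norm X)"
    unfolding norm_scaleR using q_den_pos[of X] by (intro mult_mono norm_comm_Omega) auto
  also have "\<dots> = 24 * ?n * (q_den X * norm X)" by simp
  also have "\<dots> \<le> 24 * ?n * 1" by (intro mult_left_mono q_den_norm_le_1) auto
  finally have 2: "norm (?c *\<^sub>R comm_Omega X) \<le> 24 * ?n" by simp
  have 3: "norm (q_prod_diff \<eta> X A *\<^sub>R comm_Omega B) \<le> 6 * (norm A * norm B)" for A B
  proof -
    have "norm (q_prod_diff \<eta> X A *\<^sub>R comm_Omega B) \<le> (3 * 1 * norm A) * (2 * norm B)"
      unfolding norm_scaleR using q_den_pos[of X] q_den_le_1[of X] 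
      by (intro mult_mono order_trans[OF q_prod_diff_le] mult_right_mono norm_comm_Omega) auto
    then show ?thesis by simp
  qed
  show ?thesis unfolding 1
    using 2 3[of W' V] 3[of V W']
      norm_triangle_ineq[of "?c *\<^sub>R comm_Omega X + q_prod_diff \<eta> X W' *\<^sub>R comm_Omega V" "q_prod_diff \<eta> X V *\<^sub>R comm_Omega W'"]
      norm_triangle_ineq[of "?c *\<^sub>R comm_Omega X" "q_prod_diff \<eta> X W' *\<^sub>R comm_Omega V"]
    by (simp add: mult_ac)
qed

lemma norm_M_fam_le: "norm (M_fam \<eta> X) \<le> 4"
proof -
  have "norm (M_fam \<eta> X) \<le> (2 * q_den X) * (2 * norm X)"
    unfolding M_fam_alt norm_scaleR q_prod_def[symmetric] using q_den_pos[of X]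
    by (intro mult_mono s_bounds norm_comm_Omega) auto
  also have "\<dots> = 4 * (q_den X * norm X)" by simp
  also have "\<dots> \<le> 4 * 1" by (intro mult_left_mono q_den_norm_le_1) auto
  finally show ?thesis by simp
qed

lemma F_fam_lipschitz: "norm (F_fam j \<eta> t X - F_fam j \<eta> t Z) \<le> 12 * norm (X - Z)"
proof -
  have "norm (M_fam \<eta> X - M_fam \<eta> Z) \<le> 10 * norm (X - Z)"
  proof (rule differentiable_bound[where S=UNIV and f'="\<lambda>X. blinfun_apply (DM \<eta> X)"])
    show "onorm (blinfun_apply (DM \<eta> Y)) \<le> 10" for Y
      by (rule onorm_bound) (simp_all add: norm_DM_le)
  qed (use M_fam_deriv in \<open>auto intro: has_derivative_at_withinI\<close>)
  also have "\<dots> \<le> 12 * norm (X - Z)" by (intro mult_right_mono) auto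
  finally show ?thesis by (simp add: F_fam_def)
qed

lemma F_fam_bound: "hj j \<le> 1/512 \<Longrightarrow> norm (F_fam j \<eta> t X) \<le> 5"
proof -
  assume "hj j \<le> 1/512"
  then have "(hj j)^2 \<le> (1/512)^2" by (intro power_mono) auto
  then have "4 * (hj j)^2 \<le> 1" by (simp add: power2_eq_square)
  then show ?thesis unfolding F_fam_def
    using norm_triangle_ineq[of "M_fam \<eta> X" "R_fam j t"] norm_M_fam_le[of X] norm_R_fam_le[of j t]
    by linarith
qed

lemma F_fam_derivatives_bounded:
  assumes "hj j \<le> 1"
  shows "derivatives_bounded (F_fam j \<eta>) 1 123"
  unfolding derivatives_bounded_def
proof (intro exI ballI allI conjI)
  fix t :: real and X :: "real^3^3" assume t: "t \<in> {0..1}"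
  show "(F_fam j \<eta> t has_derivative blinfun_apply (DM \<eta> X)) (at X)"
    unfolding F_fam_def[abs_def] using has_derivative_add[OF M_fam_deriv has_derivative_const] by fastforce
  have bl: "blinfun_apply (Blinfun (D2M \<eta> X)) = D2M \<eta> X"
    by (rule bounded_linear_Blinfun_apply[OF has_derivative_bounded_linear[OF DM_deriv]])
  show "(DM \<eta> has_derivative blinfun_apply (Blinfun (D2M \<eta> X))) (at X)"
    unfolding bl by (rule DM_deriv)
  show "((\<lambda>s. F_fam j \<eta> s X) has_vector_derivative Rt_fam j t) (at t within {0..1})"
    unfolding F_fam_def[abs_def] using has_vector_derivative_add[OF has_vector_derivative_const R_fam_deriv] by fastforce
  show "(Rt_fam j has_vector_derivative Rtt_fam j t) (at t within {0..1})"
    by (rule Rt_fam_deriv)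
  \<comment> \<open>The time-dependent part of the field is independent of \<open>X\<close>, so the
    mixed derivative vanishes.\<close>
  show "((\<lambda>X. Rt_fam j t) has_derivative (\<lambda>V. 0)) (at X)" by simp
  show "bilinear_norm (\<lambda>V W. blinfun_apply (blinfun_apply (Blinfun (D2M \<eta> X)) V) W) \<le> 123"
    unfolding bilinear_norm_def bl
  proof (rule cSUP_least)
    have "(e31, e31) \<in> {p. norm (fst p) = 1 \<and> norm (snd p) = 1}" by (simp add: norm_e31)
    then show "{p :: (real^3^3) \<times> (real^3^3). norm (fst p) = 1 \<and> norm (snd p) = 1} \<noteq> {}" by blast
    show "norm (blinfun_apply (D2M \<eta> X (fst p)) (snd p)) \<le> 123"
      if "p \<in> {p. norm (fst p) = 1 \<and> norm (snd p) = 1}" for p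
      using norm_D2M_le[of X "fst p" "snd p"] that by simp
  qed
  show "norm (Rt_fam j t) \<le> 123" by (rule norm_Rt_fam_le[OF assms])
  show "norm (Rtt_fam j t) \<le> 123" by (rule norm_Rtt_fam_le)
  show "onorm (\<lambda>V :: real^3^3. 0 :: real^3^3) \<le> 123" by (simp add: onorm_zero)
qed

end

lemma continuous_on_F_fam: "continuous_on (S \<times> UNIV) (\<lambda>p. F_fam j \<eta> (fst p) (snd p))"
proof -
  have "continuous_on UNIV (M_fam \<eta>)"
    by (intro continuous_at_imp_continuous_on ballI has_derivative_continuous[OF M_fam_deriv])
  then have M: "continuous_on (S \<times> UNIV) (\<lambda>p. M_fam \<eta> (snd p))"
    by (rule continuous_on_compose2) (auto intro: continuous_intros)
  have "continuous_on UNIV (R_fam j)"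
    by (intro continuous_at_imp_continuous_on ballI has_vector_derivative_continuous[OF R_fam_deriv])
  then have R: "continuous_on (S \<times> UNIV) (\<lambda>p. R_fam j (fst p))"
    by (rule continuous_on_compose2) (auto intro: continuous_intros)
  show ?thesis unfolding F_fam_def by (intro continuous_on_add M R)
qed

text \<open>Each summand of the commutator has \<open>Y\<close> at one of its ends, where the
  complementary projection on that side annihilates it.\<close>

lemma M_fam_tangent:
  assumes "rank Y = 2"
  shows "M_fam \<eta> Y \<in> tangent_space TYPE(2) Y"
proof -
  obtain U :: "real^2^3" and S V where f: "low_rank_factors Y U S V"
    using low_rank_factors_exist[OF assms] by blast
  have Y: "Y = U ** S ** transpose V" and UU: "transpose U ** U = mat 1" and VV: "transpose V ** V = mat 1"
    using f by (auto simp: low_rank_factors_def orthonormal_cols_def)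
  have "U ** transpose U ** Y = U ** (transpose U ** U) ** S ** transpose V"
    unfolding Y by (simp add: matrix_mul_assoc)
  then have 1: "(mat 1 - U ** transpose U) ** Y = 0"
    by (simp add: mm_simps UU Y)
  have "Y ** (V ** transpose V) = U ** S ** (transpose V ** V) ** transpose V"
    unfolding Y by (simp add: matrix_mul_assoc)
  then have 2: "Y ** (mat 1 - V ** transpose V) = 0"
    by (simp add: mm_simps VV Y)
  have "P ** (Omega ** Y - Y ** Omega) ** Q = P ** Omega ** (Y ** Q) - (P ** Y) ** Omega ** Q" for P Q :: "real^3^3"
    by (simp only: mm_diff_left mm_diff_right matrix_mul_assoc)
  then have "(mat 1 - U ** transpose U) ** M_fam \<eta> Y ** (mat 1 - V ** transpose V) = 0"
    unfolding M_fam_def mm_scaleR_left mm_scaleR_right by (simp add: 1 2)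
  then show ?thesis unfolding tangent_space_def using f by blast
qed

lemma Y0_fam_retained: "retained_singular_values (Y0_fam j) (vector [1, (hj j)^3] :: real^2)"
proof -
  define U :: "real^2^3" where "U = (\<chi> i k. if (i = 1 \<and> k = 1) \<or> (i = 2 \<and> k = 2) then 1 else 0)"
  have o: "orthonormal_cols U"
    unfolding orthonormal_cols_def U_def
    by (simp add: vec_eq_iff matrix_matrix_mult_def transpose_def mat_def forall_2 sum_3)
  have "Y0_fam j = U ** (\<chi> i k. if i = k then (vector [1, (hj j)^3] :: real^2) $ i else 0) ** transpose U"
    unfolding U_def Y0_fam_def matrix_unit_def
    by (simp add: vec_eq_iff matrix_matrix_mult_def transpose_def forall_3 sum_2)
  moreover have "\<forall>i. (vector [1, (hj j)^3] :: real^2) $ i > 0"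
    by (simp add: forall_2)
  ultimately show ?thesis unfolding retained_singular_values_def using o by blast
qed

lemma Y0_fam_rank: "rank (Y0_fam j) = 2"
proof -
  obtain U V :: "real^2^3" where "orthonormal_cols U" "orthonormal_cols V"
    "Y0_fam j = U ** (\<chi> i k. if i = k then (vector [1, (hj j)^3] :: real^2) $ i else 0) ** transpose V"
    using Y0_fam_retained[of j] unfolding retained_singular_values_def by blast
  moreover have "invertible (\<chi> i k. if i = k then (vector [1, (hj j)^3] :: real^2) $ i else 0)"
    by (simp add: invertible_det_nz det_2)
  ultimately have "low_rank_factors (Y0_fam j) U (\<chi> i k. if i = k then (vector [1, (hj j)^3] :: real^2) $ i else 0) V"
    by (simp add: low_rank_factors_def)
  from low_rank_factors_rank[OF this] show ?thesis by simp
qed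


section \<open>Gain per step, and steps without forcing\<close>

text \<open>The second row of \<open>Omega\<close> vanishes, so an unprojected right factor keeps
  its second component. Hence neither the L substep nor the exact flow contributes a kick.\<close>

lemma phase_full_v2:
  assumes ph: "phase \<eta> e0 a b \<sigma> P (mat 1) X u v" and s: "s \<in> {a..b}"
  shows "v s $ 2 = v a $ 2"
proof -
  have "norm (v s $ 2 - v a $ 2) \<le> 0 * (s - a)"
  proof (rule norm_diff_le_deriv_bound[OF s, where x="\<lambda>s. v s $ 2" and d="\<lambda>_. 0"])
    fix r assume "r \<in> {a..b}"
    then have "(v has_vector_derivative (\<sigma> * q_fam \<eta> (X r)) *\<^sub>R (Omega *v v r)) (at r within {a..b})"
      using ph by (auto simp: phase_def)
    from has_vector_derivative_vec_nth[OF this, of 2]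
    show "((\<lambda>s. v s $ 2) has_vector_derivative 0) (at r within {a..b})" by (simp add: Omega_mult_vec)
  qed simp
  then show ?thesis by simp
qed

text \<open>Up to small components along the first axis and \<open>nu \<theta>\<close>, the vector
  \<open>m\<close> is plus or minus \<open>nup \<theta>\<close>; both expressions are even, so the
  sign does not matter.\<close>

lemma near_normal_entries:
  assumes m: "near_normal \<epsilon> m \<theta>" and \<epsilon>: "\<epsilon> \<le> 1/100"
  defines "C \<equiv> cos (pi * \<theta> / 4)" and "S \<equiv> sin (pi * \<theta> / 4)"
  shows "\<bar>(m $ 3)\<^sup>2 - C\<^sup>2\<bar> \<le> 4 * \<epsilon>" "\<bar>m $ 2 * m $ 3 + S * C\<bar> \<le> 4 * \<epsilon>"
proof -
  define b where "b = m \<bullet> nu \<theta>"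
  define c where "c = m \<bullet> nup \<theta>"
  have CS: "C\<^sup>2 + S\<^sup>2 = 1" by (simp add: C_def S_def)
  have bb: "b = m $ 2 * C + m $ 3 * S" and cc: "c = - (m $ 2 * S) + m $ 3 * C"
    by (simp_all add: b_def c_def inner_vec_def sum_3 C_def S_def)
  have "b * C - c * S = m $ 2 * (C\<^sup>2 + S\<^sup>2)" "b * S + c * C = m $ 3 * (C\<^sup>2 + S\<^sup>2)"
    unfolding bb cc by (simp_all add: algebra_simps power2_eq_square)
  then have m2: "m $ 2 = b * C - c * S" and m3: "m $ 3 = b * S + c * C" using CS by simp_all
  have m1: "\<bar>m $ 1\<bar> \<le> \<epsilon>" and be: "\<bar>b\<bar> \<le> \<epsilon>" and nm: "norm m = 1" using m by (auto simp: near_normal_def b_def)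
  have e0: "0 \<le> \<epsilon>" using m1 by linarith
  have sq: "x\<^sup>2 \<le> \<epsilon> / 100" if "\<bar>x\<bar> \<le> \<epsilon>" for x :: real
  proof -
    have "\<bar>x\<bar> * \<bar>x\<bar> \<le> \<epsilon> * (1/100)" using that \<epsilon> e0 by (intro mult_mono) auto
    then show ?thesis by (simp add: power2_eq_square)
  qed
  have "(m $ 1)\<^sup>2 + (m $ 2)\<^sup>2 + (m $ 3)\<^sup>2 = 1" using nm norm_sq_3[of m] by simp
  moreover have "(m $ 2)\<^sup>2 + (m $ 3)\<^sup>2 = (b\<^sup>2 + c\<^sup>2) * (C\<^sup>2 + S\<^sup>2)"
    unfolding m2 m3 by (simp add: algebra_simps power2_eq_square)
  ultimately have c2: "c\<^sup>2 = 1 - ((m $ 1)\<^sup>2 + b\<^sup>2)" using CS by simp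
  define d where "d = (m $ 1)\<^sup>2 + b\<^sup>2"
  have d: "0 \<le> d" "d \<le> \<epsilon> / 50" using sq[OF m1] sq[OF be] by (auto simp: d_def)
  have c1: "\<bar>c\<bar> \<le> 1" using c2 by (simp add: abs_square_le_1[symmetric])
  have Cb: "\<bar>C\<bar> \<le> 1" "\<bar>S\<bar> \<le> 1" by (simp_all add: C_def S_def)
  have C2: "0 \<le> C\<^sup>2" "C\<^sup>2 \<le> 1" "0 \<le> S\<^sup>2" "S\<^sup>2 \<le> 1" using CS by (auto simp: power2_eq_square) (smt (verit) zero_le_square)+
  have bc: "\<bar>b * c\<bar> \<le> \<epsilon>" using mult_mono[OF be c1] e0 by (simp add: abs_mult)
  have SC: "\<bar>S * C\<bar> \<le> 1" using mult_mono[OF Cb(2,1)] by (simp add: abs_mult)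
  have "(m $ 3)\<^sup>2 - C\<^sup>2 = b\<^sup>2 * S\<^sup>2 + 2 * ((b * c) * (S * C)) + (c\<^sup>2 - 1) * C\<^sup>2"
    unfolding m3 by (simp add: algebra_simps power2_eq_square)
  also have "c\<^sup>2 - 1 = - d" using c2 by (simp add: d_def)
  finally have e1: "(m $ 3)\<^sup>2 - C\<^sup>2 = b\<^sup>2 * S\<^sup>2 + 2 * ((b * c) * (S * C)) - d * C\<^sup>2" by simp
  have b2: "0 \<le> b\<^sup>2 * S\<^sup>2" "b\<^sup>2 * S\<^sup>2 \<le> \<epsilon> / 100" using mult_mono[OF sq[OF be] C2(4)] C2 e0 by auto
  have dC: "0 \<le> d * C\<^sup>2" "d * C\<^sup>2 \<le> \<epsilon> / 50" using mult_mono[OF d(2) C2(2)] C2 d e0 by auto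
  have t: "\<bar>(b * c) * (S * C)\<bar> \<le> \<epsilon>" using mult_mono[OF bc SC] e0 by (simp add: abs_mult)
  show "\<bar>(m $ 3)\<^sup>2 - C\<^sup>2\<bar> \<le> 4 * \<epsilon>" unfolding e1 using b2 dC t e0 by linarith
  have "m $ 2 * m $ 3 + S * C = b\<^sup>2 * (S * C) + (b * c) * (C\<^sup>2 - S\<^sup>2) + (1 - c\<^sup>2) * (S * C)"
    unfolding m2 m3 by (simp add: algebra_simps power2_eq_square)
  also have "1 - c\<^sup>2 = d" using c2 by (simp add: d_def)
  finally have e2: "m $ 2 * m $ 3 + S * C = b\<^sup>2 * (S * C) + (b * c) * (C\<^sup>2 - S\<^sup>2) + d * (S * C)" .
  have "\<bar>b\<^sup>2 * (S * C)\<bar> \<le> \<epsilon> / 100 * 1" unfolding abs_mult[of "b\<^sup>2"] using sq[OF be] SC e0 by (intro mult_mono) auto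
  moreover have "\<bar>(b * c) * (C\<^sup>2 - S\<^sup>2)\<bar> \<le> \<epsilon> * 1"
  proof -
    have "\<bar>C\<^sup>2 - S\<^sup>2\<bar> \<le> 1" using C2 by linarith
    then show ?thesis unfolding abs_mult[of "b * c"] using bc e0 by (intro mult_mono) auto
  qed
  moreover have "\<bar>d * (S * C)\<bar> \<le> \<epsilon> / 50 * 1" unfolding abs_mult[of d] using d SC e0 by (intro mult_mono) auto
  ultimately show "\<bar>m $ 2 * m $ 3 + S * C\<bar> \<le> 4 * \<epsilon>" unfolding e2 using e0 by linarith
qed

text \<open>Two half steps of length h/2 turn the factor 1/4 of \<open>adjacent_phases_turn\<close>
  into 1/16, and writing a product of sine and cosine by the double angle halves it again. The
  squared cosine is that of the left plane at the midpoint, the difference belongs to the right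
  planes at the two ends.\<close>

definition step_gain :: "real \<Rightarrow> real" where
  "step_gain \<theta> = (1/32) * (cos (pi * (\<theta> + 1/2) / 4))\<^sup>2 * (sin (pi * (\<theta> + 1) / 2) - sin (pi * \<theta> / 2))"

lemma strang_step_gain:
  assumes sp: "step_phases \<eta> j t \<epsilon> u0 v0 u' v'" and \<eta>: "\<bar>\<eta>\<bar> = 1"
    and u0: "norm (u0 - e1) \<le> \<epsilon>" and v0: "norm (v0 - e1) \<le> \<epsilon>" and h: "hj j \<le> \<epsilon>" and \<epsilon>: "\<epsilon> \<le> 1/2000"
    and th: "vartheta j t = \<theta>" "vartheta j (t + hj j / 2) = \<theta> + 1/2" "vartheta j (t + hj j) = \<theta> + 1"
  shows "\<bar>v' $ 2 - v0 $ 2 - \<eta> * (hj j)\<^sup>2 * step_gain \<theta>\<bar> \<le> 300 * \<epsilon> * (hj j)\<^sup>2"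
proof -
  define H where "H = hj j"
  \<comment> \<open>Over the five substeps the factors drift from \<epsilon> to
    \<open>7 * \<epsilon>\<close>; the value 11 covers this and the requirement
    \<open>5 * H^3 \<le> e * (H / 2)\<close>.\<close>
  define e where "e = 11 * \<epsilon>"
  have H: "0 < H" "H \<le> \<epsilon>" using h by (auto simp: H_def)
  obtain n0 m n1 X1 X2 X3 X4 X5 u1 u2 u3 u4 u5 v1 v2 v3 v4 v5 where
     n0: "near_normal \<epsilon> n0 \<theta>" and m: "near_normal \<epsilon> m (\<theta> + 1/2)" and n1: "near_normal \<epsilon> n1 (\<theta> + 1)"
     and p1: "phase \<eta> (5 * H^3) t (t + H / 2) 1 (mat 1) (normal_proj n0) X1 u1 v1"
     and p2: "phase \<eta> (5 * H^3) t (t + H / 2) (-1) (normal_proj m) (normal_proj n0) X2 u2 v2"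
     and p3: "phase \<eta> (5 * H^3) t (t + H) 1 (normal_proj m) (mat 1) X3 u3 v3"
     and p4: "phase \<eta> (5 * H^3) (t + H / 2) (t + H) (-1) (normal_proj m) (normal_proj n1) X4 u4 v4"
     and p5: "phase \<eta> (5 * H^3) (t + H / 2) (t + H) 1 (mat 1) (normal_proj n1) X5 u5 v5"
     and st: "u1 t = u0" "v1 t = v0" "u2 t = u1 (t + H / 2)" "v2 t = v1 (t + H / 2)"
     "u3 t = u2 (t + H / 2)" "v3 t = v2 (t + H / 2)"
     "u4 (t + H / 2) = u3 (t + H)" "v4 (t + H / 2) = v3 (t + H)"
     "u5 (t + H / 2) = u4 (t + H)" "v5 (t + H / 2) = v4 (t + H)"
     and fin: "u' = u5 (t + H)" "v' = v5 (t + H)"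
    using sp unfolding step_phases_def th H_def by blast
  have e\<epsilon>: "7 * \<epsilon> \<le> e" "\<epsilon> \<le> e" using H by (auto simp: e_def)
  have tri: "norm (y - e1) \<le> c + d" if "norm (x - e1) \<le> c" "norm (y - x) \<le> d" for x y :: "real^3" and c d
    using norm_triangle_ineq[of "y - x" "x - e1"] that by simp
  have one: "\<bar>1 :: real\<bar> = 1" "\<bar>- 1 :: real\<bar> = 1" by simp_all
  have b1: "norm (u1 s - e1) \<le> 2 * \<epsilon>" "norm (v1 s - e1) \<le> 2 * \<epsilon>" if "s \<in> {t..t + H/2}" for s
    using tri[OF u0, of "u1 s" \<epsilon>] tri[OF v0, of "v1 s" \<epsilon>] phase_drift[OF p1 _ _ _ one(1) \<eta>, of "t" s] that st H by auto
  have b2: "norm (u2 s - e1) \<le> 3 * \<epsilon>" "norm (v2 s - e1) \<le> 3 * \<epsilon>" if "s \<in> {t..t + H/2}" for s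
    using tri[OF b1(1)[of "t + H/2"], of "u2 s" \<epsilon>] tri[OF b1(2)[of "t + H/2"], of "v2 s" \<epsilon>] phase_drift[OF p2 _ _ _ one(2) \<eta>, of "t" s] that st H by auto
  have b3: "norm (u3 s - e1) \<le> 5 * \<epsilon>" "norm (v3 s - e1) \<le> 5 * \<epsilon>" if "s \<in> {t..t + H}" for s
    using tri[OF b2(1)[of "t + H/2"], of "u3 s" "2 * \<epsilon>"] tri[OF b2(2)[of "t + H/2"], of "v3 s" "2 * \<epsilon>"] phase_drift[OF p3 _ _ _ one(1) \<eta>, of "t" s] that st H by auto
  have b4: "norm (u4 s - e1) \<le> 6 * \<epsilon>" "norm (v4 s - e1) \<le> 6 * \<epsilon>" if "s \<in> {t + H/2..t + H}" for s
    using tri[OF b3(1)[of "t + H"], of "u4 s" \<epsilon>] tri[OF b3(2)[of "t + H"], of "v4 s" \<epsilon>] phase_drift[OF p4 _ _ _ one(2) \<eta>, of "t + H/2" s] that st H by auto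
  have b5: "norm (u5 s - e1) \<le> 7 * \<epsilon>" "norm (v5 s - e1) \<le> 7 * \<epsilon>" if "s \<in> {t + H/2..t + H}" for s
    using tri[OF b4(1)[of "t + H"], of "u5 s" \<epsilon>] tri[OF b4(2)[of "t + H"], of "v5 s" \<epsilon>] phase_drift[OF p5 _ _ _ one(1) \<eta>, of "t + H/2" s] that st H by auto
  have pe: "norm (normal_proj n *v e1 - e1) \<le> e" if "near_normal \<epsilon> n \<theta>'" for n \<theta>'
    using that e\<epsilon> by (simp add: normal_proj_vec near_normal_def)
  have nn3: "\<bar>n $ 3\<bar> \<le> 1" "\<bar>n $ 2\<bar> \<le> 1" if "near_normal \<epsilon> n \<theta>'" for n \<theta>'
    using abs_nth_le_norm[of n 3] abs_nth_le_norm[of n 2] that by (auto simp: near_normal_def)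
  define r where "r = (normal_proj m *v e3) $ 3"
  have r: "r = 1 - (m $ 3)\<^sup>2" by (simp add: r_def normal_proj_vec inner_axis power2_eq_square)
  have "(m $ 3)\<^sup>2 \<le> 1" using nn3[OF m] by (simp add: abs_square_le_1)
  then have r01: "0 \<le> r" "r \<le> 1" unfolding r by auto
  have \<kappa>: "(normal_proj n *v e3) $ 2 = - (n $ 2 * n $ 3)" for n
  proof -
    have "e3 $ 2 = 0" by (simp add: axis_def)
    then show ?thesis by (simp add: normal_proj_vec inner_axis)
  qed
  have one: "(mat 1 *v e3) $ 3 = 1" "norm (mat 1 *v e1 - e1) \<le> e" using e\<epsilon> H by (auto simp: axis_def e_def)
  have e100: "e \<le> 1/100" using \<epsilon> by (simp add: e_def)
  have e0: "5 * H^3 \<le> e * (H / 2)"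
  proof -
    have "H * H \<le> \<epsilon> * 1" using H \<epsilon> by (intro mult_mono) auto
    then have "(H * H) * (5 * H) \<le> \<epsilon> * (5 * H)" using H by (intro mult_right_mono) auto
    then have "5 * H^3 \<le> 5 * (\<epsilon> * H)" by (simp add: power3_eq_cube mult_ac)
    also have "\<dots> \<le> (11/2) * (\<epsilon> * H)" using H by (intro mult_right_mono) auto
    finally show ?thesis by (simp add: e_def)
  qed
  have le: "x \<le> 2 * \<epsilon> \<Longrightarrow> x \<le> e" "x \<le> 3 * \<epsilon> \<Longrightarrow> x \<le> e" "x \<le> 6 * \<epsilon> \<Longrightarrow> x \<le> e" "x \<le> 7 * \<epsilon> \<Longrightarrow> x \<le> e" for x
    using H by (auto simp: e_def)
  have TA: "\<bar>v2 (t + H/2) $ 2 - v1 t $ 2 - \<eta> / 4 * (r - 1) * (H/2)\<^sup>2 * (normal_proj n0 *v e3) $ 2\<bar> \<le> 40 * e * (H/2)\<^sup>2"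
    by (rule adjacent_phases_turn[OF p1 p2 st(3,4) _ _ _ _ \<eta> e100 e0 le(1)[OF b1(1)] le(1)[OF b1(2)] le(2)[OF b2(1)] le(2)[OF b2(2)]
      one(2) pe[OF m] pe[OF n0] one(1)[symmetric] r_def _ _ r01]) (use H e_def in auto)
  \<comment> \<open>The second junction has the order S, K, so \<open>adjacent_phases_turn\<close>
    applies with \<open>\<sigma> = -1\<close>.\<close>
  have p5': "phase \<eta> (5 * H^3) (t + H / 2) (t + H) (- (-1)) (mat 1) (normal_proj n1) X5 u5 v5" using p5 by simp
  have TB: "\<bar>v5 (t + H) $ 2 - v4 (t + H/2) $ 2 - \<eta> / 4 * (1 - r) * (H/2)\<^sup>2 * (normal_proj n1 *v e3) $ 2\<bar> \<le> 40 * e * (H/2)\<^sup>2"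
    by (rule adjacent_phases_turn[OF p4 p5' st(9,10) _ _ _ _ \<eta> e100 e0 le(3)[OF b4(1)] le(3)[OF b4(2)] le(4)[OF b5(1)] le(4)[OF b5(2)]
      pe[OF m] one(2) pe[OF n1] r_def one(1)[symmetric] r01]) (use H e_def in auto)
  have L: "v3 (t + H) $ 2 = v3 t $ 2" using phase_full_v2[OF p3, of "t + H"] H by simp
  \<comment> \<open>The left projections appear in opposite order at the two junctions, so the
    factors \<open>r - 1\<close> and \<open>1 - r\<close> turn the kicks into a difference between
    the two right planes.\<close>
  define M where "M = (m $ 3)\<^sup>2 * (n0 $ 2 * n0 $ 3 - n1 $ 2 * n1 $ 3)"
  have "\<bar>v' $ 2 - v0 $ 2 - \<eta> / 16 * H\<^sup>2 * M\<bar> \<le> 2 * (40 * e * (H/2)\<^sup>2)"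
  proof -
    have "v' $ 2 - v0 $ 2 - \<eta> / 16 * H\<^sup>2 * M
      = (v2 (t + H/2) $ 2 - v1 t $ 2 - \<eta> / 4 * (r - 1) * (H/2)\<^sup>2 * (normal_proj n0 *v e3) $ 2)
       + (v5 (t + H) $ 2 - v4 (t + H/2) $ 2 - \<eta> / 4 * (1 - r) * (H/2)\<^sup>2 * (normal_proj n1 *v e3) $ 2)"
      using L st fin unfolding \<kappa> r M_def by (simp add: algebra_simps power2_eq_square)
    then show ?thesis using TA TB by linarith
  qed
  then have 1: "\<bar>v' $ 2 - v0 $ 2 - \<eta> / 16 * H\<^sup>2 * M\<bar> \<le> 220 * (\<epsilon> * H\<^sup>2)" by (simp add: e_def power2_eq_square mult_ac)
  define C where "C = cos (pi * (\<theta> + 1/2) / 4)"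
  define s0 where "s0 = sin (pi * \<theta> / 4) * cos (pi * \<theta> / 4)"
  define s1 where "s1 = sin (pi * (\<theta> + 1) / 4) * cos (pi * (\<theta> + 1) / 4)"
  have \<epsilon>1: "\<epsilon> \<le> 1/100" using \<epsilon> by simp
  have E0: "\<bar>n0 $ 2 * n0 $ 3 + s0\<bar> \<le> 4 * \<epsilon>" unfolding s0_def by (rule near_normal_entries(2)[OF n0 \<epsilon>1])
  have E1: "\<bar>n1 $ 2 * n1 $ 3 + s1\<bar> \<le> 4 * \<epsilon>" unfolding s1_def by (rule near_normal_entries(2)[OF n1 \<epsilon>1])
  have Em: "\<bar>(m $ 3)\<^sup>2 - C\<^sup>2\<bar> \<le> 4 * \<epsilon>" unfolding C_def by (rule near_normal_entries(1)[OF m \<epsilon>1])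
  have "\<bar>M - C\<^sup>2 * (s1 - s0)\<bar> \<le> 16 * \<epsilon>"
  proof -
    have "M - C\<^sup>2 * (s1 - s0) = ((m $ 3)\<^sup>2 - C\<^sup>2) * (n0 $ 2 * n0 $ 3 - n1 $ 2 * n1 $ 3)
       + C\<^sup>2 * ((n0 $ 2 * n0 $ 3 + s0) - (n1 $ 2 * n1 $ 3 + s1))"
      by (simp add: M_def algebra_simps)
    moreover have "\<bar>((m $ 3)\<^sup>2 - C\<^sup>2) * (n0 $ 2 * n0 $ 3 - n1 $ 2 * n1 $ 3)\<bar> \<le> (4 * \<epsilon>) * 2"
      unfolding abs_mult[of "(m $ 3)\<^sup>2 - C\<^sup>2"]
    proof (rule mult_mono[OF Em])
      have "\<bar>n0 $ 2 * n0 $ 3\<bar> \<le> 1 * 1" "\<bar>n1 $ 2 * n1 $ 3\<bar> \<le> 1 * 1"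
        unfolding abs_mult by (intro mult_mono nn3[OF n0]; simp)+ (intro mult_mono nn3[OF n1]; simp)+
      then show "\<bar>n0 $ 2 * n0 $ 3 - n1 $ 2 * n1 $ 3\<bar> \<le> 2" by linarith
    qed (use H in auto)
    moreover have "\<bar>C\<^sup>2 * ((n0 $ 2 * n0 $ 3 + s0) - (n1 $ 2 * n1 $ 3 + s1))\<bar> \<le> 1 * (8 * \<epsilon>)"
      unfolding abs_mult[of "C\<^sup>2"] using E0 E1 by (intro mult_mono) (auto simp: C_def abs_square_le_1)
    ultimately show ?thesis by linarith
  qed
  then have "\<bar>\<eta> / 16 * H\<^sup>2 * (M - C\<^sup>2 * (s1 - s0))\<bar> \<le> 1 / 16 * H\<^sup>2 * (16 * \<epsilon>)"
    unfolding abs_mult using \<eta> by (intro mult_mono) auto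
  then have 2: "\<bar>\<eta> / 16 * H\<^sup>2 * (M - C\<^sup>2 * (s1 - s0))\<bar> \<le> \<epsilon> * H\<^sup>2" by (simp add: mult.commute)
  have ss: "sin (pi * \<theta> / 2) = 2 * s0" "sin (pi * (\<theta> + 1) / 2) = 2 * s1"
    using sin_double[of "pi * \<theta> / 4"] sin_double[of "pi * (\<theta> + 1) / 4"] by (simp_all add: s0_def s1_def)
  have sg: "step_gain \<theta> = (1/32) * C\<^sup>2 * (2 * s1 - 2 * s0)"
    unfolding step_gain_def ss C_def ..
  have g: "\<eta> * H\<^sup>2 * step_gain \<theta> = \<eta> / 16 * H\<^sup>2 * (C\<^sup>2 * (s1 - s0))"
    unfolding sg by (simp add: field_simps)
  have "v' $ 2 - v0 $ 2 - \<eta> * H\<^sup>2 * step_gain \<theta> = (v' $ 2 - v0 $ 2 - \<eta> / 16 * H\<^sup>2 * M) + \<eta> / 16 * H\<^sup>2 * (M - C\<^sup>2 * (s1 - s0))"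
    unfolding g by (simp add: algebra_simps)
  then have "\<bar>v' $ 2 - v0 $ 2 - \<eta> * H\<^sup>2 * step_gain \<theta>\<bar> \<le> 221 * (\<epsilon> * H\<^sup>2)" using 1 2 by linarith
  also have "\<dots> \<le> 300 * (\<epsilon> * H\<^sup>2)" using H by (intro mult_right_mono) auto
  finally show ?thesis by (simp add: H_def mult.assoc)
qed

lemma step_gain_periodic: "step_gain (x + 4) = step_gain x"
proof -
  have 1: "pi * (x + 4 + 1/2) / 4 = pi * (x + 1/2) / 4 + pi" "pi * (x + 4 + 1) / 2 = pi * (x + 1) / 2 + 2 * pi"
    "pi * (x + 4) / 2 = pi * x / 2 + 2 * pi"
    by (simp_all add: field_simps)
  show ?thesis unfolding step_gain_def 1 by (simp add: sin_periodic)
qed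

text \<open>Within a period the sine differences are 1, -1, -1, 1. The cosine weight is the larger
  one at both positive differences and the smaller one at both negative ones, so sqrt 2/32
  remains.\<close>

lemma sum_step_gain: "(\<Sum>k<4*j. step_gain (real k)) = real j * (sqrt 2 / 32)"
proof -
  have c2: "(cos x)\<^sup>2 = (1 + cos (2 * x)) / 2" for x :: real by (simp add: cos_double_cos)
  have period: "step_gain (real (4 * j + i)) = step_gain (real i)" for i j
  proof (induction j)
    case (Suc j)
    have "real (4 * Suc j + i) = real (4 * j + i) + 4" by simp
    then show ?case using Suc step_gain_periodic by metis
  qed simp
  have a: "cos (pi / 4) = sqrt 2 / 2" "cos (3 * pi / 4) = - (sqrt 2 / 2)" "cos (5 * pi / 4) = - (sqrt 2 / 2)"
    "cos (7 * pi / 4) = sqrt 2 / 2"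
  proof -
    show 45: "cos (pi / 4) = sqrt 2 / 2" by (rule cos_45)
    have "3 * pi / 4 = pi - pi / 4" "5 * pi / 4 = pi / 4 + pi" "7 * pi / 4 = 2 * pi - pi / 4" by simp_all
    then show "cos (3 * pi / 4) = - (sqrt 2 / 2)" "cos (5 * pi / 4) = - (sqrt 2 / 2)" "cos (7 * pi / 4) = sqrt 2 / 2"
      using 45 by (simp_all only: cos_pi_minus cos_periodic_pi cos_2pi_minus)
  qed
  have s: "sin (3 * pi / 2) = - 1" "sin (2 * pi) = 0"
    using sin_3over2_pi by (simp_all add: field_simps)
  have g: "step_gain 0 = (1/64) * (1 + sqrt 2 / 2)" "step_gain 1 = - (1/64) * (1 - sqrt 2 / 2)"
    "step_gain 2 = - (1/64) * (1 - sqrt 2 / 2)" "step_gain 3 = (1/64) * (1 + sqrt 2 / 2)"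
  proof -
    have e: "2 * (pi * (0 + 1/2) / 4) = pi / 4" "2 * (pi * (1 + 1/2) / 4) = 3 * pi / 4"
      "2 * (pi * (2 + 1/2) / 4) = 5 * pi / 4" "2 * (pi * (3 + 1/2) / 4) = 7 * pi / 4"
      "pi * (0 + 1) / 2 = pi / 2" "pi * (1 + 1) / 2 = pi" "pi * (2 + 1) / 2 = 3 * pi / 2" "pi * (3 + 1) / 2 = 2 * pi"
      "pi * 1 / 2 = pi / 2" "pi * 2 / 2 = pi" "pi * 3 / 2 = 3 * pi / 2" "pi * 0 / 2 = 0"
      by simp_all
    show "step_gain 0 = (1/64) * (1 + sqrt 2 / 2)" "step_gain 1 = - (1/64) * (1 - sqrt 2 / 2)"
      "step_gain 2 = - (1/64) * (1 - sqrt 2 / 2)" "step_gain 3 = (1/64) * (1 + sqrt 2 / 2)"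
      unfolding step_gain_def c2 e a s sin_pi_half sin_pi sin_zero by simp_all
  qed
  have four: "(\<Sum>i<4. step_gain (real i)) = sqrt 2 / 32"
  proof -
    have "(\<Sum>i<4. step_gain (real i)) = step_gain 0 + step_gain 1 + step_gain 2 + step_gain 3"
      by (simp add: eval_nat_numeral)
    then show ?thesis unfolding g by (simp add: field_simps)
  qed
  show ?thesis
  proof (induction j)
    case (Suc j)
    have split: "(\<Sum>k<m + 4. f k) = (\<Sum>k<m. f k) + (\<Sum>i<4. f (m + i))" for f :: "nat \<Rightarrow> real" and m
      by (simp add: eval_nat_numeral)
    have "4 * Suc j = 4 * j + 4" by simp
    then have "(\<Sum>k<4 * Suc j. step_gain (real k)) = (\<Sum>k<4 * j. step_gain (real k)) + (\<Sum>i<4. step_gain (real (4 * j + i)))"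
      by (simp only: split)
    also have "\<dots> = real j * (sqrt 2 / 32) + sqrt 2 / 32" unfolding Suc period four ..
    finally show ?case by (simp add: algebra_simps)
  qed simp
qed

text \<open>The left rotation cancels in the Gram matrix \<open>G\<close>, which then satisfies
  \<open>G' = c (B G - G B)\<close>: an evolution by conjugation, which preserves the
  determinant.\<close>

lemma gram_det_const:
  fixes Z :: "real \<Rightarrow> real^2^'m"
  assumes ab: "a \<le> b" and A: "transpose A = - A" and B: "transpose B = - B"
    and Z: "\<And>s. s \<in> {a..b} \<Longrightarrow> (Z has_vector_derivative c s *\<^sub>R (A ** Z s - Z s ** B)) (at s within {a..b})"
  shows "det (transpose (Z b) ** Z b) = det (transpose (Z a) ** Z a)"
proof -
  define G where "G = (\<lambda>s. transpose (Z s) ** Z s)"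
  define D where "D = (\<lambda>s. c s *\<^sub>R (B ** G s - G s ** B))"
  have Gd: "(G has_vector_derivative D s) (at s within {a..b})" if s: "s \<in> {a..b}" for s
  proof -
    have "(G has_vector_derivative transpose (Z s) ** (c s *\<^sub>R (A ** Z s - Z s ** B))
        + transpose (c s *\<^sub>R (A ** Z s - Z s ** B)) ** Z s) (at s within {a..b})"
      unfolding G_def
      by (rule bounded_bilinear.has_vector_derivative[OF bounded_bilinear_matrix_mult has_vector_derivative_transpose[OF Z[OF s]] Z[OF s]])
    moreover have "transpose (Z s) ** (c s *\<^sub>R (A ** Z s - Z s ** B))
        + transpose (c s *\<^sub>R (A ** Z s - Z s ** B)) ** Z s = D s"
      by (simp add: D_def G_def mm_simps transpose_scalar transpose_diff matrix_transpose_mul A B matrix_mul_assoc algebra_simps)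
    ultimately show ?thesis by simp
  qed
  have Bs: "B $ 1 $ 1 = 0" "B $ 2 $ 2 = 0" "B $ 2 $ 1 = - B $ 1 $ 2"
  proof -
    have *: "B $ k $ i = - B $ i $ k" for i k
      using arg_cong[OF B, of "\<lambda>M. M $ i $ k"] by (simp add: transpose_def)
    show "B $ 1 $ 1 = 0" "B $ 2 $ 2 = 0" using *[of 1 1] *[of 2 2] by linarith+
    show "B $ 2 $ 1 = - B $ 1 $ 2" by (rule *)
  qed
  have ent: "((\<lambda>s. G s $ i $ k) has_vector_derivative D s $ i $ k) (at s within {a..b})" if s: "s \<in> {a..b}" for s i k
    by (intro bounded_linear.has_vector_derivative[OF bounded_linear_vec_nth] Gd[OF s])
  have "norm (det (G b) - det (G a)) \<le> 0 * (b - a)"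
  proof (rule norm_diff_le_deriv_bound[where x="\<lambda>s. det (G s)" and d="\<lambda>_. 0"])
    fix s assume s: "s \<in> {a..b}"
    have e: "((\<lambda>s. G s $ i $ k) has_real_derivative D s $ i $ k) (at s within {a..b})" for i k
      using ent[OF s] by (simp add: has_real_derivative_iff_has_vector_derivative)
    have "((\<lambda>s. G s $ 1 $ 1 * G s $ 2 $ 2 - G s $ 1 $ 2 * G s $ 2 $ 1) has_real_derivative
      (D s $ 1 $ 1 * G s $ 2 $ 2 + D s $ 2 $ 2 * G s $ 1 $ 1)
       - (D s $ 1 $ 2 * G s $ 2 $ 1 + D s $ 2 $ 1 * G s $ 1 $ 2)) (at s within {a..b})"
      by (intro DERIV_diff DERIV_mult e)
    moreover have "(D s $ 1 $ 1 * G s $ 2 $ 2 + D s $ 2 $ 2 * G s $ 1 $ 1)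
       - (D s $ 1 $ 2 * G s $ 2 $ 1 + D s $ 2 $ 1 * G s $ 1 $ 2) = 0"
      unfolding D_def by (simp add: matrix_matrix_mult_def sum_2 Bs algebra_simps)
    ultimately show "((\<lambda>s. det (G s)) has_vector_derivative 0) (at s within {a..b})"
      unfolding det_2 by (simp add: has_real_derivative_iff_has_vector_derivative)
  qed (use ab in auto)
  then show ?thesis by (simp add: G_def)
qed

lemma gram_orthonormal:
  fixes U :: "real^2^3" and S :: "real^2^2"
  assumes "orthonormal_cols U"
  shows "det (transpose (U ** S) ** (U ** S)) = (det S)\<^sup>2"
proof -
  have "transpose (U ** S) ** (U ** S) = transpose S ** (transpose U ** U) ** S"
    by (simp add: matrix_transpose_mul matrix_mul_assoc)
  then show ?thesis using assms
    by (simp add: orthonormal_cols_def det_mul power2_eq_square)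
qed

lemma orthonormal_cols_cancel: "orthonormal_cols V \<Longrightarrow> A ** transpose V ** V = A"
  unfolding orthonormal_cols_def by (metis matrix_mul_assoc matrix_mul_rid)

lemma compression_skew: "transpose (transpose V ** Omega ** V) = - (transpose V ** Omega ** V)" for V :: "real^2^3"
  by (simp add: matrix_transpose_mul Omega_skew mm_simps matrix_mul_assoc)

text \<open>Serves the steps after the forcing has stopped, where directions are no longer tracked.
  Each substep preserves the Gram determinant of its factor and orthonormal factors do not change
  it, so the squared determinants of all cores agree with that of the initial one.\<close>

lemma strang_step_admissible_autonomous:
  fixes d :: "(3, 3, 2) strang_trace"
  assumes tr: "is_strang_trace (F_fam j \<eta>) t h Y d" and h: "h > 0"
    and R: "\<And>s. s \<in> {t..t+h} \<Longrightarrow> R_fam j s = 0"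
  shows "rank_admissible_trace t h d" "rank (strang_result d) = 2"
proof -
  note d = tr[unfolded is_strang_trace_def low_rank_factors_def qr_factors_def]
  have o: "orthonormal_cols (tr_U0 d)" "orthonormal_cols (tr_V0 d)" "orthonormal_cols (tr_U1 d)"
    "orthonormal_cols (tr_V1 d)" "orthonormal_cols (tr_U2 d)" using d by auto
  have K: "(det Se)\<^sup>2 = (det Ss)\<^sup>2" if ode: "ode_solution (K_field (F_fam j \<eta>) V) a b (U ** Ss) K"
    and ab: "t \<le> a" "a \<le> b" "b \<le> t + h" and V: "orthonormal_cols V" and U: "orthonormal_cols U"
    and U': "orthonormal_cols U'" and Ke: "K b = U' ** Se"
    for V U U' :: "real^2^3" and Ss Se :: "real^2^2" and K a b
  proof -
    have "det (transpose (K b) ** K b) = det (transpose (K a) ** K a)"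
    proof (rule gram_det_const[OF ab(2) Omega_skew compression_skew[of V], where c="\<lambda>s. q_fam \<eta> (K s ** transpose V)"])
      fix s assume s: "s \<in> {a..b}"
      then have "R_fam j s = 0" using R ab by auto
      then show "(K has_vector_derivative q_fam \<eta> (K s ** transpose V) *\<^sub>R (Omega ** K s - K s ** (transpose V ** Omega ** V))) (at s within {a..b})"
        using ode_solution_deriv[OF ode s]
        by (simp add: orthonormal_cols_cancel[OF V] K_field_def F_fam_def M_fam_def mm_simps matrix_mul_assoc)
    qed
    then show ?thesis using ode gram_orthonormal[OF U] gram_orthonormal[OF U'] Ke by (simp add: ode_solution_def)
  qed
  have S: "(det (S b))\<^sup>2 = (det Ss)\<^sup>2" if ode: "ode_solution (S_field (F_fam j \<eta>) U V) a b Ss S"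
    and ab: "t \<le> a" "a \<le> b" "b \<le> t + h" and V: "orthonormal_cols V" and U: "orthonormal_cols U"
    for V U :: "real^2^3" and Ss :: "real^2^2" and S a b
  proof -
    have UU: "transpose U ** U = mat 1" using U by (simp add: orthonormal_cols_def)
    have "det (transpose (S b) ** S b) = det (transpose (S a) ** S a)"
    proof (rule gram_det_const[OF ab(2) compression_skew[of U] compression_skew[of V], where c="\<lambda>s. - q_fam \<eta> (U ** S s ** transpose V)"])
      fix s assume s: "s \<in> {a..b}"
      then have "R_fam j s = 0" using R ab by auto
      then show "(S has_vector_derivative (- q_fam \<eta> (U ** S s ** transpose V)) *\<^sub>R (transpose U ** Omega ** U ** S s - S s ** (transpose V ** Omega ** V))) (at s within {a..b})"
        using ode_solution_deriv[OF ode s]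
        by (simp add: orthonormal_cols_cancel[OF V] S_field_def F_fam_def M_fam_def mm_simps matrix_mul_assoc UU)
    qed
    then show ?thesis using ode by (simp add: ode_solution_def det_mul power2_eq_square)
  qed
  have L: "(det Se)\<^sup>2 = (det Ss)\<^sup>2" if ode: "ode_solution (L_field (F_fam j \<eta>) U) t (t + h) (V ** Ss) K"
    and V: "orthonormal_cols V" and U: "orthonormal_cols U" and V': "orthonormal_cols V'" and Ke: "K (t + h) = V' ** Se"
    for V U V' :: "real^2^3" and Ss Se :: "real^2^2" and K
  proof -
    have UU: "transpose U ** U = mat 1" using U by (simp add: orthonormal_cols_def)
    have "det (transpose (K (t + h)) ** K (t + h)) = det (transpose (K t) ** K t)"
    proof (rule gram_det_const[OF _ Omega_skew compression_skew[of U], where c="\<lambda>s. q_fam \<eta> (U ** transpose (K s))"])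
      fix s assume s: "s \<in> {t..t+h}"
      show "(K has_vector_derivative q_fam \<eta> (U ** transpose (K s)) *\<^sub>R (Omega ** K s - K s ** (transpose U ** Omega ** U))) (at s within {t..t+h})"
        using ode_solution_deriv[OF ode s] R[OF s]
        by (simp add: orthonormal_cols_cancel[OF U] L_field_def F_fam_def M_fam_def mm_simps matrix_mul_assoc transpose_scalar transpose_diff matrix_transpose_mul Omega_skew)
    qed (use h in simp)
    then show ?thesis using ode gram_orthonormal[OF V] gram_orthonormal[OF V'] Ke by (simp add: ode_solution_def)
  qed
  have "det (tr_S0 d) \<noteq> 0" using d by (simp add: invertible_det_nz)
  moreover have "(det (tr_Sh1 d))\<^sup>2 = (det (tr_S0 d))\<^sup>2"
    by (rule K[of "tr_V0 d" t "t + h/2" "tr_U0 d" _ "tr_K1 d" "tr_U1 d"]) (use d h in auto)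
  moreover have "(det (tr_S1 d (t + h/2)))\<^sup>2 = (det (tr_Sh1 d))\<^sup>2"
    by (rule S[of "tr_U1 d" "tr_V0 d" t]) (use d h in auto)
  moreover have "(det (transpose (tr_Sh2 d)))\<^sup>2 = (det (transpose (tr_S1 d (t + h/2))))\<^sup>2"
    by (rule L[of "tr_U1 d" "tr_V0 d" _ "tr_L d" "tr_V1 d"]) (use d h in auto)
  moreover have "(det (tr_S2 d (t + h)))\<^sup>2 = (det (tr_Sh2 d))\<^sup>2"
    by (rule S[of "tr_U1 d" "tr_V1 d" "t + h/2"]) (use d h in auto)
  moreover have "(det (tr_Sp d))\<^sup>2 = (det (tr_S2 d (t + h)))\<^sup>2"
    by (rule K[of "tr_V1 d" "t + h/2" "t + h" "tr_U1 d" _ "tr_K2 d" "tr_U2 d"]) (use d h in auto)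
  ultimately have inv: "invertible (tr_Sh1 d)" "invertible (tr_S1 d (t + h/2))" "invertible (tr_Sh2 d)"
    "invertible (tr_S2 d (t + h))" "invertible (tr_Sp d)"
    by (auto simp: invertible_det_nz det_transpose)
  have rk: "rank (tr_K1 d (t + h/2)) = CARD(2)" "rank (tr_L d (t + h)) = CARD(2)" "rank (tr_K2 d (t + h)) = CARD(2)"
    using qr_factors_rank[of "tr_K1 d (t + h/2)" "tr_U1 d" "tr_Sh1 d"] qr_factors_rank[of "tr_L d (t + h)" "tr_V1 d" "transpose (tr_Sh2 d)"]
      qr_factors_rank[of "tr_K2 d (t + h)" "tr_U2 d" "tr_Sp d"] inv transpose_invertible tr
    unfolding is_strang_trace_def by auto
  show "rank_admissible_trace t h d"
    unfolding rank_admissible_trace_def using inv rk by simp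
  have "low_rank_factors (strang_result d) (tr_U2 d) (tr_Sp d) (tr_V1 d)"
    using o inv by (simp add: low_rank_factors_def strang_result_def)
  from low_rank_factors_rank[OF this] show "rank (strang_result d) = 2" by simp
qed

lemma R_fam_zero: "4 * (real j + 1) * hj j \<le> s \<Longrightarrow> R_fam j s = 0"
proof -
  assume s: "4 * (real j + 1) * hj j \<le> s"
  have "4 * real j * hj j < 4 * (real j + 1) * hj j" by (intro mult_strict_right_mono) auto
  then have "\<not> s \<le> 4 * real j * hj j" using s by linarith
  moreover have "psi1 (ramp j s) = 0" if "s \<le> 4 * (real j + 1) * hj j"
  proof -
    have "s = 4 * (real j + 1) * hj j" using s that by linarith
    then show ?thesis by simp
  qed
  ultimately have "vartheta_d 1 j s = 0" by (simp add: vartheta_d_def glue_def)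
  then show ?thesis by (simp add: R_fam_eq)
qed


section \<open>Runs of the integrator\<close>

text \<open>With 10000 < 2^14 and 10^8 < 2^27 the claim reduces to
  \<open>56 * j + 97 \<le> j * j\<close>. This is where the threshold 60 comes from.\<close>

lemma growth_budget:
  assumes "60 \<le> j"
  shows "10000 ^ (4 * j + 5) * hj j \<le> 1 / 10^8"
proof -
  have "14 * (4 * j + 5) + 27 \<le> j * j"
  proof -
    have "60 * j \<le> j * j" using assms by (intro mult_right_mono) auto
    moreover have "14 * (4 * j + 5) + 27 = 56 * j + 97" by simp
    ultimately show ?thesis using assms by linarith
  qed
  then have "(2::real) ^ (14 * (4 * j + 5) + 27) \<le> 2 ^ (j\<^sup>2)"
    by (intro power_increasing) (auto simp: power2_eq_square)
  moreover have "(10000::real) ^ (4 * j + 5) * 10^8 \<le> (2^14) ^ (4 * j + 5) * 2^27"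
    by (intro mult_mono power_mono) auto
  moreover have "((2::real)^14) ^ (4 * j + 5) * 2^27 = 2 ^ (14 * (4 * j + 5) + 27)"
    by (simp only: power_mult power_add)
  ultimately have "(10000::real) ^ (4 * j + 5) * 10^8 \<le> 2 ^ (j\<^sup>2)" by linarith
  then show ?thesis by (simp add: hj_def field_simps)
qed

text \<open>As 48 = 12 * 4, the time \<open>4 * real j * hj j\<close> is at most 1/12, so over this
  time the growth term in \<open>flow_phase\<close> costs at most one further h^3.\<close>

lemma transition_time_small:
  assumes "60 \<le> j"
  shows "48 * real j * hj j \<le> 1"
proof -
  have "real j \<le> 2 ^ j" using less_exp[of j] by (metis less_imp_le of_nat_le_iff of_nat_numeral of_nat_power)
  then have "48 * real j \<le> 64 * 2 ^ j" using of_nat_0_le_iff[of j] by linarith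
  also have "\<dots> = (2::real) ^ (6 + j)" by (simp add: power_add)
  also have "\<dots> \<le> 2 ^ (j\<^sup>2)"
  proof (rule power_increasing)
    have "60 * j \<le> j * j" using assms by (intro mult_right_mono) auto
    then show "6 + j \<le> j\<^sup>2" using assms unfolding power2_eq_square by linarith
  qed simp
  finally show ?thesis by (simp add: hj_def field_simps)
qed

lemma strang_result_rank:
  fixes d :: "(3, 3, 2) strang_trace"
  assumes "is_strang_trace F t h Y d" "rank_admissible_trace t h d"
  shows "rank (strang_result d) = 2"
proof -
  have "low_rank_factors (strang_result d) (tr_U2 d) (tr_Sp d) (tr_V1 d)"
    using assms unfolding is_strang_trace_def qr_factors_def rank_admissible_trace_def
    by (simp add: low_rank_factors_def strang_result_def)
  from low_rank_factors_rank[OF this] show ?thesis by simp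
qed

text \<open>The error constants may grow geometrically with the number of steps: \<open>h\<^sub>j\<close> decays faster than
  any geometric sequence in \<open>j\<close>, and the directions only have to be tracked for \<open>4j + 4\<close> steps.\<close>

definition tracked :: "real \<Rightarrow> nat \<Rightarrow> nat \<Rightarrow> real^3^3 \<Rightarrow> bool" where
  "tracked \<eta> j n Y \<longleftrightarrow> rank Y = 2 \<and> (n \<le> 4 * j + 4 \<longrightarrow> (\<exists>u v. norm u = 1 \<and> norm v = 1 \<and>
     norm (u - e1) \<le> 10000 ^ n * hj j \<and> norm (v - e1) \<le> 10000 ^ n * hj j \<and>
     norm (Y - outer u v - (hj j)^3 *\<^sub>R W (vartheta j (real n * hj j))) \<le> 10000 ^ n * hj j * (hj j)^3 \<and>
     (n \<le> 4 * j \<longrightarrow> \<bar>v $ 2 - \<eta> * (hj j)\<^sup>2 * (\<Sum>k<n. step_gain (real k))\<bar>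
        \<le> real n * (300 * (10000 ^ (4 * j + 5) * hj j) * (hj j)\<^sup>2))))"

lemma Y0_fam_decomp: "Y0_fam j = outer e1 e1 + (hj j)^3 *\<^sub>R W 0"
  by (simp add: Y0_fam_def W_outer vec_eq_iff forall_3 matrix_unit_def axis_def)

lemma vartheta_linear: "t \<le> 4 * real j * hj j \<Longrightarrow> vartheta j t = t / hj j"
  by (simp add: vartheta_def)

lemma tracked_0: "tracked \<eta> j 0 (Y0_fam j)"
proof -
  have v0: "vartheta j 0 = 0" by (simp add: vartheta_linear)
  have "norm (Y0_fam j - outer e1 e1 - (hj j)^3 *\<^sub>R W (vartheta j (real 0 * hj j))) \<le> 10000 ^ 0 * hj j * (hj j)^3"
    by (simp add: Y0_fam_decomp v0)
  moreover have "\<bar>e1 $ 2 - \<eta> * (hj j)\<^sup>2 * (\<Sum>k<0. step_gain (real k))\<bar>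
      \<le> real 0 * (300 * (10000 ^ (4 * j + 5) * hj j) * (hj j)\<^sup>2)"
    by (simp add: axis_def)
  moreover have "norm (e1 - e1) \<le> 10000 ^ 0 * hj j" by simp
  ultimately show ?thesis unfolding tracked_def using Y0_fam_rank norm_e1_e3(1) by blast
qed

text \<open>While the angle moves, the structure of a step is available; afterwards the forcing is
  zero and only the rank has to be preserved. The gain is followed up to step 4j, because there the
  angle is linear in time and takes the values required by \<open>strang_step_gain\<close>.\<close>

lemma tracked_trace:
  fixes d :: "(3, 3, 2) strang_trace"
  assumes j: "60 \<le> j" and \<eta>: "\<bar>\<eta>\<bar> = 1" and Y: "tracked \<eta> j n Y"
    and tr: "is_strang_trace (F_fam j \<eta>) (real n * hj j) (hj j) Y d"
  shows "rank_admissible_trace (real n * hj j) (hj j) d \<and> tracked \<eta> j (Suc n) (strang_result d)"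
proof (cases "n < 4 * j + 4")
  case True
  define t where "t = real n * hj j"
  define \<delta> where "\<delta> = 10000 ^ n * hj j"
  \<comment> \<open>One bound for the relative errors of all tracked steps, so that the errors of
    the gain add up linearly in \<open>n\<close>.\<close>
  define \<beta> where "\<beta> = 10000 ^ (4 * j + 5) * hj j"
  have \<beta>: "\<beta> \<le> 1 / 10^8" unfolding \<beta>_def by (rule growth_budget[OF j])
  have "(10000::real) ^ n * 10000 \<le> 10000 ^ (4 * j + 5)"
    using power_increasing[of "Suc n" "4 * j + 5" "10000::real"] True by simp
  then have "(10000 ^ n * 10000) * hj j \<le> \<beta>" unfolding \<beta>_def by (rule mult_right_mono) simp
  then have \<delta>\<beta>: "10000 * \<delta> \<le> \<beta>" by (simp add: \<delta>_def mult_ac)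
  have "1 * hj j \<le> \<delta>" unfolding \<delta>_def by (intro mult_right_mono one_le_power) auto
  then have h\<delta>: "hj j \<le> \<delta>" by simp
  then have \<delta>0: "0 \<le> \<delta>" using hj_nonneg[of j] by linarith
  have tS: "t + hj j = real (Suc n) * hj j" by (simp add: t_def algebra_simps)
  have dS: "10000 ^ Suc n * hj j = 10000 * \<delta>" by (simp add: \<delta>_def)
  obtain u v where uv: "norm u = 1" "norm v = 1" "norm (u - e1) \<le> \<delta>" "norm (v - e1) \<le> \<delta>"
    "norm (Y - outer u v - (hj j)^3 *\<^sub>R W (vartheta j t)) \<le> \<delta> * (hj j)^3"
    and v2: "n \<le> 4 * j \<Longrightarrow> \<bar>v $ 2 - \<eta> * (hj j)\<^sup>2 * (\<Sum>k<n. step_gain (real k))\<bar> \<le> real n * (300 * \<beta> * (hj j)\<^sup>2)"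
    using Y True unfolding tracked_def \<delta>_def t_def \<beta>_def by auto
  have "\<delta> \<le> 1 / 10^8" using \<delta>\<beta> \<beta> \<delta>0 by linarith
  from strang_step_structure[OF tr[folded t_def] \<eta> uv(1,3,2,4,5) h\<delta> this]
  obtain u' v' where adm: "rank_admissible_trace t (hj j) d"
    and sp: "step_phases \<eta> j t (10000 * \<delta>) u v u' v'" and uv': "norm u' = 1" "norm v' = 1"
       "norm (u' - e1) \<le> 10000 * \<delta>" "norm (v' - e1) \<le> 10000 * \<delta>"
       "norm (strang_result d - outer u' v' - (hj j)^3 *\<^sub>R W (vartheta j (t + hj j))) \<le> 10000 * \<delta> * (hj j)^3"
    by blast
  have gain: "\<bar>v' $ 2 - \<eta> * (hj j)\<^sup>2 * (\<Sum>k<Suc n. step_gain (real k))\<bar> \<le> real (Suc n) * (300 * \<beta> * (hj j)\<^sup>2)"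
    if "Suc n \<le> 4 * j"
  proof -
    have "real (Suc n) * hj j \<le> real (4 * j) * hj j" using that by (intro mult_right_mono) auto
    then have te: "t + hj j \<le> 4 * real j * hj j" unfolding tS by simp
    have th: "vartheta j t = real n" "vartheta j (t + hj j / 2) = real n + 1/2" "vartheta j (t + hj j) = real n + 1"
    proof -
      have l: "t \<le> 4 * real j * hj j" "t + hj j / 2 \<le> 4 * real j * hj j" using te hj_pos[of j] by linarith+
      show "vartheta j t = real n" "vartheta j (t + hj j / 2) = real n + 1/2" "vartheta j (t + hj j) = real n + 1"
        unfolding vartheta_linear[OF l(1)] vartheta_linear[OF l(2)] vartheta_linear[OF te]
        by (simp_all add: t_def field_simps)
    qed
    have e: "10000 * \<delta> \<le> 1 / 2000" "norm (u - e1) \<le> 10000 * \<delta>" "norm (v - e1) \<le> 10000 * \<delta>" "hj j \<le> 10000 * \<delta>"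
      using \<delta>\<beta> \<beta> uv(3,4) h\<delta> \<delta>0 by simp_all
    have "\<bar>v' $ 2 - v $ 2 - \<eta> * (hj j)\<^sup>2 * step_gain (real n)\<bar> \<le> 300 * (10000 * \<delta>) * (hj j)\<^sup>2"
      by (rule strang_step_gain[OF sp \<eta> e(2,3,4,1) th])
    also have "\<dots> \<le> 300 * \<beta> * (hj j)\<^sup>2" using \<delta>\<beta> by (intro mult_right_mono mult_left_mono) auto
    finally have g: "\<bar>v' $ 2 - v $ 2 - \<eta> * (hj j)\<^sup>2 * step_gain (real n)\<bar> \<le> 300 * \<beta> * (hj j)\<^sup>2" .
    have "v' $ 2 - \<eta> * (hj j)\<^sup>2 * (\<Sum>k<Suc n. step_gain (real k)) =
      (v $ 2 - \<eta> * (hj j)\<^sup>2 * (\<Sum>k<n. step_gain (real k))) + (v' $ 2 - v $ 2 - \<eta> * (hj j)\<^sup>2 * step_gain (real n))"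
      by (simp add: algebra_simps)
    moreover have "real (Suc n) * (300 * \<beta> * (hj j)\<^sup>2) = real n * (300 * \<beta> * (hj j)\<^sup>2) + 300 * \<beta> * (hj j)\<^sup>2"
      by (simp add: algebra_simps)
    ultimately show ?thesis using g v2 that by linarith
  qed
  have "tracked \<eta> j (Suc n) (strang_result d)"
    unfolding tracked_def dS \<beta>_def[symmetric] tS[symmetric]
    using strang_result_rank[OF tr[folded t_def] adm] uv' gain by blast
  then show ?thesis using adm by (simp add: t_def)
next
  case False
  have R: "R_fam j s = 0" if "s \<in> {real n * hj j..real n * hj j + hj j}" for s
  proof (rule R_fam_zero)
    have "real (4 * j + 4) * hj j \<le> real n * hj j" using False by (intro mult_right_mono) auto
    then show "4 * (real j + 1) * hj j \<le> s" using that by (simp add: algebra_simps)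
  qed
  have "rank_admissible_trace (real n * hj j) (hj j) d" "rank (strang_result d) = 2"
    using strang_step_admissible_autonomous[OF tr hj_pos R] by auto
  then show ?thesis using False by (simp add: tracked_def)
qed

lemma tracked_step:
  assumes j: "60 \<le> j" and \<eta>: "\<bar>\<eta>\<bar> = 1" and Y: "tracked \<eta> j n Y"
  shows "rank_admissible_step TYPE(2) (F_fam j \<eta>) (real n * hj j) (hj j) Y"
    and "strang_step TYPE(2) (F_fam j \<eta>) (real n * hj j) (hj j) Y Y' \<Longrightarrow> tracked \<eta> j (Suc n) Y'"
proof -
  have "\<exists>d :: (3, 3, 2) strang_trace. is_strang_trace (F_fam j \<eta>) (real n * hj j) (hj j) Y d"
  proof (rule strang_trace_exists[where L=12])
    show "rank Y = 2" using Y by (simp add: tracked_def)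
    show "norm (F_fam j \<eta> s X - F_fam j \<eta> s Z) \<le> 12 * norm (X - Z)" for s X Z
      by (rule F_fam_lipschitz[OF \<eta>])
  qed (use continuous_on_F_fam in auto)
  then show "rank_admissible_step TYPE(2) (F_fam j \<eta>) (real n * hj j) (hj j) Y"
    unfolding rank_admissible_step_def using tracked_trace[OF j \<eta> Y] by blast
  show "strang_step TYPE(2) (F_fam j \<eta>) (real n * hj j) (hj j) Y Y' \<Longrightarrow> tracked \<eta> j (Suc n) Y'"
    unfolding strang_step_def using tracked_trace[OF j \<eta> Y] by blast
qed

lemma tracked_run:
  assumes j: "60 \<le> j" and \<eta>: "\<bar>\<eta>\<bar> = 1"
    and run: "strang_run TYPE(2) (F_fam j \<eta>) 1 (hj j) (Y0_fam j) Y"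
  shows "real n * hj j \<le> 1 \<Longrightarrow> tracked \<eta> j n (Y n)"
proof (induction n)
  case 0
  then show ?case using run tracked_0 by (simp add: strang_run_def)
next
  case (Suc n)
  have "real n * hj j \<le> real (Suc n) * hj j" by (intro mult_right_mono) auto
  then have "tracked \<eta> j n (Y n)" using Suc.IH order_trans[OF _ Suc.prems] by blast
  moreover have "strang_step TYPE(2) (F_fam j \<eta>) (real n * hj j) (hj j) (Y n) (Y (Suc n))"
    using run Suc.prems by (simp add: strang_run_def)
  ultimately show ?case using tracked_step(2)[OF j \<eta>] by blast
qed

lemma strang_run_admissible:
  assumes j: "60 \<le> j" and \<eta>: "\<bar>\<eta>\<bar> = 1"
    and run: "strang_run TYPE(2) (F_fam j \<eta>) 1 (hj j) (Y0_fam j) Y"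
  shows "rank_admissible_run TYPE(2) (F_fam j \<eta>) 1 (hj j) Y"
  unfolding rank_admissible_run_def
proof (intro allI impI)
  fix n assume n: "real (Suc n) * hj j \<le> 1"
  have "real n * hj j \<le> real (Suc n) * hj j" by (intro mult_right_mono) auto
  then have "tracked \<eta> j n (Y n)" using tracked_run[OF j \<eta> run] order_trans[OF _ n] by blast
  then show "rank_admissible_step TYPE(2) (F_fam j \<eta>) (real n * hj j) (hj j) (Y n)"
    by (rule tracked_step(1)[OF j \<eta>])
qed

text \<open>A step is a relation, so a run is built by dependent choice, with \<open>tracked\<close>
  as the invariant that makes the next step possible. Beyond time 1 a run is unconstrained and any
  matrix will do.\<close>

lemma strang_run_exists:
  assumes j: "60 \<le> j" and \<eta>: "\<bar>\<eta>\<bar> = 1"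
  shows "\<exists>Y. strang_run TYPE(2) (F_fam j \<eta>) 1 (hj j) (Y0_fam j) Y"
proof -
  define P where "P = (\<lambda>n Y. (n = 0 \<longrightarrow> Y = Y0_fam j) \<and> (real n * hj j \<le> 1 \<longrightarrow> tracked \<eta> j n Y))"
  define Q where "Q = (\<lambda>n Y Y'. real (Suc n) * hj j \<le> 1 \<longrightarrow>
    strang_step TYPE(2) (F_fam j \<eta>) (real n * hj j) (hj j) Y Y')"
  have "\<exists>f. \<forall>n. P n (f n) \<and> Q n (f n) (f (Suc n))"
  proof (rule dependent_nat_choice)
    show "\<exists>Y. P 0 Y" using tracked_0 by (auto simp: P_def)
    fix Y n assume PY: "P n Y"
    show "\<exists>Y'. P (Suc n) Y' \<and> Q n Y Y'"
    proof (cases "real (Suc n) * hj j \<le> 1")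
      case True
      have "real n * hj j \<le> real (Suc n) * hj j" by (intro mult_right_mono) auto
      then have "real n * hj j \<le> 1" using True by (rule order_trans)
      then have t: "tracked \<eta> j n Y" using PY by (simp add: P_def)
      obtain d :: "(3, 3, 2) strang_trace" where "is_strang_trace (F_fam j \<eta>) (real n * hj j) (hj j) Y d"
        using tracked_step(1)[OF j \<eta> t] unfolding rank_admissible_step_def by blast
      then have "strang_step TYPE(2) (F_fam j \<eta>) (real n * hj j) (hj j) Y (strang_result d)"
        unfolding strang_step_def by blast
      moreover from this have "tracked \<eta> j (Suc n) (strang_result d)" by (rule tracked_step(2)[OF j \<eta> t])
      ultimately show ?thesis unfolding P_def Q_def by blast
    next
      case False
      then show ?thesis unfolding P_def Q_def by auto
    qed
  qed
  then show ?thesis unfolding P_def Q_def strang_run_def by blast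
qed

text \<open>The exact flow is itself a phase whose projections are both the identity, so its right
  factor keeps second component 0 and only the remainder of order h^3 reaches this entry.\<close>

lemma exact_solution_entry:
  assumes j: "60 \<le> j" and \<eta>: "\<bar>\<eta>\<bar> = 1" and A: "ode_solution (F_fam j \<eta>) 0 1 (Y0_fam j) A"
  shows "\<bar>A (4 * real j * hj j) $ 1 $ 2\<bar> \<le> 4 * (hj j)^3"
proof -
  define T where "T = 4 * real j * hj j"
  have T: "0 \<le> T" "12 * T \<le> 1" using transition_time_small[OF j] by (auto simp: T_def)
  have A0: "A 0 = Y0_fam j" using A by (simp add: ode_solution_def)
  have Ad: "(A has_vector_derivative 1 *\<^sub>R (q_fam \<eta> (A s) *\<^sub>R (compressed_Omega (mat 1) ** A s
      - A s ** compressed_Omega (mat 1)) + mat 1 ** R_fam j s ** mat 1)) (at s within {0..T})"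
    if s: "s \<in> {0..T}" for s
    using has_vector_derivative_within_subset[OF ode_solution_deriv[OF A], of s "{0..T}"] s T
    by (simp add: F_fam_def M_fam_def)
  have e': "0 + (hj j)^3 * (12 * (T - 0)) + 3 * (hj j)^3 \<le> 4 * (hj j)^3"
    using mult_left_mono[OF T(2), of "(hj j)^3"] by simp
  have init: "norm (A 0 - outer e1 e1 - (hj j)^3 *\<^sub>R W 0) \<le> 0" by (simp add: A0 Y0_fam_decomp)
  have Z0: "norm ((hj j)^3 *\<^sub>R W 0) \<le> (hj j)^3" by simp
  have one: "\<bar>1::real\<bar> = 1" by simp
  have "\<exists>u v. phase \<eta> (4 * (hj j)^3) 0 T 1 (mat 1) (mat 1) A u v \<and> u 0 = e1 \<and> v 0 = e1"
    by (rule flow_phase[OF T(1) orth_proj_mat_1 orth_proj_mat_1 one \<eta> Ad norm_e1_e3(1) norm_e1_e3(1) Z0 init e']) blast+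
  then obtain u v where ph: "phase \<eta> (4 * (hj j)^3) 0 T 1 (mat 1) (mat 1) A u v" and uv: "u 0 = e1" "v 0 = e1"
    by blast
  have v2: "v T $ 2 = 0" using phase_full_v2[OF ph, of T] T uv by (simp add: axis_def)
  have "norm (A T - outer (u T) (v T)) \<le> 4 * (hj j)^3" using ph T by (simp add: phase_def)
  then have "\<bar>(A T - outer (u T) (v T)) $ 1 $ 2\<bar> \<le> 4 * (hj j)^3"
    using norm_matrix_entry_le order_trans by blast
  then show ?thesis using v2 by (simp add: T_def)
qed

text \<open>The errors are compared in the entry (1,2): the first row of \<open>W\<close> vanishes,
  so there the iterate is \<open>u $ 1 * v $ 2\<close> up to h^3, about
  \<open>sqrt 2 / 32 * real j * (hj j)\<^sup>2\<close>. Claiming half of this leaves room for all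
  errors.\<close>

lemma strang_error_lower_bound:
  assumes j: "60 \<le> j" and run: "strang_run TYPE(2) (F_fam j 1) 1 (hj j) (Y0_fam j) Y"
    and A: "ode_solution (F_fam j 1) 0 1 (Y0_fam j) A"
  shows "sqrt 2 / 64 * real j * (hj j)\<^sup>2 \<le> norm (Y (4 * j) - A (4 * real j * hj j))"
proof -
  define \<beta> where "\<beta> = 10000 ^ (4 * j + 5) * hj j"
  define h2 where "h2 = (hj j)\<^sup>2"
  define J where "J = real j"
  have J: "J \<ge> 60" using j by (simp add: J_def)
  have h2: "h2 > 0" by (simp add: h2_def)
  have \<beta>: "\<beta> \<le> 1 / 10^8" "0 \<le> \<beta>" using growth_budget[OF j] by (simp_all add: \<beta>_def)
  have h: "hj j \<le> 1/512" using hj_le j by simp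
  have h3: "(hj j)^3 = h2 * hj j" by (simp add: h2_def power3_eq_cube power2_eq_square)
  have "real (4 * j) * hj j \<le> 1" using transition_time_small[OF j] hj_nonneg[of j] by simp
  then have "tracked 1 j (4 * j) (Y (4 * j))" using tracked_run[OF j _ run, of "4 * j"] by simp
  then obtain u v where uv: "norm u = 1" "norm (u - e1) \<le> 10000 ^ (4 * j) * hj j"
    "norm (Y (4 * j) - outer u v - (hj j)^3 *\<^sub>R W (vartheta j (real (4 * j) * hj j))) \<le> 10000 ^ (4 * j) * hj j * (hj j)^3"
    and v2: "\<bar>v $ 2 - 1 * h2 * (\<Sum>k<4 * j. step_gain (real k))\<bar> \<le> real (4 * j) * (300 * \<beta> * h2)"
    unfolding tracked_def \<beta>_def h2_def by auto
  have "(10000::real) ^ (4 * j) * hj j \<le> \<beta>" unfolding \<beta>_def by (intro mult_right_mono power_increasing) auto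
  then have u1: "u $ 1 \<ge> 99/100" and E: "norm (Y (4 * j) - outer u v - (hj j)^3 *\<^sub>R W (vartheta j (real (4 * j) * hj j))) \<le> 1 * (hj j)^3"
  proof -
    assume le: "(10000::real) ^ (4 * j) * hj j \<le> \<beta>"
    have "\<bar>(u - e1) $ 1\<bar> \<le> norm (u - e1)" by (rule abs_nth_le_norm)
    then have "\<bar>u $ 1 - 1\<bar> \<le> 1 / 10^8" using uv(2) le \<beta> by (simp add: axis_def)
    moreover have "(1::real) / 10^8 \<le> 1 / 100" by simp
    ultimately show "u $ 1 \<ge> 99/100" by linarith
    have "10000 ^ (4 * j) * hj j * (hj j)^3 \<le> 1 * (hj j)^3" using le \<beta> by (intro mult_right_mono) auto
    then show "norm (Y (4 * j) - outer u v - (hj j)^3 *\<^sub>R W (vartheta j (real (4 * j) * hj j))) \<le> 1 * (hj j)^3"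
      using uv(3) by linarith
  qed
  have s2: "1.41 \<le> sqrt 2" by (rule real_le_rsqrt) (simp add: power2_eq_square)
  have "v $ 2 \<ge> h2 * (J * (sqrt 2 / 32)) - 4 * J * (300 * \<beta> * h2)"
    using v2 unfolding sum_step_gain by (simp add: J_def abs_le_iff)
  also have "h2 * (J * (sqrt 2 / 32)) - 4 * J * (300 * \<beta> * h2) = (h2 * J) * (sqrt 2 / 32 - 1200 * \<beta>)"
    by (simp add: algebra_simps)
  \<comment> \<open>Here 1.41/32 exceeds 0.04406, and \<open>1200 * \<beta>\<close> is at most
    0.000012.\<close>
  also have "\<dots> \<ge> (h2 * J) * (44/1000)"
    using h2 J s2 \<beta> by (intro mult_left_mono) auto
  finally have vb: "v $ 2 \<ge> (h2 * J) * (44/1000)" .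
  have hJ: "0 \<le> h2 * J" using h2 J by simp
  have "99/100 * ((h2 * J) * (44/1000)) \<le> u $ 1 * v $ 2" using u1 vb hJ by (intro mult_mono) auto
  moreover have "\<bar>(Y (4 * j) - outer u v - (hj j)^3 *\<^sub>R W (vartheta j (real (4 * j) * hj j))) $ 1 $ 2\<bar> \<le> 1 * (hj j)^3"
    using norm_matrix_entry_le E order_trans by blast
  then have "\<bar>Y (4 * j) $ 1 $ 2 - u $ 1 * v $ 2\<bar> \<le> h2 * hj j"
    by (simp add: W_outer h3)
  moreover have "\<bar>A (4 * real j * hj j) $ 1 $ 2\<bar> \<le> 4 * (h2 * hj j)"
    using exact_solution_entry[OF j _ A] by (simp add: h3)
  moreover have "h2 * hj j \<le> (h2 * J) * (1/512)"
  proof -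
    have "h2 * hj j \<le> h2 * (J * (1/512))" using h J h2 by (intro mult_left_mono) auto
    then show ?thesis by simp
  qed
  moreover have "sqrt 2 / 64 * real j * (hj j)\<^sup>2 \<le> (h2 * J) * (142/6400)"
  proof -
    have "(h2 * J) * (sqrt 2 / 64) \<le> (h2 * J) * (142/6400)" using hJ sqrt_2_le by (intro mult_left_mono) auto
    then show ?thesis by (simp add: h2_def J_def mult_ac)
  qed
  ultimately have "sqrt 2 / 64 * real j * (hj j)\<^sup>2 \<le> \<bar>Y (4 * j) $ 1 $ 2 - A (4 * real j * hj j) $ 1 $ 2\<bar>"
    using hJ by linarith
  then have "sqrt 2 / 64 * real j * (hj j)\<^sup>2 \<le> \<bar>(Y (4 * j) - A (4 * real j * hj j)) $ 1 $ 2\<bar>" by simp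
  also have "\<dots> \<le> norm (Y (4 * j) - A (4 * real j * hj j))" by (rule norm_matrix_entry_le)
  finally show ?thesis .
qed

section \<open>Membership in the problem class and failure of the robust bound\<close>

lemma F_fam_ode_solution_exists:
  assumes "\<bar>\<eta>\<bar> = 1"
  shows "\<exists>A. ode_solution (F_fam j \<eta>) 0 1 (Y0_fam j) A"
  by (rule ode_solution_exists[where L=12]) (simp_all add: continuous_on_F_fam F_fam_lipschitz[OF assms])

lemma fixed_rank_2: "Y \<in> fixed_rank TYPE(2) \<longleftrightarrow> rank Y = 2"
  by (simp add: fixed_rank_def)

lemma eps_fam_nonneg: "0 \<le> eps_fam j"
  using norm_R_fam_le_eps[of j 0] norm_ge_zero order_trans by blast

lemma F_fam_problem_class:
  assumes "3 \<le> j" "\<bar>\<eta>\<bar> = 1"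
  shows "problem_class TYPE(2) 5 12 1 123 (F_fam j \<eta>) (Y0_fam j) (Y0_fam j) 0 (eps_fam j)"
proof -
  have h: "hj j \<le> 1/512" by (rule hj_le[OF assms(1)])
  then have "\<exists>M R. \<forall>t\<in>{0..1}. \<forall>Y\<in>fixed_rank TYPE(2). F_fam j \<eta> t Y = M t Y + R t Y \<and>
        M t Y \<in> tangent_space TYPE(2) Y \<and> norm (M t Y) \<le> 5 \<and> norm (R t Y) \<le> eps_fam j"
    using M_fam_tangent[of _ \<eta>] norm_M_fam_le[OF assms(2)] norm_R_fam_le_eps[of j]
    by (intro exI[of _ "\<lambda>t. M_fam \<eta>"] exI[of _ "\<lambda>t Y. R_fam j t"])
      (auto simp: F_fam_def fixed_rank_2 intro: order_trans[of _ 4])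
  then show ?thesis unfolding problem_class_def
    using F_fam_bound[OF assms(2) h] F_fam_lipschitz[OF assms(2)] F_fam_derivatives_bounded[OF assms(2), of j] h
      Y0_fam_rank eps_fam_nonneg by (simp add: fixed_rank_2)
qed

text \<open>A positive stepsize leaves only finitely many grid points up to \<open>T\<close>, so
  \<open>Max\<close> really dominates each of the errors.\<close>

lemma max_grid_error_ge:
  assumes "h > 0" "real n * h \<le> T"
  shows "norm (Y n - A (real n * h)) \<le> max_grid_error T h Y A"
proof -
  have "{n. real n * h \<le> T} \<subseteq> {..nat \<lceil>T / h\<rceil>}"
  proof
    fix k assume "k \<in> {n. real n * h \<le> T}"
    then have "real k \<le> T / h" using assms(1) by (simp add: field_simps)
    then show "k \<in> {..nat \<lceil>T / h\<rceil>}" by (simp add: le_nat_iff) linarith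
  qed
  then have "finite {n. real n * h \<le> T}" using finite_subset by blast
  then show ?thesis unfolding max_grid_error_def using assms(2) by (intro Max_ge) auto
qed

lemma no_robust_second_order_bound:
  "\<not> (\<exists>C>0. \<exists>h0>0.
          \<forall>(F :: real \<Rightarrow> real^3^3 \<Rightarrow> real^3^3) A0 Y0 \<delta> \<epsilon> h A Y.
            problem_class TYPE(2) 5 12 1 123 F A0 Y0 \<delta> \<epsilon> \<and>
            0 < h \<and> h \<le> h0 \<and>
            ode_solution F 0 1 A0 A \<and>
            strang_run TYPE(2) F 1 h Y0 Y \<and>
            rank_admissible_run TYPE(2) F 1 h Y \<longrightarrow>
            max_grid_error 1 h Y A \<le> C * (\<delta> + \<epsilon> + h^2))"
proof (intro notI, elim exE conjE)
  fix C h0 :: real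
  assume C: "C > 0" and h0: "h0 > 0"
    and H: "\<forall>(F :: real \<Rightarrow> real^3^3 \<Rightarrow> real^3^3) A0 Y0 \<delta> \<epsilon> h A Y.
            problem_class TYPE(2) 5 12 1 123 F A0 Y0 \<delta> \<epsilon> \<and>
            0 < h \<and> h \<le> h0 \<and>
            ode_solution F 0 1 A0 A \<and>
            strang_run TYPE(2) F 1 h Y0 Y \<and>
            rank_admissible_run TYPE(2) F 1 h Y \<longrightarrow>
            max_grid_error 1 h Y A \<le> C * (\<delta> + \<epsilon> + h^2)"
  define \<gamma> where "\<gamma> = beta_psi * sqrt 2 * (pi / 4)"
  obtain n1 where n1: "(1/2)^n1 < h0" using real_arch_pow_inv[OF h0, of "1/2"] by auto
  \<comment> \<open>As \<epsilon> equals \<open>\<gamma>\<close> times h^2, the supposed bound and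
    the lower bound can both be divided by h^2. What remains is
    \<open>real j \<le> 64 * C * (\<gamma> + 1)\<close>, which this choice contradicts.\<close>
  obtain n2 :: nat where n2: "64 * C * (\<gamma> + 1) < real n2" using reals_Archimedean2 by blast
  define j where "j = max 60 (max n1 n2)"
  have j: "60 \<le> j" "n1 \<le> j" "n2 \<le> j" by (auto simp: j_def)
  have hh0: "hj j \<le> h0"
  proof -
    have "hj j = (1/2)^(j\<^sup>2)" by (simp add: hj_def power_divide)
    also have "\<dots> \<le> (1/2)^n1"
    proof (rule power_decreasing)
      have "j * 1 \<le> j * j" using j by (intro mult_left_mono) auto
      then show "n1 \<le> j\<^sup>2" using j(2) unfolding power2_eq_square by linarith
    qed auto
    finally show ?thesis using n1 by simp
  qed
  obtain Y where run: "strang_run TYPE(2) (F_fam j 1) 1 (hj j) (Y0_fam j) Y"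
    using strang_run_exists[OF j(1), of 1] by auto
  obtain A where A: "ode_solution (F_fam j 1) 0 1 (Y0_fam j) A"
    using F_fam_ode_solution_exists[of 1 j] by auto
  have "problem_class TYPE(2) 5 12 1 123 (F_fam j 1) (Y0_fam j) (Y0_fam j) 0 (eps_fam j)"
    by (rule F_fam_problem_class) (use j in auto)
  moreover have "rank_admissible_run TYPE(2) (F_fam j 1) 1 (hj j) Y"
    by (rule strang_run_admissible[OF j(1) _ run]) simp
  ultimately have up: "max_grid_error 1 (hj j) Y A \<le> C * (0 + eps_fam j + (hj j)^2)"
    using H hh0 run A hj_pos[of j] by blast
  have t: "real (4 * j) * hj j \<le> 1" using transition_time_small[OF j(1)] hj_nonneg[of j] by simp
  have "sqrt 2 / 64 * real j * (hj j)\<^sup>2 \<le> norm (Y (4 * j) - A (real (4 * j) * hj j))"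
    using strang_error_lower_bound[OF j(1) run A] by simp
  also have "\<dots> \<le> C * (0 + eps_fam j + (hj j)^2)"
    using max_grid_error_ge[OF hj_pos t] up by (rule order_trans)
  also have "\<dots> = (C * (\<gamma> + 1)) * (hj j)\<^sup>2" by (simp add: eps_fam_def \<gamma>_def algebra_simps)
  finally have "sqrt 2 / 64 * real j \<le> C * (\<gamma> + 1)" by (rule mult_right_le_imp_le) simp
  moreover have "1 / 64 * real j \<le> sqrt 2 / 64 * real j" by (intro mult_right_mono divide_right_mono) auto
  moreover have "real n2 \<le> real j" using j by simp
  ultimately show False using n2 by linarith
qed

lemma family_bounds:
  "\<forall>j\<ge>3. \<forall>\<eta>\<in>{1,-1}.
        (\<exists>A. ode_solution (F_fam j \<eta>) 0 1 (Y0_fam j) A \<and>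
           (\<forall>B. ode_solution (F_fam j \<eta>) 0 1 (Y0_fam j) B \<longrightarrow> (\<forall>t\<in>{0..1}. B t = A t)) \<and>
           norm (Y0_fam j - A 0) = 0) \<and>
        (\<forall>t\<in>{0..1}. \<forall>X Z. norm (F_fam j \<eta> t X) \<le> 5 \<and>
           norm (F_fam j \<eta> t X - F_fam j \<eta> t Z) \<le> 12 * norm (X - Z)) \<and>
        (\<forall>Y\<in>fixed_rank TYPE(2). \<forall>t\<in>{0..1}.
           F_fam j \<eta> t Y = M_fam \<eta> Y + R_fam j t \<and>
           M_fam \<eta> Y \<in> tangent_space TYPE(2) Y \<and>
           norm (M_fam \<eta> Y) \<le> 4 \<and> norm (R_fam j t) \<le> eps_fam j) \<and>
        retained_singular_values (Y0_fam j) (vector [1, (hj j)^3] :: real^2) \<and>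
        derivatives_bounded (F_fam j \<eta>) 1 123"
  (is "\<forall>j\<ge>3. \<forall>\<eta>\<in>{1,-1}. ?P j \<eta>")
proof (intro allI impI ballI)
  fix j :: nat and \<eta> :: real
  assume j: "3 \<le> j" and "\<eta> \<in> {1, -1}"
  then have \<eta>: "\<bar>\<eta>\<bar> = 1" by auto
  have h: "hj j \<le> 1/512" by (rule hj_le[OF j])
  obtain A where A: "ode_solution (F_fam j \<eta>) 0 1 (Y0_fam j) A"
    using F_fam_ode_solution_exists[OF \<eta>] by blast
  have "B t = A t" if "ode_solution (F_fam j \<eta>) 0 1 (Y0_fam j) B" "t \<in> {0..1}" for B t
    by (rule ode_solution_unique[OF F_fam_lipschitz[OF \<eta>] that(1) A that(2)])
  moreover have "norm (Y0_fam j - A 0) = 0" using A by (simp add: ode_solution_def)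
  ultimately have 1: "\<exists>A. ode_solution (F_fam j \<eta>) 0 1 (Y0_fam j) A \<and>
         (\<forall>B. ode_solution (F_fam j \<eta>) 0 1 (Y0_fam j) B \<longrightarrow> (\<forall>t\<in>{0..1}. B t = A t)) \<and>
         norm (Y0_fam j - A 0) = 0" using A by blast
  have 2: "\<forall>t\<in>{0..1}. \<forall>X Z. norm (F_fam j \<eta> t X) \<le> 5 \<and>
         norm (F_fam j \<eta> t X - F_fam j \<eta> t Z) \<le> 12 * norm (X - Z)"
    using F_fam_bound[OF \<eta> h] F_fam_lipschitz[OF \<eta>] by blast
  have 3: "\<forall>Y\<in>fixed_rank TYPE(2). \<forall>t\<in>{0..1}.
         F_fam j \<eta> t Y = M_fam \<eta> Y + R_fam j t \<and>
         M_fam \<eta> Y \<in> tangent_space TYPE(2) Y \<and>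
         norm (M_fam \<eta> Y) \<le> 4 \<and> norm (R_fam j t) \<le> eps_fam j"
    using M_fam_tangent norm_M_fam_le[OF \<eta>] norm_R_fam_le_eps by (simp add: F_fam_def fixed_rank_2)
  have 4: "derivatives_bounded (F_fam j \<eta>) 1 123"
    by (rule F_fam_derivatives_bounded[OF \<eta>]) (use h in simp)
  show "?P j \<eta>" by (intro conjI 1 2 3 4 Y0_fam_retained)
qed

lemma family_strang_error:
  "\<forall>\<^sub>F j in sequentially.
        (\<forall>\<eta>\<in>{1,-1}.
           (\<exists>Y. strang_run TYPE(2) (F_fam j \<eta>) 1 (hj j) (Y0_fam j) Y) \<and>
           (\<forall>Y. strang_run TYPE(2) (F_fam j \<eta>) 1 (hj j) (Y0_fam j) Y \<longrightarrow>
              rank_admissible_run TYPE(2) (F_fam j \<eta>) 1 (hj j) Y)) \<and>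
        (\<forall>(Y :: real \<Rightarrow> nat \<Rightarrow> real^3^3) (A :: real \<Rightarrow> real \<Rightarrow> real^3^3).
           (\<forall>\<eta>\<in>{1,-1}. strang_run TYPE(2) (F_fam j \<eta>) 1 (hj j) (Y0_fam j) (Y \<eta>) \<and>
              ode_solution (F_fam j \<eta>) 0 1 (Y0_fam j) (A \<eta>)) \<longrightarrow>
           Max ((\<lambda>\<eta>. norm (Y \<eta> (4 * j) - A \<eta> (4 * real j * hj j))) ` {1,-1})
             \<ge> sqrt 2 / 64 * real j * (hj j)^2)"
  using eventually_ge_at_top[of 60]
proof eventually_elim
  case (elim j)
  have abs1: "\<bar>\<eta>\<bar> = 1" if "\<eta> \<in> {1, -1}" for \<eta> :: real using that by auto
  have "Max ((\<lambda>\<eta>. norm (Y \<eta> (4 * j) - A \<eta> (4 * real j * hj j))) ` {1,-1}) \<ge> sqrt 2 / 64 * real j * (hj j)^2"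
    if "\<forall>\<eta>\<in>{1,-1}. strang_run TYPE(2) (F_fam j \<eta>) 1 (hj j) (Y0_fam j) (Y \<eta>) \<and>
            ode_solution (F_fam j \<eta>) 0 1 (Y0_fam j) (A \<eta>)"
    for Y :: "real \<Rightarrow> nat \<Rightarrow> real^3^3" and A :: "real \<Rightarrow> real \<Rightarrow> real^3^3"
  proof -
    have "sqrt 2 / 64 * real j * (hj j)^2 \<le> norm (Y 1 (4 * j) - A 1 (4 * real j * hj j))"
      using that by (intro strang_error_lower_bound[OF elim]) auto
    also have "\<dots> \<le> Max ((\<lambda>\<eta>. norm (Y \<eta> (4 * j) - A \<eta> (4 * real j * hj j))) ` {1,-1})"
      by (intro Max_ge) auto
    finally show ?thesis .
  qed
  then show ?case using strang_run_exists[OF elim abs1] strang_run_admissible[OF elim abs1] by blast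
qed

theorem theorem3p1:
  shows
    "(\<forall>j\<ge>3. \<forall>\<eta>\<in>{1,-1}.
        (\<exists>A. ode_solution (F_fam j \<eta>) 0 1 (Y0_fam j) A \<and>
           (\<forall>B. ode_solution (F_fam j \<eta>) 0 1 (Y0_fam j) B \<longrightarrow> (\<forall>t\<in>{0..1}. B t = A t)) \<and>
           norm (Y0_fam j - A 0) = 0) \<and>
        (\<forall>t\<in>{0..1}. \<forall>X Z. norm (F_fam j \<eta> t X) \<le> 5 \<and>
           norm (F_fam j \<eta> t X - F_fam j \<eta> t Z) \<le> 12 * norm (X - Z)) \<and>
        (\<forall>Y\<in>fixed_rank TYPE(2). \<forall>t\<in>{0..1}.
           F_fam j \<eta> t Y = M_fam \<eta> Y + R_fam j t \<and>
           M_fam \<eta> Y \<in> tangent_space TYPE(2) Y \<and>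
           norm (M_fam \<eta> Y) \<le> 4 \<and> norm (R_fam j t) \<le> eps_fam j) \<and>
        retained_singular_values (Y0_fam j) (vector [1, (hj j)^3] :: real^2) \<and>
        derivatives_bounded (F_fam j \<eta>) 1 123)
     \<and>
     (\<forall>\<^sub>F j in sequentially.
        (\<forall>\<eta>\<in>{1,-1}.
           (\<exists>Y. strang_run TYPE(2) (F_fam j \<eta>) 1 (hj j) (Y0_fam j) Y) \<and>
           (\<forall>Y. strang_run TYPE(2) (F_fam j \<eta>) 1 (hj j) (Y0_fam j) Y \<longrightarrow>
              rank_admissible_run TYPE(2) (F_fam j \<eta>) 1 (hj j) Y)) \<and>
        (\<forall>(Y :: real \<Rightarrow> nat \<Rightarrow> real^3^3) (A :: real \<Rightarrow> real \<Rightarrow> real^3^3).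
           (\<forall>\<eta>\<in>{1,-1}. strang_run TYPE(2) (F_fam j \<eta>) 1 (hj j) (Y0_fam j) (Y \<eta>) \<and>
              ode_solution (F_fam j \<eta>) 0 1 (Y0_fam j) (A \<eta>)) \<longrightarrow>
           Max ((\<lambda>\<eta>. norm (Y \<eta> (4 * j) - A \<eta> (4 * real j * hj j))) ` {1,-1})
             \<ge> sqrt 2 / 64 * real j * (hj j)^2))
     \<and>
     \<not> (\<exists>C>0. \<exists>h0>0.
          \<forall>(F :: real \<Rightarrow> real^3^3 \<Rightarrow> real^3^3) A0 Y0 \<delta> \<epsilon> h A Y.
            problem_class TYPE(2) 5 12 1 123 F A0 Y0 \<delta> \<epsilon> \<and>
            0 < h \<and> h \<le> h0 \<and>
            ode_solution F 0 1 A0 A \<and>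
            strang_run TYPE(2) F 1 h Y0 Y \<and>
            rank_admissible_run TYPE(2) F 1 h Y \<longrightarrow>
            max_grid_error 1 h Y A \<le> C * (\<delta> + \<epsilon> + h^2))"
  by (intro conjI family_bounds family_strang_error no_robust_second_order_bound)

end
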